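(* For any given integers $a,m$ with $1\le a< m/2$ and any $(x,y)\in\{(1,0),(0,1),(1,1)\}$ we have $$p_{n}(a,m-a,m; x,y)\sim c_{a,m}(x)\,p_n(x,y)\qquad\text{as } n\to +\infty,$$ where $$c_{a,m}(0)=\frac{1}{2},\qquad c_{a,m}(1)=\frac{\psi\left(\frac12+\frac{a}{2m}\right)-\psi\left(\frac{a}{2m}\right)}{2\pi\csc(a\pi/m)},$$ and where $\psi(u)=\Gamma'(u)/\Gamma(u)$ is the digamma function.
   Context: A partition $\lambda$ is a finite nonincreasing sequence of positive integers (its parts), possibly empty; $\ell(\lambda)$ is its number of parts and $|\lambda|$ the sum of its parts (so $\ell(\varnothing)=|\varnothing|=0$). $\mathcal{P}$ is the set of all partitions and $\mathcal{D}$ the set of all partitions with pairwise distinct parts. For integers $m\ge 1$ and $1\le c\le m$, $\ell_{c,m}(\lambda)$ is the number of parts of $\lambda$ congruent to $c$ modulo $m$, and $\ell_{c,m}(\lambda,\mu):=\ell_{c,m}(\lambda)+\ell_{c,m}(\mu)$ for $(\lambda,\mu)\in\mathcal{P}\times\mathcal{D}$. For real $x,y\ge 0$ and integer $n\ge 0$ define $$p_n(x,y)=\sum_{\substack{(\lambda, \mu)\in \mathcal{P}\times\mathcal{D}\\ |\lambda|+|\mu|=n}}x^{\ell(\lambda)}y^{\ell(\mu)},$$ and, for residues $a\neq b$ in $\{1,\dots,m\}$, $$p_{n}(a,b,m; x,y):=\sum_{\substack{(\lambda, \mu)\in\mathcal{P}\times \mathcal{D}\\ |\lambda|+|\mu|=n\\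 \ell_{a,m}(\lambda,\mu)> \ell_{b,m}(\lambda,\mu)}} x^{\ell(\lambda)}y^{\ell(\mu)},$$ with the convention $0^0=1$. Thus $p_n(1,0)$, $p_n(0,1)$, $p_n(1,1)$ are the numbers of partitions, of partitions into distinct parts, and of overpartitions of $n$, respectively. *)

theory Defs
  imports
    "HOL-Analysis.Analysis"
    "HOL-Library.Landau_Symbols"
    "HOL-Number_Theory.Cong"
begin

definition partitions :: "nat list set" where
  "partitions = {xs. sorted_wrt (\<ge>) xs \<and> (\<forall>k\<in>set xs. 0 < k)}"

definition distinct_partitions :: "nat list set" where
  "distinct_partitions = {xs \<in> partitions. distinct xs}"

definition residue_parts :: "nat \<Rightarrow> nat \<Rightarrow> nat list \<Rightarrow> nat" where
  "residue_parts c m xs = length (filter (\<lambda>k. [k = c] (mod m)) xs)"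

definition residue_parts_pair :: "nat \<Rightarrow> nat \<Rightarrow> nat list \<times> nat list \<Rightarrow> nat" where
  "residue_parts_pair c m z = residue_parts c m (fst z) + residue_parts c m (snd z)"

definition partition_pairs :: "nat \<Rightarrow> (nat list \<times> nat list) set" where
  "partition_pairs n =
     {z \<in> partitions \<times> distinct_partitions. sum_list (fst z) + sum_list (snd z) = n}"

text \<open>The sums below run over finite sets (recall that a sum over an infinite set is \<open>0\<close>).\<close>

lemma finite_partition_pairs: "finite (partition_pairs n)"
proof -
  let ?L = "{xs. set xs \<subseteq> {..n} \<and> length xs \<le> n}"
  have bound: "length xs \<le> sum_list xs \<and> set xs \<subseteq> {..sum_list xs}"
    if "\<forall>k\<in>set xs. 0 < k" for xs :: "nat list"
    using that by (induction xs) (auto simp: subset_iff trans_le_add2)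
  have mem: "xs \<in> ?L" if "xs \<in> partitions" "sum_list xs \<le> n" for xs
  proof -
    have "length xs \<le> sum_list xs \<and> set xs \<subseteq> {..sum_list xs}"
      using that(1) by (intro bound) (simp add: partitions_def)
    with that(2) show ?thesis by auto
  qed
  have "partition_pairs n \<subseteq> ?L \<times> ?L"
  proof
    fix z assume "z \<in> partition_pairs n"
    then have "fst z \<in> partitions" "sum_list (fst z) \<le> n" "snd z \<in> partitions" "sum_list (snd z) \<le> n"
      by (auto simp: partition_pairs_def distinct_partitions_def)
    then have "fst z \<in> ?L" "snd z \<in> ?L"
      using mem[of "fst z"] mem[of "snd z"] by simp_all
    then show "z \<in> ?L \<times> ?L"
      by (simp add: mem_Times_iff)
  qed
  moreover have "finite ?L"
    by (rule finite_lists_length_le) simp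
  ultimately show ?thesis
    by (meson finite_SigmaI finite_subset)
qed

text \<open>The convention \<open>0\<^sup>0 = 1\<close> is that of \<^term>\<open>(^)\<close> with a natural exponent.\<close>

definition weighted_count :: "nat \<Rightarrow> real \<Rightarrow> real \<Rightarrow> real" where
  "weighted_count n x y =
     (\<Sum>z\<in>partition_pairs n. x ^ length (fst z) * y ^ length (snd z))"

definition biased_count :: "nat \<Rightarrow> nat \<Rightarrow> nat \<Rightarrow> nat \<Rightarrow> real \<Rightarrow> real \<Rightarrow> real" where
  "biased_count n a b m x y =
     (\<Sum>z \<in> {z \<in> partition_pairs n. residue_parts_pair a m z > residue_parts_pair b m z}.
        x ^ length (fst z) * y ^ length (snd z))"

text \<open>Only the values at \<open>x = 0\<close> and \<open>x = 1\<close> are meaningful; \<open>1 / sin\<close> is the cosecant.\<close>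

definition bias_const :: "nat \<Rightarrow> nat \<Rightarrow> real \<Rightarrow> real" where
  "bias_const a m x =
     (if x = 0 then 1 / 2
      else (Digamma (1 / 2 + real a / (2 * real m)) - Digamma (real a / (2 * real m)))
             / (2 * pi * (1 / sin (real a * pi / real m))))"

end

theory Submission
  imports Defs
begin

text \<open>
  Write \<open>b = m - a\<close>, \<open>Q = q\<^sup>m\<close> and let \<open>d\<close> be the excess of the parts congruent to \<open>a\<close> over those
  congruent to \<open>b\<close>. Since \<open>a + b = m\<close>, theta function identities give the generating function of the
  pairs with excess \<open>d \<ge> 0\<close> in closed form: it is a series \<open>H(q)\<close> independent of \<open>d\<close>, with
  nonnegative coefficients \<open>h(n)\<close>, times \<open>\<Sum>\<^sub>j (-1)\<^sup>j q\<^bsup>d (a + m j) + m j (j + 1) / 2\<^esup>\<close> for \<open>(x, y) = (1, 0)\<close>,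
  times \<open>2 \<Sum>\<^sub>j (-1)\<^sup>j q\<^bsup>d (a + m j)\<^esup>\<close> for \<open>(1, 1)\<close> and times \<open>q\<^bsup>a d + m d (d - 1) / 2\<^esup>\<close> for \<open>(0, 1)\<close>.

  No precise asymptotics of \<open>h\<close> are needed, only \<open>h(n - m) \<le> h(n)\<close> and \<open>h(n) - h(n - m) = o(h(n))\<close>. For
  \<open>x = 1\<close>, summing over \<open>d > 0\<close> for fixed \<open>j\<close> samples \<open>h\<close> with step \<open>a + m j\<close> and yields \<open>U(n) / (a + m j)\<close>
  up to \<open>o(U(n))\<close>, where \<open>U\<close> is unchanged when \<open>a\<close> and \<open>b\<close> are exchanged; the alternating series in \<open>j\<close> is
  controlled by its partial sums, and \<open>\<Sum>\<^sub>j (-1)\<^sup>j / (a + m j)\<close> is a difference of digamma values. For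
  \<open>(0, 1)\<close> the exponents belonging to \<open>a\<close> and to \<open>b\<close> interlace within each residue class modulo \<open>m\<close>.

  To see that \<open>h\<close> varies slowly, factor \<open>H = R V\<close>, where \<open>R\<close> is \<open>1 / ((1 - Q) (1 - Q\<^sup>2) (1 - Q\<^sup>3))\<close> times a
  polynomial. The coefficients of \<open>R\<close> grow quadratically and their differences linearly, while those of
  the logarithmic derivative of \<open>V\<close> are at most quadratic, so that the end terms of the convolution
  \<open>h(n) = \<Sum>\<^sub>k R(k) V(n - k)\<close> are \<open>O(h(n) / n)\<close>.
\<close>

unbundle fps_syntax
unbundle no vec_syntax

section \<open>The digamma function\<close>

text \<open>All series identities are congruences between finite products and sums, since
  coefficient n sees only finitely many factors. The closed form in d arises as follows: the
  q-binomial theorem expands the two residue classes, the part with excess d becomes a sum over k,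
  and the sums for neighbouring d are tied by recurrences that leave no freedom once the limit for
  large d is known. The obstacle to estimating h is that its values in different residue classes
  modulo m need not be comparable and may vanish in some, hence every comparison is made in steps of
  m. Quadratic growth of R is what dominates the logarithmic derivative: n V(n) is the convolution
  of V with it, so replacing it by a multiple of R bounds V(n - k) by a multiple of h(n) / n. The
  size of U is never found. The total count is positive plus negative plus a negligible zero excess,
  so with S and S' the alternating series for a and for b the constant is S / (S + S'), and the
  cosecant is what the reflection formula makes of S + S'.\<close>

lemma Digamma_reflection:
  fixes u :: real
  assumes "0 < u" "u < 1"
  shows "Digamma (1 - u) - Digamma u = pi * cot (pi * u)"
proof -
  \<comment> \<open>The reflection formula is taken for 1 / Gamma, which is entire, so that both
    sides can be differentiated without regard to poles.\<close>
  have eq: "rGamma x * rGamma (1 - x) = sin (pi * x) / pi" for x :: real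
  proof -
    have "complex_of_real (rGamma x * rGamma (1 - x)) = rGamma (of_real x) * rGamma (1 - of_real x)"
      by (simp flip: rGamma_complex_of_real)
    also have "\<dots> = of_real (sin (pi * x) / pi)"
      by (subst rGamma_reflection_complex) (simp flip: sin_of_real)
    finally show ?thesis by (simp only: of_real_eq_iff)
  qed
  have np: "u \<notin> \<int>\<^sub>\<le>\<^sub>0" "1 - u \<notin> \<int>\<^sub>\<le>\<^sub>0"
    using assms by (auto elim!: nonpos_Ints_cases)
  have "((\<lambda>x. rGamma x * rGamma (1 - x)) has_field_derivative
          (rGamma u * rGamma (1 - u)) * (Digamma (1 - u) - Digamma u)) (at u)"
    using np by (auto intro!: derivative_eq_intros simp: algebra_simps)
  moreover have "((\<lambda>x. rGamma x * rGamma (1 - x)) has_field_derivative cos (pi * u)) (at u)"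
    unfolding eq by (auto intro!: derivative_eq_intros)
  ultimately have "(rGamma u * rGamma (1 - u)) * (Digamma (1 - u) - Digamma u) = cos (pi * u)"
    by (rule DERIV_unique)
  moreover have "sin (pi * u) \<noteq> 0"
    using assms sin_gt_zero[of "pi * u"] by (simp add: mult_less_cancel_left_pos)
  ultimately show ?thesis
    unfolding eq by (simp add: cot_def field_simps)
qed

text \<open>Subtracting two instances of \<open>Digamma_LIMSEQ\<close> cancels the logarithms. As 1
  / (\<alpha> + 2 j) is half of 1 / (\<alpha>/2 + j), one instance supplies the even terms and the
  other the odd ones.\<close>

lemma alternating_sums_Digamma:
  fixes \<alpha> :: real
  assumes "0 < \<alpha>"
  shows "(\<lambda>J. \<Sum>j<2 * J. (-1) ^ j / (\<alpha> + real j))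
           \<longlonglongrightarrow> (Digamma (1 / 2 + \<alpha> / 2) - Digamma (\<alpha> / 2)) / 2"
proof -
  have "(\<lambda>J. ((of_real (ln (real J)) - (\<Sum>j<J. inverse (1 / 2 + \<alpha> / 2 + of_nat j)))
            - (of_real (ln (real J)) - (\<Sum>j<J. inverse (\<alpha> / 2 + of_nat j)))) / 2)
          \<longlonglongrightarrow> (Digamma (1 / 2 + \<alpha> / 2) - Digamma (\<alpha> / 2)) / 2"
    using assms by (intro tendsto_intros Digamma_LIMSEQ) auto
  moreover have "((of_real (ln (real J)) - (\<Sum>j<J. inverse (1 / 2 + \<alpha> / 2 + of_nat j)))
            - (of_real (ln (real J)) - (\<Sum>j<J. inverse (\<alpha> / 2 + of_nat j)))) / 2
         = (\<Sum>j<2 * J. (-1) ^ j / (\<alpha> + real j))" for J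
  proof (induction J)
    case (Suc J)
    have "inverse (1 / 2 + \<alpha> / 2 + real J) / 2 = 1 / (\<alpha> + (1 + 2 * real J))"
         "inverse (\<alpha> / 2 + real J) / 2 = 1 / (\<alpha> + 2 * real J)"
      using assms by (auto simp: field_simps)
    moreover have "(\<Sum>j<2 * Suc J. (-1) ^ j / (\<alpha> + real j)) = (\<Sum>j<2 * J. (-1) ^ j / (\<alpha> + real j))
        + 1 / (\<alpha> + 2 * real J) - 1 / (\<alpha> + (1 + 2 * real J))" by simp
    ultimately show ?case
      using Suc unfolding sum.lessThan_Suc by argo
  qed simp
  ultimately show ?thesis by simp
qed

text \<open>With \<alpha> = a / m, \<open>D\<close> is the alternating series of 1 / (\<alpha> + j).
  Reflection collapses D(\<alpha>) + D(1 - \<alpha>) to pi / sin(pi \<alpha>), so the cosecant is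
  the normalisation by the two opposite biases.\<close>

lemma bias_const_eq:
  assumes "1 \<le> a" "2 * a < m"
  defines "D \<equiv> \<lambda>u. (Digamma (1 / 2 + u / 2) - Digamma (u / 2)) / (2 :: real)"
  shows "bias_const a m 1 = D (real a / real m) / (D (real a / real m) + D (real (m - a) / real m))"
    and "D (real a / real m) + D (real (m - a) / real m) > 0"
proof -
  define \<alpha> where "\<alpha> = real a / real m"
  have \<alpha>: "0 < \<alpha>" "\<alpha> < 1 / 2" using assms by (auto simp: \<alpha>_def field_simps)
  have b: "real (m - a) / real m = 1 - \<alpha>"
    using assms by (simp add: \<alpha>_def of_nat_diff field_simps)
  have s: "sin (pi * \<alpha>) > 0" using \<alpha> by (intro sin_gt_zero) (auto simp: mult_less_cancel_left_pos)
  have s2: "sin (pi * (\<alpha>/2)) > 0" using \<alpha> by (intro sin_gt_zero) (auto simp: mult_less_cancel_left_pos)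
  have c2: "cos (pi * (\<alpha>/2)) > 0" using \<alpha> by (intro cos_gt_zero) (auto simp: field_simps)
  \<comment> \<open>The four digamma values in D(\<alpha>) + D(1 - \<alpha>) regroup into two
    reflected pairs, at \<alpha>/2 and at 1/2 - \<alpha>/2.\<close>
  have 1: "Digamma (1 - \<alpha> / 2) - Digamma (\<alpha> / 2) = pi * cot (pi * (\<alpha> / 2))"
    using \<alpha> by (intro Digamma_reflection) auto
  have 2: "Digamma (1 - (1 / 2 - \<alpha> / 2)) - Digamma (1 / 2 - \<alpha> / 2) = pi * cot (pi * (1 / 2 - \<alpha> / 2))"
    using \<alpha> by (intro Digamma_reflection) auto
  have 3: "cot (pi * (1 / 2 - \<alpha> / 2)) = sin (pi * (\<alpha>/2)) / cos (pi * (\<alpha>/2))"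
  proof -
    have e: "pi * (1 / 2 - \<alpha> / 2) = pi / 2 - pi * (\<alpha>/2)" by (simp add: algebra_simps)
    show ?thesis unfolding e by (simp add: cot_def cos_diff sin_diff)
  qed
  have 4: "sin (pi * \<alpha>) = 2 * sin (pi * (\<alpha>/2)) * cos (pi * (\<alpha>/2))"
    using sin_double[of "pi * (\<alpha>/2)"] by simp
  have r1: "1 - (1 / 2 - \<alpha> / 2) = 1 / 2 + \<alpha> / 2" "1 / 2 + (1 - \<alpha>) / 2 = 1 - \<alpha> / 2"
     "(1 - \<alpha>) / 2 = 1 / 2 - \<alpha> / 2" by (simp_all add: field_simps)
  have "2 * (D \<alpha> + D (1 - \<alpha>)) = pi * (cot (pi * (\<alpha> / 2)) + sin (pi * (\<alpha>/2)) / cos (pi * (\<alpha>/2)))"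
    using 1 2[unfolded 3] unfolding D_def r1 by argo
  also have "cot (pi * (\<alpha> / 2)) + sin (pi * (\<alpha>/2)) / cos (pi * (\<alpha>/2))
     = (cos (pi * (\<alpha>/2)) ^ 2 + sin (pi * (\<alpha>/2)) ^ 2) / (sin (pi * (\<alpha>/2)) * cos (pi * (\<alpha>/2)))"
    using s2 c2 by (simp add: cot_def field_simps power2_eq_square)
  also have "\<dots> = 2 / sin (pi * \<alpha>)"
    unfolding 4 using s2 c2 by (simp add: field_simps)
  finally have "2 * (D \<alpha> + D (1 - \<alpha>)) = 2 * (pi / sin (pi * \<alpha>))" by simp
  then have sum: "D \<alpha> + D (1 - \<alpha>) = pi / sin (pi * \<alpha>)" unfolding mult_cancel_left by simp
  show "D (real a / real m) + D (real (m - a) / real m) > 0"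
    unfolding b \<alpha>_def[symmetric] sum using s by simp
  have e: "real a / (2 * real m) = \<alpha> / 2" "real a * pi / real m = pi * \<alpha>"
    "real a / real m = \<alpha>"
    by (simp_all add: \<alpha>_def field_simps)
  then have "bias_const a m 1 = D \<alpha> / (pi / sin (pi * \<alpha>))"
    unfolding bias_const_def e D_def using s by simp
  then show "bias_const a m 1 = D (real a / real m) / (D (real a / real m) + D (real (m - a) / real m))"
    by (simp only: b e sum)
qed

section \<open>Generating functions of partition pairs\<close>

text \<open>The bound on the parts makes the generating function a finite product and provides an
  induction on the largest admissible part.\<close>

definition bounded_partitions :: "nat \<Rightarrow> nat \<Rightarrow> nat list set" where
  "bounded_partitions N n = {xs \<in> partitions. set xs \<subseteq> {..N} \<and> sum_list xs = n}"

lemma finite_bounded_partitions [simp]: "finite (bounded_partitions N n)"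
proof (rule finite_subset)
  show "bounded_partitions N n \<subseteq> {xs. set xs \<subseteq> {..N} \<and> length xs \<le> n}"
  proof
    fix xs assume "xs \<in> bounded_partitions N n"
    moreover have "length xs \<le> sum_list xs" if "\<forall>k\<in>set xs. 0 < k" for xs :: "nat list"
      using that by (induction xs) (auto simp: trans_le_add2)
    ultimately show "xs \<in> {xs. set xs \<subseteq> {..N} \<and> length xs \<le> n}"
      by (auto simp: bounded_partitions_def partitions_def)
  qed
qed (simp add: finite_lists_length_le)

lemma bounded_partitions_0: "bounded_partitions 0 n = (if n = 0 then {[]} else {})"
proof -
  have "xs = []" if "xs \<in> partitions" "set xs \<subseteq> {..0}" for xs
    using that by (cases xs) (auto simp: partitions_def)
  then have "bounded_partitions 0 n \<subseteq> {[]}" by (auto simp: bounded_partitions_def)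
  moreover have "[] \<in> bounded_partitions 0 n \<longleftrightarrow> n = 0"
    by (auto simp: bounded_partitions_def partitions_def)
  ultimately show ?thesis by auto
qed

lemma bounded_partitions_unique:
  "xs \<in> bounded_partitions N i \<Longrightarrow> xs \<in> bounded_partitions N j \<Longrightarrow> i = j"
  by (simp add: bounded_partitions_def)

lemma Suc_notin_bounded_partitions: "Suc N # xs \<notin> bounded_partitions N n"
  by (simp add: bounded_partitions_def)

lemma bounded_partitions_Suc:
  "bounded_partitions (Suc N) n = bounded_partitions N n \<union>
     (if Suc N \<le> n then (#) (Suc N) ` bounded_partitions (Suc N) (n - Suc N) else {})"
  (is "?L = ?R")
proof (intro equalityI subsetI)
  fix xs assume xs: "xs \<in> ?L"
  show "xs \<in> ?R"
  proof (cases "Suc N \<in> set xs")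
    case True
    then obtain k ys where ys: "xs = k # ys" by (cases xs) auto
    have "k = Suc N"
      using xs True unfolding ys by (auto simp: bounded_partitions_def partitions_def)
    with xs ys show ?thesis
      by (auto simp: bounded_partitions_def partitions_def)
  next
    case False
    then have "set xs \<subseteq> {..N}"
      using xs le_Suc_eq by (auto simp: bounded_partitions_def)
    with xs show ?thesis by (auto simp: bounded_partitions_def)
  qed
next
  fix xs assume "xs \<in> ?R"
  then show "xs \<in> ?L"
    by (auto simp: bounded_partitions_def partitions_def split: if_splits)
qed

text \<open>The largest part heads the list. Unlike in the unrestricted case its removal lowers the
  bound to \<open>N\<close>, which is why the factor becomes 1 + v q^k instead of a geometric
  series.\<close>

lemma bounded_distinct_partitions_Suc:
  "bounded_partitions (Suc N) n \<inter> Collect distinct = bounded_partitions N n \<inter> Collect distinct \<union>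
     (if Suc N \<le> n then (#) (Suc N) ` (bounded_partitions N (n - Suc N) \<inter> Collect distinct) else {})"
  (is "?L = ?R")
proof (intro equalityI subsetI)
  fix xs assume xs: "xs \<in> ?L"
  then consider "xs \<in> bounded_partitions N n"
    | ys where "Suc N \<le> n" "xs = Suc N # ys" "ys \<in> bounded_partitions (Suc N) (n - Suc N)"
    unfolding bounded_partitions_Suc[of N n] by (auto split: if_splits)
  then show "xs \<in> ?R"
  proof cases
    case 2
    then have "Suc N \<notin> set ys" "distinct ys" using xs by auto
    then have "ys \<in> bounded_partitions N (n - Suc N)"
      using 2(3) le_Suc_eq by (auto simp: bounded_partitions_def)
    then show ?thesis using 2 \<open>distinct ys\<close> by simp
  qed (use xs in simp)
next
  fix xs assume xs: "xs \<in> ?R"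
  have mono: "bounded_partitions N k \<subseteq> bounded_partitions (Suc N) k" for k
    by (auto simp: bounded_partitions_def)
  have notin: "Suc N \<notin> set ys" if "ys \<in> bounded_partitions N k" for ys k
    using that by (auto simp: bounded_partitions_def)
  from xs show "xs \<in> ?L"
    using mono[of "n - Suc N"] notin unfolding bounded_partitions_Suc[of N n]
    by (force split: if_splits)
qed

text \<open>Coefficient form of B (1 - c q^w) = A. It drives the partition count, the geometric
  series and the lower bound for \<open>three_parts\<close>.\<close>

lemma fps_nth_mult_inverse_one_minus:
  fixes A :: "'a::field fps"
  assumes "0 < w"
  shows "(A * inverse (1 - fps_const c * fps_X ^ w)) $ n =
     A $ n + (if w \<le> n then c * (A * inverse (1 - fps_const c * fps_X ^ w)) $ (n - w) else 0)"
proof -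
  let ?B = "A * inverse (1 - fps_const c * fps_X ^ w)"
  have "inverse (1 - fps_const c * fps_X ^ w) * (1 - fps_const c * fps_X ^ w) = 1"
    using assms by (intro inverse_mult_eq_1) simp
  then have *: "B * (1 - fps_const c * fps_X ^ w) = A" if "B = ?B" for B
    using that by (simp add: mult.assoc)
  have "B = A + fps_const c * (fps_X ^ w * B)" if "B = ?B" for B
    using *[OF that] by (simp add: algebra_simps)
  then have "?B $ n = (A + fps_const c * (fps_X ^ w * ?B)) $ n" by metis
  then show ?thesis by (simp add: fps_X_power_mult_nth)
qed

lemma sum_bounded_partitions:
  fixes u :: "nat \<Rightarrow> real"
  shows "(\<Sum>xs\<in>bounded_partitions N n. prod_list (map u xs)) =
    (\<Prod>k=1..N. inverse (1 - fps_const (u k) * fps_X ^ k)) $ n"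
proof (induction N arbitrary: n)
  case 0
  then show ?case by (simp add: bounded_partitions_0)
next
  case (Suc N)
  let ?A = "\<Prod>k=1..N. inverse (1 - fps_const (u k) * fps_X ^ k)"
  have A: "(\<Prod>k=1..Suc N. inverse (1 - fps_const (u k) * fps_X ^ k)) =
     ?A * inverse (1 - fps_const (u (Suc N)) * fps_X ^ Suc N)"
    by (subst prod.cl_ivl_Suc, rule if_not_P) simp
  show ?case
  \<comment> \<open>Removing one part \<open>Suc N\<close> leaves the bound on the parts unchanged,
    so a second induction on the size is needed for fixed \<open>N\<close>.\<close>
  proof (induction n rule: less_induct)
    case (less n)
    define S where "S = (\<lambda>N n. \<Sum>xs\<in>bounded_partitions N n. prod_list (map u xs))"
    have disj: "bounded_partitions N n \<inter>
        (if Suc N \<le> n then (#) (Suc N) ` bounded_partitions (Suc N) (n - Suc N) else {}) = {}"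
      using Suc_notin_bounded_partitions by (auto split: if_splits)
    have "S (Suc N) n = S N n +
       (\<Sum>xs\<in>(if Suc N \<le> n then (#) (Suc N) ` bounded_partitions (Suc N) (n - Suc N) else {}).
          prod_list (map u xs))"
      unfolding S_def bounded_partitions_Suc[of N n] by (rule sum.union_disjoint) (use disj in simp_all)
    also have "(\<Sum>xs\<in>(if Suc N \<le> n then (#) (Suc N) ` bounded_partitions (Suc N) (n - Suc N) else {}).
          prod_list (map u xs)) = (if Suc N \<le> n then u (Suc N) * S (Suc N) (n - Suc N) else 0)"
      by (simp add: sum.reindex sum_distrib_left S_def)
    finally have rec: "S (Suc N) n = S N n + (if Suc N \<le> n then u (Suc N) * S (Suc N) (n - Suc N) else 0)" .
    have IH: "S (Suc N) (n - Suc N) =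
        (?A * inverse (1 - fps_const (u (Suc N)) * fps_X ^ Suc N)) $ (n - Suc N)" if "Suc N \<le> n"
      using less.IH[of "n - Suc N"] that unfolding S_def A by linarith
    have "(?A * inverse (1 - fps_const (u (Suc N)) * fps_X ^ Suc N)) $ n = S (Suc N) n"
      unfolding rec using IH Suc.IH[of n]
      by (subst fps_nth_mult_inverse_one_minus) (simp_all only: S_def split: if_split, simp)
    then show ?case unfolding A S_def by (rule sym)
  qed
qed

lemma sum_bounded_distinct_partitions:
  fixes v :: "nat \<Rightarrow> real"
  shows "(\<Sum>xs\<in>bounded_partitions N n \<inter> Collect distinct. prod_list (map v xs)) =
    (\<Prod>k=1..N. 1 + fps_const (v k) * fps_X ^ k) $ n"
proof (induction N arbitrary: n)
  case 0
  then show ?case by (simp add: bounded_partitions_0)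
next
  case (Suc N)
  define S where "S = (\<lambda>N n. \<Sum>xs\<in>bounded_partitions N n \<inter> Collect distinct. prod_list (map v xs))"
  let ?T = "if Suc N \<le> n then (#) (Suc N) ` (bounded_partitions N (n - Suc N) \<inter> Collect distinct) else {}"
  have disj: "bounded_partitions N n \<inter> Collect distinct \<inter> ?T = {}"
    using Suc_notin_bounded_partitions by (auto split: if_splits)
  have "S (Suc N) n = S N n + (\<Sum>xs\<in>?T. prod_list (map v xs))"
    unfolding S_def bounded_distinct_partitions_Suc[of N n]
    by (rule sum.union_disjoint) (use disj in simp_all)
  also have "(\<Sum>xs\<in>?T. prod_list (map v xs)) = (if Suc N \<le> n then v (Suc N) * S N (n - Suc N) else 0)"
    by (simp add: sum.reindex sum_distrib_left S_def)
  also have "S N n + \<dots> = ((\<Prod>k=1..N. 1 + fps_const (v k) * fps_X ^ k) *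
      (1 + fps_const (v (Suc N)) * fps_X ^ Suc N)) $ n"
    unfolding S_def Suc.IH by (simp add: distrib_left fps_X_power_mult_right_nth mult.assoc[symmetric]
        mult.commute[of _ "fps_const _"] del: power_Suc)
  also have "\<dots> = (\<Prod>k=1..Suc N. 1 + fps_const (v k) * fps_X ^ k) $ n"
    by (subst prod.cl_ivl_Suc, subst if_not_P) simp_all
  finally show ?case unfolding S_def .
qed

lemma partition_pairs_eq:
  assumes "n \<le> N"
  shows "partition_pairs n =
    (\<Union>i\<in>{0..n}. bounded_partitions N i \<times> (bounded_partitions N (n - i) \<inter> Collect distinct))"
proof -
  have "set xs \<subseteq> {..N}" if "sum_list xs \<le> n" for xs :: "nat list"
    using that assms member_le_sum_list order_trans by fastforce
  then show ?thesis
    by (auto simp: partition_pairs_def bounded_partitions_def distinct_partitions_def)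
qed

text \<open>The weights are arbitrary functions of the part so that they can carry x and y together
  with a marker of the residue class.\<close>

lemma sum_partition_pairs:
  fixes u v :: "nat \<Rightarrow> real"
  assumes "n \<le> N"
  shows "(\<Sum>z\<in>partition_pairs n. prod_list (map u (fst z)) * prod_list (map v (snd z))) =
    (\<Prod>k=1..N. (1 + fps_const (v k) * fps_X ^ k) * inverse (1 - fps_const (u k) * fps_X ^ k)) $ n"
proof -
  have "(\<Sum>z\<in>partition_pairs n. prod_list (map u (fst z)) * prod_list (map v (snd z))) =
    (\<Sum>i=0..n. \<Sum>z\<in>bounded_partitions N i \<times> (bounded_partitions N (n - i) \<inter> Collect distinct).
        prod_list (map u (fst z)) * prod_list (map v (snd z)))"
    unfolding partition_pairs_eq[OF assms]
  proof (rule sum.UNION_disjoint)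
    show "\<forall>i\<in>{0..n}. \<forall>j\<in>{0..n}. i \<noteq> j \<longrightarrow>
        bounded_partitions N i \<times> (bounded_partitions N (n - i) \<inter> Collect distinct) \<inter>
        (bounded_partitions N j \<times> (bounded_partitions N (n - j) \<inter> Collect distinct)) = {}"
      using bounded_partitions_unique by fast
  qed simp_all
  also have "\<dots> = (\<Sum>i=0..n. (\<Sum>xs\<in>bounded_partitions N i. prod_list (map u xs)) *
      (\<Sum>ys\<in>bounded_partitions N (n - i) \<inter> Collect distinct. prod_list (map v ys)))"
    by (simp add: sum_product sum.cartesian_product case_prod_unfold)
  also have "\<dots> = ((\<Prod>k=1..N. inverse (1 - fps_const (u k) * fps_X ^ k)) *
      (\<Prod>k=1..N. 1 + fps_const (v k) * fps_X ^ k)) $ n"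
    by (simp add: fps_mult_nth sum_bounded_partitions sum_bounded_distinct_partitions)
  finally show ?thesis by (simp add: prod.distrib mult.commute)
qed

lemma prod_list_map_residue:
  fixes x z :: real
  assumes "a < m" "b < m" "a \<noteq> b"
  shows "prod_list (map (\<lambda>k. x * (if [k = a] (mod m) then z else if [k = b] (mod m) then w else 1)) xs) =
    x ^ length xs * z ^ residue_parts a m xs * w ^ residue_parts b m xs"
proof -
  have "\<not> ([k = a] (mod m) \<and> [k = b] (mod m))" for k
    using assms by (auto simp: cong_def)
  then show ?thesis by (induction xs) (auto simp: residue_parts_def)
qed

text \<open>Extracts a power of the marker z while z stays a positive real parameter, which avoids
  series in two variables: a polynomial with infinitely many roots is zero.\<close>

lemma sum_powers_eq_imp_coeff_eq:
  fixes w :: "'i \<Rightarrow> real" and w' :: "'j \<Rightarrow> real"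
  assumes "finite A" "finite B"
    and "\<And>z. 0 < z \<Longrightarrow> (\<Sum>i\<in>A. w i * z ^ e i) = (\<Sum>j\<in>B. w' j * z ^ e' j)"
  shows "(\<Sum>i\<in>{i\<in>A. e i = d}. w i) = (\<Sum>j\<in>{j\<in>B. e' j = d}. w' j)"
proof -
  define p where "p = (\<Sum>i\<in>A. monom (w i) (e i)) - (\<Sum>j\<in>B. monom (w' j) (e' j))"
  have "poly p z = 0" if "z > 0" for z
    using assms(3)[OF that] by (simp add: p_def poly_sum poly_monom)
  then have "{0<..} \<subseteq> {z. poly p z = 0}" by auto
  then have "infinite {z. poly p z = 0}"
    using infinite_super infinite_Ioi by blast
  then have "p = 0" using poly_roots_finite by blast
  then have "coeff (\<Sum>i\<in>A. monom (w i) (e i)) d = coeff (\<Sum>j\<in>B. monom (w' j) (e' j)) d"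
    by (simp add: p_def)
  then show ?thesis
    using assms by (simp add: coeff_sum sum.inter_filter if_distrib cong: if_cong)
qed

section \<open>Theta function identities\<close>

text \<open>Congruence modulo X^M; it takes the place of infinite products and of limits of
  series.\<close>

definition fps_eq_upto :: "nat \<Rightarrow> 'a::comm_ring_1 fps \<Rightarrow> 'a fps \<Rightarrow> bool" where
  "fps_eq_upto M f g \<longleftrightarrow> (\<forall>i<M. f $ i = g $ i)"

lemma fps_eq_upto_refl [simp]: "fps_eq_upto M f f"
  by (simp add: fps_eq_upto_def)

lemma fps_eq_upto_sym: "fps_eq_upto M f g \<Longrightarrow> fps_eq_upto M g f"
  by (simp add: fps_eq_upto_def)

lemma fps_eq_upto_trans [trans]: "fps_eq_upto M f g \<Longrightarrow> fps_eq_upto M g h \<Longrightarrow> fps_eq_upto M f h"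
  by (simp add: fps_eq_upto_def)

lemma fps_eq_upto_nth: "fps_eq_upto M f g \<Longrightarrow> n < M \<Longrightarrow> f $ n = g $ n"
  by (simp add: fps_eq_upto_def)

lemma fps_eq_upto_add: "fps_eq_upto M f g \<Longrightarrow> fps_eq_upto M f' g' \<Longrightarrow> fps_eq_upto M (f + f') (g + g')"
  by (simp add: fps_eq_upto_def)

lemma fps_eq_upto_diff: "fps_eq_upto M f g \<Longrightarrow> fps_eq_upto M f' g' \<Longrightarrow> fps_eq_upto M (f - f') (g - g')"
  by (simp add: fps_eq_upto_def)

lemma fps_eq_upto_mult: "fps_eq_upto M f g \<Longrightarrow> fps_eq_upto M f' g' \<Longrightarrow> fps_eq_upto M (f * f') (g * g')"
  by (simp add: fps_eq_upto_def fps_mult_nth)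

lemma fps_eq_upto_sum: "(\<And>i. i \<in> I \<Longrightarrow> fps_eq_upto M (f i) (g i)) \<Longrightarrow> fps_eq_upto M (sum f I) (sum g I)"
  by (simp add: fps_eq_upto_def fps_sum_nth)

lemma fps_eq_upto_X_power: "M \<le> k \<Longrightarrow> fps_eq_upto M (fps_X ^ k * f) 0"
  by (simp add: fps_eq_upto_def fps_X_power_mult_nth)

lemma fps_eq_upto_cancel:
  fixes u :: "'a::field fps"
  assumes "fps_eq_upto M (u * f) (u * g)" "u $ 0 \<noteq> 0"
  shows "fps_eq_upto M f g"
proof -
  have inv: "inverse u * u = 1" using assms(2) by (rule inverse_mult_eq_1)
  have *: "inverse u * (u * h) = h" for h
    by (subst mult.assoc[symmetric]) (simp only: inv mult_1_left)
  from fps_eq_upto_mult[OF fps_eq_upto_refl assms(1), of "inverse u"] show ?thesis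
    unfolding * .
qed

text \<open>For G(w), the sum of w^i e_i, this is the functional equation (1 - x w) G(w) = (1 + y w)
  G(w q) with its truncation error. It belongs to the product over j of (1 + y w q^j) / (1 - x w
  q^j).\<close>

lemma q_binomial_telescope:
  fixes w q x y :: "'a::comm_ring_1"
  assumes "e 0 = 1" and "\<And>k. (1 - q ^ Suc k) * e (Suc k) = (x + y * q ^ k) * e k"
  shows "(1 - x * w) * (\<Sum>i\<le>n. w ^ i * e i) =
     (1 + y * w) * (\<Sum>i\<le>n. (w * q) ^ i * e i) - w ^ Suc n * ((x + y * q ^ n) * e n)"
proof (induction n)
  case (Suc n)
  have e: "(x + y * q ^ n) * e n = (1 - q ^ Suc n) * e (Suc n)" by (rule assms(2)[symmetric])
  show ?case
    unfolding sum.atMost_Suc distrib_left Suc e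
    by (simp add: algebra_simps power_mult_distrib)
qed (simp add: assms algebra_simps)

section \<open>Recurrences in the excess d\<close>

context
  fixes q x y :: "'a::comm_ring_1" and e :: "nat \<Rightarrow> 'a"
  assumes e_Suc: "\<And>k. (1 - q ^ Suc k) * e (Suc k) = (x + y * q ^ k) * e k"
begin

text \<open>Applies the recurrence of \<open>e\<close> to the factor e (k + Suc d). The companion
  below applies it to the other factor; together they allow the sums with q^(2 k) to be
  eliminated.\<close>

lemma charge_sum_recurrence1:
  "(\<Sum>k<n. q ^ k * e k * e (k + Suc d)) - q ^ Suc d * (\<Sum>k<n. q ^ (2 * k) * e k * e (k + Suc d)) =
   x * (\<Sum>k<n. q ^ k * e k * e (k + d)) + y * q ^ d * (\<Sum>k<n. q ^ (2 * k) * e k * e (k + d))"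
proof -
  have "q ^ k * e k * e (k + Suc d) - q ^ Suc d * (q ^ (2 * k) * e k * e (k + Suc d)) =
    x * (q ^ k * e k * e (k + d)) + y * q ^ d * (q ^ (2 * k) * e k * e (k + d))" for k
  proof -
    have "q ^ k * e k * e (k + Suc d) - q ^ Suc d * (q ^ (2 * k) * e k * e (k + Suc d)) =
      q ^ k * e k * ((1 - q ^ Suc (k + d)) * e (Suc (k + d)))"
      by (simp add: algebra_simps power_add mult_2 mult_2_right)
    then show ?thesis unfolding e_Suc by (simp add: algebra_simps power_add mult_2 mult_2_right)
  qed
  then show ?thesis
    by (simp add: sum_distrib_left flip: sum.distrib sum_subtractf)
qed

text \<open>The term k = 0 drops out of q^k - q^(2 k), which permits the index shift and explains
  the limits \<open>Suc n\<close> on one side and \<open>n\<close> on the other.\<close>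

lemma charge_sum_recurrence2:
  "(\<Sum>k<Suc n. q ^ k * e k * e (k + d)) - (\<Sum>k<Suc n. q ^ (2 * k) * e k * e (k + d)) =
   x * q * (\<Sum>k<n. q ^ k * e k * e (k + Suc d)) + y * q * (\<Sum>k<n. q ^ (2 * k) * e k * e (k + Suc d))"
proof -
  have "q ^ Suc k * e (Suc k) * e (Suc k + d) - q ^ (2 * Suc k) * e (Suc k) * e (Suc k + d) =
     x * q * (q ^ k * e k * e (k + Suc d)) + y * q * (q ^ (2 * k) * e k * e (k + Suc d))" for k
  proof -
    have "q ^ Suc k * e (Suc k) * e (Suc k + d) - q ^ (2 * Suc k) * e (Suc k) * e (Suc k + d) =
      q ^ Suc k * e (Suc k + d) * ((1 - q ^ Suc k) * e (Suc k))"
      by (simp add: algebra_simps power_add mult_2 mult_2_right)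
    then show ?thesis unfolding e_Suc by (simp add: algebra_simps power_add mult_2 mult_2_right)
  qed
  then show ?thesis
    unfolding sum.lessThan_Suc_shift
    by (simp add: sum_distrib_left algebra_simps flip: sum.distrib sum_subtractf)
qed

end

text \<open>For e_k = 1 / ((1 - q) ... (1 - q^k)) these are Durfee rectangle sums, whose limit does
  not depend on d. A difference of neighbours is q^(d + 1) times the next difference, up to
  truncation.\<close>

lemma durfee_sum_recurrence:
  fixes q :: "'a::comm_ring_1"
  assumes "\<And>k. (1 - q ^ Suc k) * e (Suc k) = e k"
  shows "(\<Sum>k<Suc n. q ^ (k * k + k * d) * e k * e (k + d)) -
      (\<Sum>k<Suc n. q ^ (k * k + k * Suc d) * e k * e (k + Suc d)) =
    q ^ Suc d * ((\<Sum>k<n. q ^ (k * k + k * Suc (Suc d)) * e k * e (k + Suc (Suc d))) -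
      (\<Sum>k<Suc n. q ^ (k * k + k * Suc d) * e k * e (k + Suc d)))"
proof -
  have "(\<Sum>k<Suc n. q ^ (k * k + k * d) * e k * e (k + d)) -
      (\<Sum>k<Suc n. q ^ (k * k + k * Suc d) * e k * e (k + Suc d)) =
     (\<Sum>k<Suc n. q ^ (k * k + k * d) * (1 - q ^ k) * e k * e (k + Suc d)
         - q ^ Suc d * (q ^ (k * k + k * Suc d) * e k * e (k + Suc d)))"
    unfolding sum_subtractf[symmetric]
  proof (rule sum.cong)
    fix k
    have e: "e (k + d) = (1 - q ^ Suc (k + d)) * e (Suc (k + d))" by (simp only: assms)
    show "q ^ (k * k + k * d) * e k * e (k + d) - q ^ (k * k + k * Suc d) * e k * e (k + Suc d) =
       q ^ (k * k + k * d) * (1 - q ^ k) * e k * e (k + Suc d)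
         - q ^ Suc d * (q ^ (k * k + k * Suc d) * e k * e (k + Suc d))"
      unfolding e by (simp add: algebra_simps power_add)
  qed simp
  also have "\<dots> = (\<Sum>k<Suc n. q ^ (k * k + k * d) * (1 - q ^ k) * e k * e (k + Suc d))
       - q ^ Suc d * (\<Sum>k<Suc n. q ^ (k * k + k * Suc d) * e k * e (k + Suc d))"
    by (simp only: sum_subtractf sum_distrib_left)
  also have "(\<Sum>k<Suc n. q ^ (k * k + k * d) * (1 - q ^ k) * e k * e (k + Suc d)) =
      (\<Sum>k<n. q ^ (Suc k * Suc k + Suc k * d) * ((1 - q ^ Suc k) * e (Suc k)) * e (Suc k + Suc d))"
    unfolding sum.lessThan_Suc_shift by (simp add: mult.assoc)
  also have "\<dots> = q ^ Suc d * (\<Sum>k<n. q ^ (k * k + k * Suc (Suc d)) * e k * e (k + Suc (Suc d)))"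
    unfolding assms sum_distrib_left
    by (rule sum.cong) (simp_all add: algebra_simps power_add)
  finally show ?thesis by (simp only: right_diff_distrib)
qed

text \<open>For \<open>0 < c < m\<close>, the series \<open>q\<^bsup>c k\<^esup> core_coeff m x y k\<close> counts the pairs with exactly \<open>k\<close> parts, all
  of them congruent to \<open>c\<close> modulo \<open>m\<close>.\<close>

fun core_coeff :: "nat \<Rightarrow> real \<Rightarrow> real \<Rightarrow> nat \<Rightarrow> real fps" where
  "core_coeff m x y 0 = 1"
| "core_coeff m x y (Suc k) = core_coeff m x y k *
     ((fps_const x + fps_const y * (fps_X ^ m) ^ k) * inverse (1 - (fps_X ^ m) ^ Suc k))"

lemma inverse_one_minus_X_power:
  assumes "0 < k"
  shows "inverse (1 - fps_X ^ k) * (1 - fps_X ^ k :: real fps) = 1"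
  using assms by (intro inverse_mult_eq_1) simp

lemma cancel_left_inverse:
  fixes u i p f :: "'a::comm_ring_1"
  assumes "i * u = 1"
  shows "u * (f * (p * i)) = p * f" "u * (p * i * f) = p * f"
proof -
  have "u * (f * (p * i)) = (i * u) * (p * f)" "u * (p * i * f) = (i * u) * (p * f)"
    by (simp_all add: mult_ac)
  then show "u * (f * (p * i)) = p * f" "u * (p * i * f) = p * f"
    unfolding assms by simp_all
qed

lemma core_coeff_Suc:
  assumes "0 < m"
  shows "(1 - (fps_X ^ m) ^ Suc k) * core_coeff m x y (Suc k) =
     (fps_const x + fps_const y * (fps_X ^ m) ^ k) * core_coeff m x y k"
proof -
  have "inverse (1 - (fps_X ^ m) ^ Suc k) * (1 - (fps_X ^ m) ^ Suc k :: real fps) = 1"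
    unfolding power_mult[symmetric] by (rule inverse_one_minus_X_power) (use assms in simp)
  then show ?thesis
    unfolding core_coeff.simps(2) by (rule cancel_left_inverse)
qed

text \<open>The q-binomial theorem modulo X^M: the functional equation is iterated from w = z X^c,
  each step multiplying w by X^m, until after M steps only the constant term of the series
  survives.\<close>

lemma prod_eq_sum_core_coeff:
  fixes x y z :: real
  assumes "0 < c" "0 < m"
  shows "fps_eq_upto M
    (\<Prod>j<M. (1 + fps_const (y * z) * fps_X ^ (c + m * j)) * inverse (1 - fps_const (x * z) * fps_X ^ (c + m * j)))
    (\<Sum>i\<le>M. fps_const (z ^ i) * fps_X ^ (c * i) * core_coeff m x y i)"
proof -
  define w where "w = (\<lambda>s. fps_const z * fps_X ^ (c + m * s) :: real fps)"
  define G where "G = (\<lambda>s. \<Sum>i\<le>M. w s ^ i * core_coeff m x y i)"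
  define F where "F = (\<lambda>s. (1 + fps_const (y * z) * fps_X ^ (c + m * s)) *
      inverse (1 - fps_const (x * z) * fps_X ^ (c + m * s)) :: real fps)"
  \<comment> \<open>As c > 0, each factor w contributes at least one power of X, so M of them
    vanish; this removes the truncation error of the telescope.\<close>
  have w_X: "fps_eq_upto M (w s ^ k * f) 0" if "M \<le> k" for s k f
  proof -
    have "w s ^ k * f = fps_X ^ ((c + m * s) * k) * (fps_const z ^ k * f)"
      by (simp only: w_def power_mult_distrib mult_ac flip: power_mult)
    moreover have "M \<le> (c + m * s) * k" using that assms
      by (metis add_gr_0 le_trans mult.commute mult_le_mono2 nat_mult_1_right Suc_leI One_nat_def)
    ultimately show ?thesis by (simp only: fps_eq_upto_X_power)
  qed
  have w_Suc: "w (Suc s) = w s * fps_X ^ m" for s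
    by (simp add: w_def power_add mult_ac)
  have step: "fps_eq_upto M (G s) (F s * G (Suc s))" for s
  proof -
    let ?u = "1 - fps_const (x * z) * fps_X ^ (c + m * s)"
    have xw: "fps_const x * w s = fps_const (x * z) * fps_X ^ (c + m * s)"
       "fps_const y * w s = fps_const (y * z) * fps_X ^ (c + m * s)"
      by (simp_all add: w_def mult.assoc[symmetric])
    have "?u * G s = (1 + fps_const y * w s) * G (Suc s) -
        w s ^ Suc M * ((fps_const x + fps_const y * (fps_X ^ m) ^ M) * core_coeff m x y M)"
      unfolding G_def xw(1)[symmetric] w_Suc
      by (rule q_binomial_telescope) (rule core_coeff.simps(1) core_coeff_Suc[OF assms(2)])+
    then have "fps_eq_upto M (?u * G s) ((1 + fps_const y * w s) * G (Suc s) - 0)"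
      using w_X by (metis fps_eq_upto_diff fps_eq_upto_refl le_SucI order_refl)
    moreover have "inverse ?u * ?u = 1" using assms by (intro inverse_mult_eq_1) simp
    then have "?u * (F s * G (Suc s)) = (1 + fps_const y * w s) * G (Suc s)"
      unfolding F_def xw by (rule cancel_left_inverse)
    ultimately have "fps_eq_upto M (?u * G s) (?u * (F s * G (Suc s)))" by (simp only: diff_zero)
    then show ?thesis by (rule fps_eq_upto_cancel) (use assms in simp)
  qed
  have "fps_eq_upto M (G 0) ((\<Prod>s<J. F s) * G J)" for J
  proof (induction J)
    case (Suc J)
    note Suc
    also have "fps_eq_upto M ((\<Prod>s<J. F s) * G J) ((\<Prod>s<J. F s) * (F J * G (Suc J)))"
      by (intro fps_eq_upto_mult fps_eq_upto_refl step)
    finally show ?case by (simp add: mult.assoc)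
  qed simp
  then have "fps_eq_upto M (G 0) ((\<Prod>s<M. F s) * G M)" .
  also have "fps_eq_upto M ((\<Prod>s<M. F s) * G M) ((\<Prod>s<M. F s) * 1)"
  proof (intro fps_eq_upto_mult fps_eq_upto_refl)
    have "fps_eq_upto M (w M ^ i * core_coeff m x y i) (if i = 0 then 1 else 0)" for i
    proof (cases i)
      case (Suc k)
      have "w M ^ i * core_coeff m x y i =
         fps_X ^ (c + m * M) * (fps_const z * w M ^ k * core_coeff m x y i)"
        by (simp add: Suc w_def mult_ac del: core_coeff.simps)
      moreover have "M \<le> c + m * M" using assms(2) by (cases m) auto
      ultimately have "fps_eq_upto M (w M ^ i * core_coeff m x y i) 0"
        by (simp only: fps_eq_upto_X_power)
      then show ?thesis by (simp only: Suc nat.simps if_False)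
    qed simp
    then have "fps_eq_upto M (G M) (\<Sum>i\<le>M. if i = 0 then 1 else 0)"
      unfolding G_def by (intro fps_eq_upto_sum)
    then show "fps_eq_upto M (G M) 1" by simp
  qed
  finally have "fps_eq_upto M (\<Prod>s<M. F s) (G 0)" by (simp add: fps_eq_upto_sym)
  moreover have "G 0 = (\<Sum>i\<le>M. fps_const (z ^ i) * fps_X ^ (c * i) * core_coeff m x y i)"
    by (simp add: G_def w_def power_mult_distrib fps_const_power flip: power_mult)
  ultimately show ?thesis by (simp add: F_def)
qed

text \<open>The recurrences determine the charge sums from their limit as \<open>d\<close> grows, because two solutions
  agreeing modulo \<open>q\<^sup>M\<close> for all \<open>d \<ge> M\<close> agree modulo \<open>q\<^sup>M\<close> for all \<open>d\<close>.\<close>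

lemma downward_induct:
  assumes "\<And>d. M \<le> d \<Longrightarrow> P d" "\<And>d. P (Suc d) \<Longrightarrow> P d"
  shows "P (d :: nat)"
proof -
  have "M \<le> d + i \<Longrightarrow> P d" for i d
    by (induction i arbitrary: d) (use assms in auto)
  from this[where i = M] show ?thesis by simp
qed

lemma fps_eq_upto_q_power:
  assumes "0 < m" "M \<le> k"
  shows "fps_eq_upto M ((fps_X ^ m) ^ k * f) 0"
proof -
  have "M \<le> m * k" using assms by (cases m) auto
  then show ?thesis unfolding power_mult[symmetric] by (rule fps_eq_upto_X_power)
qed

lemma fps_eq_upto_add_q_power:
  assumes "0 < m" "M \<le> k"
  shows "fps_eq_upto M (g + (fps_X ^ m) ^ k * f) g" "fps_eq_upto M (g - (fps_X ^ m) ^ k * f) g"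
  using fps_eq_upto_add[OF fps_eq_upto_refl fps_eq_upto_q_power[OF assms]]
    fps_eq_upto_diff[OF fps_eq_upto_refl fps_eq_upto_q_power[OF assms]] by simp_all

text \<open>For x = 1 the ratio of successive coefficients is (1 + y q^k) / (1 - q^(k + 1)), which
  is 1 modulo X^M from k = M on. The value at M therefore stands for the limiting infinite
  product.\<close>

lemma core_coeff_stable:
  assumes "0 < m" "M \<le> k"
  shows "fps_eq_upto M (core_coeff m 1 y k) (core_coeff m 1 y M)"
  using assms(2)
proof (induction k rule: dec_induct)
  case (step k)
  have "fps_eq_upto M (core_coeff m 1 y (Suc k))
      (core_coeff m 1 y (Suc k) - (fps_X ^ m) ^ Suc k * core_coeff m 1 y (Suc k))"
    using step.hyps by (intro fps_eq_upto_sym[OF fps_eq_upto_add_q_power(2)] assms) simp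
  also have "core_coeff m 1 y (Suc k) - (fps_X ^ m) ^ Suc k * core_coeff m 1 y (Suc k) =
      core_coeff m 1 y k + (fps_X ^ m) ^ k * (fps_const y * core_coeff m 1 y k)"
    using core_coeff_Suc[OF assms(1), of k 1 y]
    by (simp add: algebra_simps del: core_coeff.simps)
  also have "fps_eq_upto M \<dots> (core_coeff m 1 y k)"
    using step.hyps by (intro fps_eq_upto_add_q_power(1) assms) simp
  finally show ?case using step.IH fps_eq_upto_trans by blast
qed simp

section \<open>Closed forms of the charge sums for the three weights\<close>

context
  fixes m M :: nat
  assumes m: "0 < m"
begin

private abbreviation (input) "q \<equiv> fps_X ^ m :: real fps"
private abbreviation (input) "E \<equiv> core_coeff m"

lemma charge_sum_limit:
  assumes "M \<le> d"
  shows "fps_eq_upto M (\<Sum>k<n. q ^ k * E 1 y k * E 1 y (k + d)) ((\<Sum>k<n. q ^ k * E 1 y k) * E 1 y M)"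
  unfolding sum_distrib_right using assms
  by (intro fps_eq_upto_sum fps_eq_upto_mult fps_eq_upto_refl core_coeff_stable m) simp

text \<open>Partitions with parts at most n, sorted by their largest part k. It evaluates the charge
  sum for large d.\<close>

lemma sum_core_coeff_partitions: "(\<Sum>k<Suc n. q ^ k * E 1 0 k) = E 1 0 n"
proof (induction n)
  case (Suc n)
  have "(\<Sum>k<Suc (Suc n). q ^ k * E 1 0 k) = E 1 0 n + q ^ Suc n * E 1 0 (Suc n)"
    using Suc by (simp del: core_coeff.simps)
  also have "E 1 0 n = (1 - q ^ Suc n) * E 1 0 (Suc n)"
    by (subst core_coeff_Suc[OF m]) simp
  finally show ?case by (simp add: algebra_simps del: core_coeff.simps)
qed simp

lemma sum_core_coeff_overpartitions: "2 * (\<Sum>k<Suc n. q ^ k * E 1 1 k) = (1 + q ^ n) * E 1 1 n"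
proof (induction n)
  case (Suc n)
  have "2 * (\<Sum>k<Suc (Suc n). q ^ k * E 1 1 k) = (1 + q ^ n) * E 1 1 n + 2 * (q ^ Suc n * E 1 1 (Suc n))"
    using Suc by (simp add: distrib_left del: core_coeff.simps)
  also have "(1 + q ^ n) * E 1 1 n = (1 - q ^ Suc n) * E 1 1 (Suc n)"
    by (subst core_coeff_Suc[OF m]) simp
  finally show ?case by (simp add: algebra_simps del: core_coeff.simps)
qed simp

text \<open>For y = 0 the two recurrences combine to C(d) = (1 - q^(d+1)) C(d+1) + q^(d+2) C(d+2).
  The partial theta series satisfies S(d) + q^(d+1) S(d+1) = 1, and equating this for d and d + 1
  gives the same relation. Both sides agree for d \<ge> M.\<close>

lemma charge_sum_partitions:
  "fps_eq_upto M (\<Sum>k<Suc M. q ^ k * E 1 0 k * E 1 0 (k + d))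
     (E 1 0 M ^ 2 * (\<Sum>j<Suc M. (-1) ^ j * q ^ (j * (j + 1) div 2 + j * d)))"
proof -
  define C where "C = (\<lambda>d. \<Sum>k<Suc M. q ^ k * E 1 0 k * E 1 0 (k + d))"
  define A where "A = (\<lambda>d. \<Sum>k<Suc M. q ^ (2 * k) * E 1 0 k * E 1 0 (k + d))"
  define S where "S = (\<lambda>n d. \<Sum>j<n. (-1) ^ j * q ^ (j * (j + 1) div 2 + j * d))"
  define G where "G = (\<lambda>d. E 1 0 M ^ 2 * S (Suc M) d)"
  have e: "(1 - q ^ Suc k) * E 1 0 (Suc k) = (1 + 0 * q ^ k) * E 1 0 k" for k
    by (subst core_coeff_Suc[OF m]) simp
  have recC: "fps_eq_upto M (C d) (C (Suc d) - q ^ Suc d * C (Suc d) + q ^ Suc (Suc d) * C (Suc (Suc d)))" for d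
  proof -
    have 1: "C d = C (Suc d) - q ^ Suc d * A (Suc d)"
      using charge_sum_recurrence1[where e = "E 1 0" and n = "Suc M" and d = d, OF e] by (simp add: C_def A_def del: core_coeff.simps)
    have 2: "A (Suc d) = C (Suc d) - (q * C (Suc (Suc d)) - q ^ Suc M * (E 1 0 M * E 1 0 (M + Suc (Suc d))))"
      using charge_sum_recurrence2[where e = "E 1 0" and n = M and d = "Suc d", OF e]
      by (simp add: C_def A_def algebra_simps del: core_coeff.simps)
    have "C d = C (Suc d) - q ^ Suc d * C (Suc d) + q ^ Suc (Suc d) * C (Suc (Suc d))
        - q ^ Suc M * (q ^ Suc d * (E 1 0 M * E 1 0 (M + Suc (Suc d))))"
      unfolding 1 2 by (simp add: algebra_simps)
    then show ?thesis using fps_eq_upto_add_q_power(2)[OF m, of M "Suc M"] by simp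
  qed
  have recS: "S (Suc n) d = 1 - q ^ Suc d * S n (Suc d)" for n d
  proof -
    have "(j + 1) * (j + 2) div 2 + (j + 1) * d = j * (j + 1) div 2 + j * Suc d + Suc d" for j :: nat
    proof -
      have "(j + 1) * (j + 2) = j * (j + 1) + (j + 1) * 2" by simp
      then have "(j + 1) * (j + 2) div 2 = j * (j + 1) div 2 + (j + 1)"
        by (metis div_mult_self1 add.commute zero_neq_numeral)
      then show ?thesis by simp
    qed
    then show ?thesis
      unfolding S_def sum.lessThan_Suc_shift sum_distrib_left
      by (simp add: sum_negf[symmetric] power_add mult_ac)
  qed
  \<comment> \<open>\<open>recS\<close> shortens the series by its last term; restoring that term
    costs only a multiple of q^M.\<close>
  have recS': "fps_eq_upto M (S (Suc M) d + q ^ Suc d * S (Suc M) (Suc d)) 1" for d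
  proof -
    have "S (Suc M) (Suc d) = S M (Suc d) + q ^ M * ((-1) ^ M * q ^ (M * (M + 1) div 2 - M + M * Suc d))"
    proof (cases "M = 0")
      case False
      then have "M \<le> M * (M + 1) div 2" by (cases M) auto
      then have "M * (M + 1) div 2 + M * Suc d = M + (M * (M + 1) div 2 - M + M * Suc d)" by linarith
      then have "q ^ (M * (M + 1) div 2 + M * Suc d) = q ^ M * q ^ (M * (M + 1) div 2 - M + M * Suc d)"
        by (simp only: flip: power_add)
      then show ?thesis by (simp add: S_def mult_ac)
    qed (simp add: S_def)
    then have "S (Suc M) d + q ^ Suc d * S (Suc M) (Suc d) =
        1 + q ^ M * (q ^ Suc d * ((-1) ^ M * q ^ (M * (M + 1) div 2 - M + M * Suc d)))"
      unfolding recS[of M d] by (simp add: algebra_simps)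
    then show ?thesis using fps_eq_upto_add_q_power(1)[OF m order_refl] by simp
  qed
  have recG: "fps_eq_upto M (G d) (G (Suc d) - q ^ Suc d * G (Suc d) + q ^ Suc (Suc d) * G (Suc (Suc d)))" for d
  proof -
    have "fps_eq_upto M (S (Suc M) d + q ^ Suc d * S (Suc M) (Suc d))
        (S (Suc M) (Suc d) + q ^ Suc (Suc d) * S (Suc M) (Suc (Suc d)))"
      using recS' fps_eq_upto_sym fps_eq_upto_trans by blast
    then have "fps_eq_upto M (E 1 0 M ^ 2 * (S (Suc M) d + q ^ Suc d * S (Suc M) (Suc d)) - q ^ Suc d * G (Suc d))
        (E 1 0 M ^ 2 * (S (Suc M) (Suc d) + q ^ Suc (Suc d) * S (Suc M) (Suc (Suc d))) - q ^ Suc d * G (Suc d))"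
      by (intro fps_eq_upto_diff fps_eq_upto_mult fps_eq_upto_refl)
    then show ?thesis unfolding G_def by (simp add: algebra_simps)
  qed
  have "fps_eq_upto M (C d) (G d)" if "M \<le> d" for d
  proof -
    have "fps_eq_upto M (C d) (E 1 0 M * E 1 0 M)"
      using charge_sum_limit[OF that, where n = "Suc M" and y = 0] unfolding C_def sum_core_coeff_partitions .
    moreover have "fps_eq_upto M (S (Suc M) d) 1"
      unfolding recS using that by (intro fps_eq_upto_add_q_power(2) m) simp
    then have "fps_eq_upto M (G d) (E 1 0 M ^ 2 * 1)"
      unfolding G_def by (intro fps_eq_upto_mult fps_eq_upto_refl)
    ultimately show ?thesis
      using fps_eq_upto_sym fps_eq_upto_trans by (metis mult.right_neutral power2_eq_square)
  qed
  \<comment> \<open>The recurrence has order two, so the downward induction carries two neighbouring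
    values.\<close>
  then have "fps_eq_upto M (C d) (G d) \<and> fps_eq_upto M (C (Suc d)) (G (Suc d))" for d
  proof (induction d rule: downward_induct[where M = M])
    case (2 d)
    note recC[of d]
    also have "fps_eq_upto M (C (Suc d) - q ^ Suc d * C (Suc d) + q ^ Suc (Suc d) * C (Suc (Suc d)))
       (G (Suc d) - q ^ Suc d * G (Suc d) + q ^ Suc (Suc d) * G (Suc (Suc d)))"
      using 2 by (intro fps_eq_upto_add fps_eq_upto_diff fps_eq_upto_mult fps_eq_upto_refl) simp_all
    also have "fps_eq_upto M \<dots> (G d)" by (rule fps_eq_upto_sym[OF recG])
    finally show ?case using 2 by simp
  qed simp
  then show ?thesis by (simp add: C_def G_def S_def)
qed

text \<open>For x = y = 1, the first recurrence minus q^d times the second eliminates the sums with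
  q^(2 k) and says that C(d) (1 + q^d) is independent of d; its value is read off for large
  d.\<close>

lemma charge_sum_overpartitions:
  "fps_eq_upto M (2 * (\<Sum>k<Suc M. q ^ k * E 1 1 k * E 1 1 (k + d)) * (1 + q ^ d)) (E 1 1 M ^ 2)"
proof -
  define C where "C = (\<lambda>d. \<Sum>k<Suc M. q ^ k * E 1 1 k * E 1 1 (k + d))"
  define A where "A = (\<lambda>d. \<Sum>k<Suc M. q ^ (2 * k) * E 1 1 k * E 1 1 (k + d))"
  have e: "(1 - q ^ Suc k) * E 1 1 (Suc k) = (1 + 1 * q ^ k) * E 1 1 k" for k
    by (subst core_coeff_Suc[OF m]) simp
  have rec: "fps_eq_upto M (C (Suc d) * (1 + q ^ Suc d)) (C d * (1 + q ^ d))" for d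
  proof -
    have 1: "C (Suc d) - q ^ Suc d * A (Suc d) = C d + q ^ d * A d"
      using charge_sum_recurrence1[where e = "E 1 1" and n = "Suc M" and d = d, OF e] by (simp add: C_def A_def del: core_coeff.simps)
    have 2: "C d - A d = q * C (Suc d) + q * A (Suc d) -
        q ^ M * (q * (E 1 1 M * E 1 1 (M + Suc d)) + q ^ Suc M * (E 1 1 M * E 1 1 (M + Suc d)))"
    proof -
      have "C d - A d = q * (C (Suc d) - q ^ M * E 1 1 M * E 1 1 (M + Suc d)) +
          q * (A (Suc d) - q ^ (2 * M) * E 1 1 M * E 1 1 (M + Suc d))"
        using charge_sum_recurrence2[where e = "E 1 1" and n = M and d = d, OF e]
        unfolding C_def A_def sum.lessThan_Suc[of _ M] by (simp only: add_diff_cancel_right' mult_1_left)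
      then show ?thesis by (simp add: algebra_simps mult_2 mult_2_right power_add del: core_coeff.simps)
    qed
    have "C (Suc d) * (1 + q ^ Suc d) = C d * (1 + q ^ d) +
        (C (Suc d) - q ^ Suc d * A (Suc d) - (C d + q ^ d * A d))
        - q ^ d * (C d - A d - (q * C (Suc d) + q * A (Suc d)))"
      by (simp add: algebra_simps)
    also have "\<dots> = C d * (1 + q ^ d) + q ^ M * (q ^ d *
        (q * (E 1 1 M * E 1 1 (M + Suc d)) + q ^ Suc M * (E 1 1 M * E 1 1 (M + Suc d))))"
      unfolding 1 2 by (simp add: algebra_simps)
    finally show ?thesis using fps_eq_upto_add_q_power(1)[OF m order_refl] by simp
  qed
  have "fps_eq_upto M (2 * C d * (1 + q ^ d)) (E 1 1 M ^ 2)" for d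
  proof (induction d rule: downward_induct[where M = M])
    case (1 d)
    have "fps_eq_upto M (2 * C d * (1 + q ^ d)) (2 * C d)"
      using fps_eq_upto_add_q_power(1)[OF m 1, of "2 * C d" "2 * C d"] by (simp add: algebra_simps)
    also have "fps_eq_upto M (2 * C d) (2 * ((\<Sum>k<Suc M. q ^ k * E 1 1 k) * E 1 1 M))"
      unfolding C_def by (intro fps_eq_upto_mult fps_eq_upto_refl charge_sum_limit 1)
    also have "2 * ((\<Sum>k<Suc M. q ^ k * E 1 1 k) * E 1 1 M) = E 1 1 M ^ 2 + q ^ M * E 1 1 M ^ 2"
      unfolding mult.assoc[symmetric] sum_core_coeff_overpartitions
      by (simp add: algebra_simps power2_eq_square)
    also have "fps_eq_upto M \<dots> (E 1 1 M ^ 2)"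
      by (intro fps_eq_upto_add_q_power(1) m order_refl)
    finally show ?case .
  next
    case (2 d)
    have "fps_eq_upto M (2 * (C d * (1 + q ^ d))) (2 * (C (Suc d) * (1 + q ^ Suc d)))"
      by (intro fps_eq_upto_mult fps_eq_upto_refl fps_eq_upto_sym[OF rec])
    then show ?case using 2 fps_eq_upto_trans by (simp add: mult.assoc) blast
  qed
  then show ?thesis by (simp add: C_def)
qed

text \<open>In units of m, k distinct parts are k arbitrary parts on top of a staircase.\<close>

lemma core_coeff_distinct: "E 0 1 k = q ^ (k * (k - 1) div 2) * E 1 0 k"
proof (induction k)
  case (Suc k)
  have "Suc k * (Suc k - 1) div 2 = k * (k - 1) div 2 + k"
  proof -
    have "Suc k * (Suc k - 1) = k * (k - 1) + k * 2" by (cases k) (auto simp: algebra_simps)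
    then show ?thesis by (metis div_mult_self1 add.commute zero_neq_numeral)
  qed
  then show ?case by (simp add: Suc power_add mult_ac)
qed simp

text \<open>Taking out both staircases leaves q^(d (d - 1) / 2) times a Durfee rectangle sum, which
  equals the limiting product for every d.\<close>

lemma charge_sum_distinct:
  "fps_eq_upto M (\<Sum>k<Suc M. q ^ k * E 0 1 k * E 0 1 (k + d)) (q ^ (d * (d - 1) div 2) * E 1 0 M)"
proof -
  define T where "T = (\<lambda>d. \<Sum>k<Suc M. q ^ (k * k + k * d) * E 1 0 k * E 1 0 (k + d))"
  have e: "(1 - q ^ Suc k) * E 1 0 (Suc k) = E 1 0 k" for k
    by (subst core_coeff_Suc[OF m]) simp
  have T: "fps_eq_upto M (T d - T (Suc d)) (q ^ Suc d * (T (Suc (Suc d)) - T (Suc d)))" for d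
  proof -
    let ?r = "q ^ Suc d * (q ^ (M * M - M + M * Suc (Suc d)) * E 1 0 M * E 1 0 (M + Suc (Suc d)))"
    have "M * M + M * Suc (Suc d) = M + (M * M - M + M * Suc (Suc d))" by (cases M) auto
    then have "q ^ (M * M + M * Suc (Suc d)) = q ^ M * q ^ (M * M - M + M * Suc (Suc d))"
      by (simp only: flip: power_add)
    moreover have "T d - T (Suc d) = q ^ Suc d * ((T (Suc (Suc d)) -
        q ^ (M * M + M * Suc (Suc d)) * E 1 0 M * E 1 0 (M + Suc (Suc d))) - T (Suc d))"
      using durfee_sum_recurrence[where e = "E 1 0" and n = M and d = d, OF e]
      unfolding T_def sum.lessThan_Suc[of _ M] by (simp only: add_diff_cancel_right')
    ultimately have "T d - T (Suc d) = q ^ Suc d * (T (Suc (Suc d)) - T (Suc d)) - q ^ M * ?r"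
      by (simp only: right_diff_distrib left_diff_distrib mult_ac) simp
    then show ?thesis using fps_eq_upto_add_q_power(2)[OF m order_refl] by simp
  qed
  \<comment> \<open>A difference of neighbours is q^(d + 1) times the next one: it vanishes for d
    \<ge> M, and then for all smaller d.\<close>
  have T_diff: "fps_eq_upto M (T d) (T (Suc d))" for d
  proof (induction d rule: downward_induct[where M = M])
    case (1 d)
    have "fps_eq_upto M (T d - T (Suc d)) 0"
      using T[of d] fps_eq_upto_q_power[OF m, of M "Suc d"] 1 fps_eq_upto_trans le_SucI by blast
    then show ?case by (simp add: fps_eq_upto_def)
  next
    case (2 d)
    have "fps_eq_upto M (T (Suc (Suc d)) - T (Suc d)) 0"
      using 2 by (simp add: fps_eq_upto_def)
    then have "fps_eq_upto M (q ^ Suc d * (T (Suc (Suc d)) - T (Suc d))) (q ^ Suc d * 0)"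
      by (intro fps_eq_upto_mult fps_eq_upto_refl)
    then have "fps_eq_upto M (T d - T (Suc d)) 0"
      using T[of d] fps_eq_upto_trans by fastforce
    then show ?case by (simp add: fps_eq_upto_def)
  qed
  have "fps_eq_upto M (T d) (E 1 0 M)"
  proof (induction d rule: downward_induct[where M = M])
    case (1 d)
    have "fps_eq_upto M (T d) (\<Sum>k<Suc M. if k = 0 then E 1 0 M else 0)"
      unfolding T_def
    proof (rule fps_eq_upto_sum)
      fix k assume "k \<in> {..<Suc M}"
      show "fps_eq_upto M (q ^ (k * k + k * d) * E 1 0 k * E 1 0 (k + d)) (if k = 0 then E 1 0 M else 0)"
      proof (cases k)
        case 0
        then show ?thesis using core_coeff_stable[OF m 1, of 0] by simp
      next
        case (Suc l)
        have "M \<le> k * k + k * d" using 1 by (simp add: Suc)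
        then have "fps_eq_upto M (q ^ (k * k + k * d) * (E 1 0 k * E 1 0 (k + d))) 0"
          by (rule fps_eq_upto_q_power[OF m])
        then show ?thesis by (simp only: Suc nat.simps if_False mult.assoc)
      qed
    qed
    also have "(\<Sum>k<Suc M. if k = 0 then E 1 0 M else 0) = E 1 0 M" by (subst sum.delta) simp_all
    finally show ?case .
  next
    case (2 d)
    then show ?case using T_diff fps_eq_upto_trans by blast
  qed
  moreover have "(\<Sum>k<Suc M. q ^ k * E 0 1 k * E 0 1 (k + d)) = q ^ (d * (d - 1) div 2) * T d"
    unfolding T_def sum_distrib_left
  proof (rule sum.cong)
    fix k
    \<comment> \<open>Doubling clears the integer divisions before the exponents are
      compared.\<close>
    have tri: "2 * (i * (i - 1) div 2) = i * (i - 1)" for i :: nat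
      by (cases "even i") auto
    have "2 * (k + k * (k - 1) div 2 + (k + d) * (k + d - 1) div 2) =
        2 * (d * (d - 1) div 2 + (k * k + k * d))"
      unfolding distrib_left tri
      by (cases k; cases d) (auto simp: algebra_simps)
    then have exps: "k + k * (k - 1) div 2 + (k + d) * (k + d - 1) div 2 =
        d * (d - 1) div 2 + (k * k + k * d)"
      by (rule nat_mult_eq_cancel1[THEN iffD1, rotated]) simp
    have "q ^ k * E 0 1 k * E 0 1 (k + d) =
      q ^ (k + k * (k - 1) div 2 + (k + d) * (k + d - 1) div 2) * E 1 0 k * E 1 0 (k + d)"
      unfolding core_coeff_distinct power_add by (simp add: mult_ac)
    then show "q ^ k * E 0 1 k * E 0 1 (k + d) =
      q ^ (d * (d - 1) div 2) * (q ^ (k * k + k * d) * E 1 0 k * E 1 0 (k + d))"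
      unfolding exps power_add by (simp add: mult_ac)
  qed simp
  ultimately show ?thesis by (simp only: fps_eq_upto_mult fps_eq_upto_refl)
qed

lemma core_coeff_partitions_prod: "E 1 0 n = (\<Prod>k=1..n. inverse (1 - q ^ k))"
  by (induction n) (simp_all add: mult.commute)

text \<open>The numerators in \<open>core_coeff\<close> are 1 + q^(k - 1) for k = 1, ..., n.
  Shifting them by one splits off 1 + q^0 = 2 and supplies the missing 1 + q^n; this is the origin
  of the 2 in the overpartition formulas.\<close>

lemma core_coeff_overpartitions_prod:
  "(1 + q ^ n) * E 1 1 n = 2 * (\<Prod>k=1..n. (1 + q ^ k) * inverse (1 - q ^ k))"
proof (induction n)
  case (Suc n)
  have "(1 + q ^ Suc n) * E 1 1 (Suc n) =
     (1 + q ^ n) * E 1 1 n * ((1 + q ^ Suc n) * inverse (1 - q ^ Suc n))"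
    by (simp add: mult_ac)
  then show ?case unfolding Suc by (simp add: mult.assoc)
qed simp

lemma core_coeff_overpartitions:
  "fps_eq_upto M (E 1 1 M) (2 * (\<Prod>k=1..M. (1 + q ^ k) * inverse (1 - q ^ k)))"
  using fps_eq_upto_add_q_power(1)[OF m order_refl, of M "E 1 1 M" "E 1 1 M"]
  unfolding core_coeff_overpartitions_prod[symmetric]
  by (simp add: algebra_simps fps_eq_upto_sym)

end

section \<open>Counting by excess\<close>

definition neutral_product :: "nat \<Rightarrow> nat \<Rightarrow> nat \<Rightarrow> real \<Rightarrow> real \<Rightarrow> nat \<Rightarrow> real fps" where
  "neutral_product a b m x y N = (\<Prod>k\<in>{k \<in> {1..N}. \<not> [k = a] (mod m) \<and> \<not> [k = b] (mod m)}.
     (1 + fps_const y * fps_X ^ k) * inverse (1 - fps_const x * fps_X ^ k))"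

text \<open>The cutoff m M is chosen so that each class has exactly M members, matching the product
  in \<open>prod_eq_sum_core_coeff\<close>.\<close>

lemma residue_class_image:
  fixes c m M :: nat
  assumes "0 < c" "c < m"
  shows "{k \<in> {1..m * M}. [k = c] (mod m)} = (\<lambda>j. c + m * j) ` {..<M}"
proof (intro equalityI subsetI)
  fix k assume k: "k \<in> {k \<in> {1..m * M}. [k = c] (mod m)}"
  then have mod: "k mod m = c" using assms by (simp add: cong_def)
  have kk: "k = c + m * (k div m)" using mod_mult_div_eq[of k m] by (simp add: mod)
  have "k \<le> m * M" using k by simp
  then have "m * (k div m) < m * M" using kk assms(1) by linarith
  then have "k div m < M" by simp
  then show "k \<in> (\<lambda>j. c + m * j) ` {..<M}" using kk by blast
next
  fix k assume "k \<in> (\<lambda>j. c + m * j) ` {..<M}"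
  then obtain j where j: "k = c + m * j" "j < M" by blast
  have "c + m * j \<le> m * Suc j" using assms by simp
  also have "\<dots> \<le> m * M" using j by (intro mult_le_mono2) simp
  finally show "k \<in> {k \<in> {1..m * M}. [k = c] (mod m)}"
    using assms j by (simp add: cong_def)
qed

lemma prod_split_residues:
  fixes g :: "nat \<Rightarrow> 'a::comm_monoid_mult"
  assumes "0 < a" "a < m" "0 < b" "b < m" "a \<noteq> b"
  shows "(\<Prod>k=1..m * M. g k) = (\<Prod>j<M. g (a + m * j)) * (\<Prod>j<M. g (b + m * j)) *
    (\<Prod>k\<in>{k \<in> {1..m * M}. \<not> [k = a] (mod m) \<and> \<not> [k = b] (mod m)}. g k)"
proof -
  let ?I = "\<lambda>c. {k \<in> {1..m * M}. [k = c] (mod m)}"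
  let ?N = "{k \<in> {1..m * M}. \<not> [k = a] (mod m) \<and> \<not> [k = b] (mod m)}"
  have eq: "(\<Prod>k\<in>?I c. g k) = (\<Prod>j<M. g (c + m * j))" if "0 < c" "c < m" for c
    unfolding residue_class_image[OF that] using that
    by (subst prod.reindex) (auto simp: inj_on_def)
  have "(\<Prod>k=1..m * M. g k) = (\<Prod>k\<in>?I a \<union> ?I b \<union> ?N. g k)"
    by (rule prod.cong) auto
  also have "\<dots> = (\<Prod>k\<in>?I a \<union> ?I b. g k) * (\<Prod>k\<in>?N. g k)"
    by (rule prod.union_disjoint) auto
  also have "(\<Prod>k\<in>?I a \<union> ?I b. g k) = (\<Prod>k\<in>?I a. g k) * (\<Prod>k\<in>?I b. g k)"
    using assms by (intro prod.union_disjoint) (auto simp: cong_def)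
  finally show ?thesis by (simp only: eq assms)
qed

lemma residue_parts_pair_le:
  assumes "z \<in> partition_pairs n"
  shows "residue_parts_pair c m z \<le> n"
proof -
  have "length (filter P xs) \<le> sum_list xs" if "xs \<in> partitions" for xs and P :: "nat \<Rightarrow> bool"
  proof -
    have "\<forall>k\<in>set xs. 0 < k" using that by (simp add: partitions_def)
    then have "length xs \<le> sum_list xs" by (induction xs) (auto simp: trans_le_add2)
    then show ?thesis using length_filter_le le_trans by blast
  qed
  then have "residue_parts c m (fst z) \<le> sum_list (fst z)" "residue_parts c m (snd z) \<le> sum_list (snd z)"
    using assms by (auto simp: residue_parts_def partition_pairs_def distinct_partitions_def)
  then show ?thesis using assms by (simp add: residue_parts_pair_def partition_pairs_def)
qed

definition charge_count :: "nat \<Rightarrow> nat \<Rightarrow> nat \<Rightarrow> nat \<Rightarrow> real \<Rightarrow> real \<Rightarrow> nat \<Rightarrow> real" where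
  "charge_count n a b m x y d =
     (\<Sum>z \<in> {z \<in> partition_pairs n. residue_parts_pair a m z = residue_parts_pair b m z + d}.
        x ^ length (fst z) * y ^ length (snd z))"

text \<open>Parts congruent to a are marked by z, those congruent to b by 1 / z. After expansion z^d
  collects the index pairs (k + d, k), whose exponent a (k + d) + b k equals a d + m k because a + b
  = m.\<close>

lemma charge_count_eq:
  assumes ab: "a + b = m" "0 < a" "0 < b" "a \<noteq> b" and n: "n < M" "d \<le> M"
  shows "charge_count n a b m x y d =
    (fps_X ^ (a * d) * (\<Sum>k<Suc M. (fps_X ^ m) ^ k * core_coeff m x y k * core_coeff m x y (k + d)) *
      neutral_product a b m x y (m * M)) $ n"
proof -
  have am: "a < m" "b < m" and m: "0 < m" using ab by auto
  define E where "E = core_coeff m x y"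
  define N where "N = neutral_product a b m x y (m * M)"
  define coef where "coef = (\<lambda>(i, k). (fps_X ^ (a * i) * E i * (fps_X ^ (b * k) * E k) * N) $ n)"
  define w where "w = (\<lambda>p :: nat list \<times> nat list. x ^ length (fst p) * y ^ length (snd p))"
  have gf: "(\<Sum>p\<in>partition_pairs n. w p * z ^ residue_parts_pair a m p * (1 / z) ^ residue_parts_pair b m p) =
      (\<Sum>p\<in>{..M} \<times> {..M}. coef p * z ^ fst p * (1 / z) ^ snd p)" if "0 < z" for z
  proof -
    define \<zeta> where "\<zeta> = (\<lambda>k. if [k = a] (mod m) then z else if [k = b] (mod m) then 1 / z else 1)"
    define g where "g = (\<lambda>k. (1 + fps_const (y * \<zeta> k) * fps_X ^ k) * inverse (1 - fps_const (x * \<zeta> k) * fps_X ^ k))"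
    have \<zeta>: "\<zeta> (a + m * j) = z" "\<zeta> (b + m * j) = 1 / z" for j
      using am ab(4) by (auto simp: \<zeta>_def cong_def)
    have "w p * z ^ residue_parts_pair a m p * (1 / z) ^ residue_parts_pair b m p =
        prod_list (map (\<lambda>k. x * \<zeta> k) (fst p)) * prod_list (map (\<lambda>k. y * \<zeta> k) (snd p))" for p
      unfolding \<zeta>_def prod_list_map_residue[OF am ab(4)]
      by (simp add: w_def residue_parts_pair_def power_add)
    then have "(\<Sum>p\<in>partition_pairs n. w p * z ^ residue_parts_pair a m p * (1 / z) ^ residue_parts_pair b m p) =
       (\<Sum>p\<in>partition_pairs n. prod_list (map (\<lambda>k. x * \<zeta> k) (fst p)) * prod_list (map (\<lambda>k. y * \<zeta> k) (snd p)))"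
      by simp
    also have "\<dots> = (\<Prod>k=1..m * M. g k) $ n"
    proof -
      have "M \<le> m * M" using m by simp
      then have "n \<le> m * M" using n(1) by linarith
      then show ?thesis unfolding g_def by (rule sum_partition_pairs)
    qed
    also have "(\<Prod>k=1..m * M. g k) = (\<Prod>j<M. g (a + m * j)) * (\<Prod>j<M. g (b + m * j)) * N"
      unfolding prod_split_residues[OF ab(2) am(1) ab(3) am(2) ab(4)] N_def neutral_product_def
      by (intro arg_cong2[where f = "(*)"] prod.cong refl) (auto simp: g_def \<zeta>_def)
    also have "\<dots> $ n = ((\<Sum>i\<le>M. fps_const (z ^ i) * fps_X ^ (a * i) * E i) *
        (\<Sum>k\<le>M. fps_const ((1 / z) ^ k) * fps_X ^ (b * k) * E k) * N) $ n"
    proof (rule fps_eq_upto_nth[OF _ n(1)], intro fps_eq_upto_mult fps_eq_upto_refl)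
      show "fps_eq_upto M (\<Prod>j<M. g (a + m * j)) (\<Sum>i\<le>M. fps_const (z ^ i) * fps_X ^ (a * i) * E i)"
        unfolding g_def \<zeta> E_def by (rule prod_eq_sum_core_coeff[OF ab(2) m])
      show "fps_eq_upto M (\<Prod>j<M. g (b + m * j)) (\<Sum>k\<le>M. fps_const ((1 / z) ^ k) * fps_X ^ (b * k) * E k)"
        unfolding g_def \<zeta> E_def by (rule prod_eq_sum_core_coeff[OF ab(3) m])
    qed
    also have "(\<Sum>i\<le>M. fps_const (z ^ i) * fps_X ^ (a * i) * E i) *
        (\<Sum>k\<le>M. fps_const ((1 / z) ^ k) * fps_X ^ (b * k) * E k) * N =
        (\<Sum>p\<in>{..M} \<times> {..M}. fps_const (z ^ fst p * (1 / z) ^ snd p) *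
           (fps_X ^ (a * fst p) * E (fst p) * (fps_X ^ (b * snd p) * E (snd p)) * N))"
    proof -
      have eq: "(\<Sum>i\<le>M. fps_const (z ^ i) * fps_X ^ (a * i) * E i) *
        (\<Sum>k\<le>M. fps_const ((1 / z) ^ k) * fps_X ^ (b * k) * E k) =
        (\<Sum>p\<in>{..M} \<times> {..M}. (fps_const (z ^ fst p) * fps_X ^ (a * fst p) * E (fst p)) *
           (fps_const ((1 / z) ^ snd p) * fps_X ^ (b * snd p) * E (snd p)))"
        by (simp only: sum_product sum.cartesian_product case_prod_unfold)
      show ?thesis
        unfolding eq unfolding sum_distrib_right
        by (intro sum.cong refl) (simp only: fps_const_mult[symmetric] mult_ac)
    qed
    also have "\<dots> $ n = (\<Sum>p\<in>{..M} \<times> {..M}. coef p * z ^ fst p * (1 / z) ^ snd p)"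
      unfolding fps_sum_nth fps_mult_left_const_nth
      by (intro sum.cong) (simp_all add: coef_def case_prod_unfold)
    finally show ?thesis .
  qed
  \<comment> \<open>Multiplying by z^M removes negative powers. The exponents subtracted never
    exceed M, so the natural subtraction is exact and polynomials in z result.\<close>
  have shift: "z ^ M * (v * z ^ i * (1 / z) ^ k) = v * z ^ (M + i - k)" if "0 < z" "k \<le> M" for v z :: real and i k
  proof -
    have "z ^ (M + i) = z ^ (M + i - k) * z ^ k" using that by (simp flip: power_add)
    then show ?thesis using that by (simp add: power_add power_one_over field_simps)
  qed
  have "(\<Sum>p\<in>partition_pairs n. w p * z ^ (M + residue_parts_pair a m p - residue_parts_pair b m p)) =
      (\<Sum>p\<in>{..M} \<times> {..M}. coef p * z ^ (M + fst p - snd p))" if z: "0 < z" for z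
  proof -
    have "(\<Sum>p\<in>partition_pairs n. w p * z ^ (M + residue_parts_pair a m p - residue_parts_pair b m p)) =
       z ^ M * (\<Sum>p\<in>partition_pairs n. w p * z ^ residue_parts_pair a m p * (1 / z) ^ residue_parts_pair b m p)"
      unfolding sum_distrib_left
    proof (rule sum.cong)
      fix p assume "p \<in> partition_pairs n"
      then have "residue_parts_pair b m p \<le> M" using residue_parts_pair_le[of p n b m] n by simp
      then show "w p * z ^ (M + residue_parts_pair a m p - residue_parts_pair b m p) =
          z ^ M * (w p * z ^ residue_parts_pair a m p * (1 / z) ^ residue_parts_pair b m p)"
        by (simp only: shift[OF z])
    qed simp
    also have "\<dots> = (\<Sum>p\<in>{..M} \<times> {..M}. coef p * z ^ (M + fst p - snd p))"
      unfolding gf[OF z] sum_distrib_left by (intro sum.cong refl shift[OF z]) auto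
    finally show ?thesis .
  qed
  then have "(\<Sum>p\<in>{p \<in> partition_pairs n. M + residue_parts_pair a m p - residue_parts_pair b m p = M + d}. w p) =
      (\<Sum>p\<in>{p \<in> {..M} \<times> {..M}. M + fst p - snd p = M + d}. coef p)"
    by (intro sum_powers_eq_imp_coeff_eq finite_partition_pairs) simp_all
  also have "{p \<in> partition_pairs n. M + residue_parts_pair a m p - residue_parts_pair b m p = M + d} =
      {p \<in> partition_pairs n. residue_parts_pair a m p = residue_parts_pair b m p + d}"
  proof -
    have "residue_parts_pair b m p \<le> M" if "p \<in> partition_pairs n" for p
      using residue_parts_pair_le[OF that, of b m] n by simp
    then show ?thesis by force
  qed
  also have "{p \<in> {..M} \<times> {..M}. M + fst p - snd p = M + d} = (\<lambda>k. (k + d, k)) ` {..M - d}"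
    using n(2) by (auto simp: image_iff)
  also have "(\<Sum>p\<in>(\<lambda>k. (k + d, k)) ` {..M - d}. coef p) = (\<Sum>k\<le>M - d. coef (k + d, k))"
    by (subst sum.reindex) (auto simp: inj_on_def)
  \<comment> \<open>The terms added beyond k = M - d start at X^(a (k + d)) with k + d > M > n, so
    they do not reach coefficient n.\<close>
  also have "\<dots> = (\<Sum>k<Suc M. coef (k + d, k))"
  proof (rule sum.mono_neutral_left)
    show "\<forall>k\<in>{..<Suc M} - {..M - d}. coef (k + d, k) = 0"
    proof
      fix k assume "k \<in> {..<Suc M} - {..M - d}"
      then have "n < k + d" using n by auto
      also have "k + d \<le> a * (k + d)" using ab by simp
      finally show "coef (k + d, k) = 0"
        by (simp add: coef_def mult.assoc fps_X_power_mult_nth)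
    qed
  qed auto
  also have "(\<Sum>k<Suc M. coef (k + d, k)) = (fps_X ^ (a * d) * (\<Sum>k<Suc M. (fps_X ^ m) ^ k * E k * E (k + d)) * N) $ n"
    unfolding sum_distrib_left sum_distrib_right fps_sum_nth
  proof (rule sum.cong)
    fix k
    have "fps_X ^ (a * (k + d)) * fps_X ^ (b * k) = (fps_X ^ (a * d) * (fps_X ^ m) ^ k :: real fps)"
      unfolding ab(1)[symmetric] power_mult[symmetric] power_add[symmetric] by (simp add: algebra_simps)
    moreover have "fps_X ^ (a * (k + d)) * E (k + d) * (fps_X ^ (b * k) * E k) * N =
        (fps_X ^ (a * (k + d)) * fps_X ^ (b * k)) * (E (k + d) * E k * N)"
      by (simp only: mult_ac)
    ultimately have "fps_X ^ (a * (k + d)) * E (k + d) * (fps_X ^ (b * k) * E k) * N =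
        fps_X ^ (a * d) * ((fps_X ^ m) ^ k * E k * E (k + d)) * N"
      by (simp only: mult_ac)
    then show "coef (k + d, k) = (fps_X ^ (a * d) * ((fps_X ^ m) ^ k * E k * E (k + d)) * N) $ n"
      by (simp only: coef_def prod.case)
  qed simp
  finally show ?thesis by (simp only: charge_count_def w_def E_def N_def)
qed

lemma biased_count_eq_sum:
  "biased_count n a b m x y = (\<Sum>d=1..n. charge_count n a b m x y d)"
proof -
  have "{z \<in> partition_pairs n. residue_parts_pair a m z > residue_parts_pair b m z} =
    (\<Union>d\<in>{1..n}. {z \<in> partition_pairs n. residue_parts_pair a m z = residue_parts_pair b m z + d})"
    (is "?L = ?R")
  proof (intro equalityI subsetI)
    fix z assume z: "z \<in> ?L"
    define d where "d = residue_parts_pair a m z - residue_parts_pair b m z"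
    have "d \<in> {1..n}" "residue_parts_pair a m z = residue_parts_pair b m z + d"
      using z residue_parts_pair_le[of z n a m] by (auto simp: d_def)
    then show "z \<in> ?R" using z by auto
  qed auto
  then show ?thesis
    unfolding biased_count_def charge_count_def
    by (simp only:) (rule sum.UNION_disjoint, auto simp: finite_partition_pairs)
qed

lemma weighted_count_eq:
  "weighted_count n x y = biased_count n a b m x y + biased_count n b a m x y + charge_count n a b m x y 0"
proof -
  let ?A = "{z \<in> partition_pairs n. residue_parts_pair a m z > residue_parts_pair b m z}"
  let ?B = "{z \<in> partition_pairs n. residue_parts_pair b m z > residue_parts_pair a m z}"
  let ?C = "{z \<in> partition_pairs n. residue_parts_pair a m z = residue_parts_pair b m z + 0}"
  let ?w = "\<lambda>z :: nat list \<times> nat list. x ^ length (fst z) * y ^ length (snd z)"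
  have fin: "finite ?A" "finite ?B" "finite ?C" using finite_partition_pairs by simp_all
  have "sum ?w (partition_pairs n) = sum ?w (?A \<union> ?B \<union> ?C)"
    by (rule sum.cong) auto
  also have "\<dots> = sum ?w (?A \<union> ?B) + sum ?w ?C"
    using fin by (intro sum.union_disjoint) auto
  also have "sum ?w (?A \<union> ?B) = sum ?w ?A + sum ?w ?B"
    using fin by (intro sum.union_disjoint) auto
  finally show ?thesis
    unfolding weighted_count_def biased_count_def charge_count_def .
qed

lemma weighted_count_pos:
  assumes "(x, y) \<in> {(1, 0), (0, 1), (1, 1 :: real)}"
  shows "0 < weighted_count n x y"
proof -
  have part: "(if n = 0 then [] else [n]) \<in> distinct_partitions" "sum_list (if n = 0 then [] else [n]) = n"
    "[] \<in> distinct_partitions" "distinct_partitions \<subseteq> partitions"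
    by (auto simp: distinct_partitions_def partitions_def)
  \<comment> \<open>The single part n, placed in the component whose weight is 1; for n = 0 the
    empty pair.\<close>
  define z where "z = (if x = 0 then ([], if n = 0 then [] else [n]) else (if n = 0 then [] else [n], []))"
  have z: "z \<in> partition_pairs n"
    using part by (auto simp: z_def partition_pairs_def)
  have "x ^ length (fst z) * y ^ length (snd z) = 1"
    using assms by (auto simp: z_def)
  moreover have "x ^ length (fst z) * y ^ length (snd z) \<le> weighted_count n x y"
    unfolding weighted_count_def using assms
    by (intro member_le_sum z finite_partition_pairs) auto
  ultimately show ?thesis by simp
qed

section \<open>Slow variation of Euler products\<close>

definition fps_nonneg :: "real fps \<Rightarrow> bool" where
  "fps_nonneg f \<longleftrightarrow> (\<forall>n. 0 \<le> f $ n)"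

lemma fps_nonnegD: "fps_nonneg f \<Longrightarrow> 0 \<le> f $ n"
  by (simp add: fps_nonneg_def)

lemma fps_nonneg_mult: "fps_nonneg f \<Longrightarrow> fps_nonneg g \<Longrightarrow> fps_nonneg (f * g)"
  by (auto simp: fps_nonneg_def fps_mult_nth intro!: sum_nonneg)

lemma fps_nonneg_1: "fps_nonneg 1"
  by (simp add: fps_nonneg_def)

lemma fps_nonneg_power: "fps_nonneg f \<Longrightarrow> fps_nonneg (f ^ k)"
  by (induction k) (simp_all add: fps_nonneg_mult fps_nonneg_1)

lemma fps_nonneg_prod: "(\<And>i. i \<in> I \<Longrightarrow> fps_nonneg (f i)) \<Longrightarrow> fps_nonneg (prod f I)"
  by (induction I rule: infinite_finite_induct) (simp_all add: fps_nonneg_mult fps_nonneg_1)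

lemma fps_nonneg_one_plus_X_power: "fps_nonneg (1 + fps_X ^ k)"
  by (simp add: fps_nonneg_def)

text \<open>A general c covers 1 / (1 - q^w) and, through c = -1, the logarithmic derivative of 1 +
  q^w.\<close>

lemma inverse_one_minus_cX_power_nth:
  fixes c :: real
  assumes "0 < w"
  shows "inverse (1 - fps_const c * fps_X ^ w) $ n = (if w dvd n then c ^ (n div w) else 0)"
proof (induction n rule: less_induct)
  case (less n)
  have "inverse (1 - fps_const c * fps_X ^ w) $ n = (1 :: real fps) $ n +
      (if w \<le> n then c * inverse (1 - fps_const c * fps_X ^ w) $ (n - w) else 0)"
    using fps_nth_mult_inverse_one_minus[OF assms, of 1 c n] by simp
  also have "\<dots> = (if w dvd n then c ^ (n div w) else 0)"
  proof (cases "w \<le> n")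
    case True
    then have "w dvd n - w \<longleftrightarrow> w dvd n" "n div w = Suc ((n - w) div w)"
      using assms by (simp_all add: dvd_minus_self le_div_geq)
    then show ?thesis using True assms less.IH[of "n - w"] by simp
  next
    case False
    then show ?thesis using assms by (auto dest: dvd_imp_le)
  qed
  finally show ?case .
qed

lemma inverse_one_minus_X_power_nth:
  assumes "0 < w"
  shows "inverse (1 - fps_X ^ w) $ n = (if w dvd n then 1 else 0 :: real)"
  using inverse_one_minus_cX_power_nth[OF assms, of 1 n] by simp

lemma fps_nonneg_inverse_one_minus_X_power: "0 < w \<Longrightarrow> fps_nonneg (inverse (1 - fps_X ^ w))"
  by (simp add: fps_nonneg_def inverse_one_minus_X_power_nth)

lemmas fps_nonneg_intros = fps_nonneg_mult fps_nonneg_power fps_nonneg_prod fps_nonneg_1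
  fps_nonneg_one_plus_X_power fps_nonneg_inverse_one_minus_X_power

lemma fps_mult_nth_ge:
  assumes "fps_nonneg f" "fps_nonneg g"
  shows "f $ i * g $ j \<le> (f * g) $ (i + j)"
proof -
  have "f $ i * g $ (i + j - i) \<le> (\<Sum>k=0..i + j. f $ k * g $ (i + j - k))"
    using assms by (intro member_le_sum) (auto simp: fps_nonneg_def)
  then show ?thesis by (simp add: fps_mult_nth)
qed

lemma fps_mult_nth_ge_1:
  assumes "fps_nonneg f" "fps_nonneg g" "1 \<le> f $ i" "1 \<le> g $ j"
  shows "1 \<le> (f * g) $ (i + j)"
  using fps_mult_nth_ge[OF assms(1,2), of i j] mult_mono[OF assms(3,4)] assms(3) by simp

text \<open>Picks the term of degree \<phi> i from each factor; nothing cancels. It will exhibit a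
  coefficient of a polynomial in a prescribed residue class.\<close>

lemma fps_prod_nth_ge_1:
  assumes "finite I" "\<And>i. i \<in> I \<Longrightarrow> fps_nonneg (f i)" "\<And>i. i \<in> I \<Longrightarrow> 1 \<le> f i $ \<phi> i"
  shows "1 \<le> prod f I $ sum \<phi> I"
  using assms
proof (induction I rule: finite_induct)
  case (insert i I)
  then show ?case by (simp add: fps_mult_nth_ge_1 fps_nonneg_prod)
qed simp

lemma fps_power_nth_ge_1:
  assumes "fps_nonneg f" "f $ 0 = 1" "1 \<le> f $ k" "0 < c"
  shows "1 \<le> (f ^ c) $ k"
proof -
  obtain d where c: "c = Suc d" using assms(4) gr0_implies_Suc by blast
  have "(f ^ d) $ 0 = 1" using assms(2) by (induction d) simp_all
  then show ?thesis
    using fps_mult_nth_ge_1[of f "f ^ d" k 0] assms by (simp add: c fps_nonneg_power)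
qed

text \<open>Used with sets closed under addition. Quadratic lower bounds can hold only on such a
  set, since some residue classes modulo m may be missed.\<close>

definition fps_supp :: "nat set \<Rightarrow> real fps \<Rightarrow> bool" where
  "fps_supp S f \<longleftrightarrow> (\<forall>n. f $ n \<noteq> 0 \<longrightarrow> n \<in> S)"

context
  fixes S :: "nat set"
  assumes zero: "0 \<in> S" and add: "\<And>i j. i \<in> S \<Longrightarrow> j \<in> S \<Longrightarrow> i + j \<in> S"
begin

lemma fps_supp_1: "fps_supp S 1"
  using zero by (simp add: fps_supp_def)

lemma fps_supp_mult: "fps_supp S f \<Longrightarrow> fps_supp S g \<Longrightarrow> fps_supp S (f * g)"
  unfolding fps_supp_def
proof (intro allI impI)
  fix n assume *: "\<forall>n. f $ n \<noteq> 0 \<longrightarrow> n \<in> S" "\<forall>n. g $ n \<noteq> 0 \<longrightarrow> n \<in> S" "(f * g) $ n \<noteq> 0"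
  then obtain i where "i \<in> {0..n}" "f $ i * g $ (n - i) \<noteq> 0"
    unfolding fps_mult_nth by (meson sum.not_neutral_contains_not_neutral)
  then show "n \<in> S" using * add[of i "n - i"] by auto
qed

lemma fps_supp_power: "fps_supp S f \<Longrightarrow> fps_supp S (f ^ k)"
  by (induction k) (simp_all add: fps_supp_mult fps_supp_1)

lemma fps_supp_prod: "(\<And>i. i \<in> I \<Longrightarrow> fps_supp S (f i)) \<Longrightarrow> fps_supp S (prod f I)"
  by (induction I rule: infinite_finite_induct) (simp_all add: fps_supp_mult fps_supp_1)

lemma multiple_mem: "k \<in> S \<Longrightarrow> k * j \<in> S"
  by (induction j) (simp_all add: zero add)

lemma fps_supp_inverse_one_minus_X_power: "k \<in> S \<Longrightarrow> 0 < k \<Longrightarrow> fps_supp S (inverse (1 - fps_X ^ k))"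
  by (auto simp: fps_supp_def inverse_one_minus_X_power_nth multiple_mem elim!: dvdE split: if_splits)

lemma fps_supp_one_plus_X_power: "k \<in> S \<Longrightarrow> fps_supp S (1 + fps_X ^ k)"
  using zero by (auto simp: fps_supp_def split: if_splits)

end

text \<open>The series l is q f' / f, written without division: it is additive over products and
  expresses n f(n) as a convolution of l and f.\<close>

definition has_log_deriv :: "real fps \<Rightarrow> real fps \<Rightarrow> bool" where
  "has_log_deriv f l \<longleftrightarrow> fps_X * fps_deriv f = f * l"

lemma has_log_deriv_1: "has_log_deriv 1 0"
  by (simp add: has_log_deriv_def)

lemma has_log_deriv_mult:
  assumes "has_log_deriv f l" "has_log_deriv g k"
  shows "has_log_deriv (f * g) (l + k)"
proof -
  have "fps_X * fps_deriv (f * g) = f * (fps_X * fps_deriv g) + (fps_X * fps_deriv f) * g"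
    by (simp add: algebra_simps)
  also have "\<dots> = f * g * (l + k)"
    using assms unfolding has_log_deriv_def by (simp only: algebra_simps)
  finally show ?thesis by (simp add: has_log_deriv_def)
qed

lemma has_log_deriv_one_minus_cX_power:
  fixes c :: real
  assumes "0 < w"
  defines "l \<equiv> of_nat w * (fps_const c * fps_X ^ w * inverse (1 - fps_const c * fps_X ^ w))"
  shows "has_log_deriv (1 - fps_const c * fps_X ^ w) (- l)"
    and "has_log_deriv (inverse (1 - fps_const c * fps_X ^ w)) l"
proof -
  let ?u = "1 - fps_const c * fps_X ^ w"
  have inv: "inverse ?u * ?u = 1" using assms by (intro inverse_mult_eq_1) simp
  have X: "fps_X * fps_X ^ (w - 1) = (fps_X ^ w :: real fps)"
    using assms by (simp add: power_eq_if)
  have "fps_X * fps_deriv ?u = - (of_nat w * fps_const c * (fps_X * fps_X ^ (w - 1)))"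
    by (simp add: fps_deriv_power fps_of_nat algebra_simps)
  then have dX: "fps_X * fps_deriv ?u = - (of_nat w * fps_const c * fps_X ^ w)"
    unfolding X .
  moreover have "?u * (- l) = - (of_nat w * fps_const c * fps_X ^ w) * (inverse ?u * ?u)"
    unfolding l_def by (simp only: mult_ac mult_minus_left mult_minus_right)
  ultimately show "has_log_deriv ?u (- l)" unfolding has_log_deriv_def inv by simp
  have "inverse ?u * (inverse ?u * (fps_X * fps_deriv ?u)) + (fps_X * fps_deriv (inverse ?u)) * (inverse ?u * ?u)
      = inverse ?u * (fps_X * fps_deriv (inverse ?u * ?u))"
    by (simp only: fps_deriv_mult distrib_left mult_ac add_ac)
  also have "\<dots> = 0" unfolding inv by simp
  finally have "inverse ?u * (inverse ?u * (fps_X * fps_deriv ?u)) + (fps_X * fps_deriv (inverse ?u)) * (inverse ?u * ?u) = 0" .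
  then have "fps_X * fps_deriv (inverse ?u) = - (inverse ?u * (inverse ?u * (fps_X * fps_deriv ?u)))"
    unfolding inv by (simp add: add_eq_0_iff)
  also have "\<dots> = inverse ?u * l"
    unfolding dX l_def by (simp only: mult_ac mult_minus_left mult_minus_right minus_minus)
  finally show "has_log_deriv (inverse ?u) l" unfolding has_log_deriv_def .
qed

lemma log_deriv_coeff:
  fixes c :: real
  assumes "0 < w"
  shows "(of_nat w * (fps_const c * fps_X ^ w * inverse (1 - fps_const c * fps_X ^ w))) $ i =
     (if w dvd i \<and> 0 < i then real w * c ^ (i div w) else 0)"
proof -
  have "(of_nat w * (fps_const c * fps_X ^ w * inverse (1 - fps_const c * fps_X ^ w))) $ i =
      real w * (c * (if i < w then 0 else inverse (1 - fps_const c * fps_X ^ w) $ (i - w)))"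
  proof -
    have "(of_nat w :: real fps) = fps_const (real w)" by (simp add: fps_of_nat)
    then show ?thesis by (simp only: mult.assoc fps_mult_left_const_nth fps_X_power_mult_nth)
  qed
  also have "\<dots> = (if w dvd i \<and> 0 < i then real w * c ^ (i div w) else 0)"
  proof (cases "i < w")
    case True
    then show ?thesis by (auto dest: dvd_imp_le)
  next
    case False
    then have "w dvd i - w \<longleftrightarrow> w dvd i" "i div w = Suc ((i - w) div w)"
      using assms by (simp_all add: dvd_minus_self le_div_geq)
    then show ?thesis using False assms by (simp add: inverse_one_minus_cX_power_nth)
  qed
  finally show ?thesis .
qed

lemma has_log_deriv_bounded:
  assumes "0 < w"
  obtains l where "has_log_deriv (1 + fps_X ^ w) l" "\<And>i. \<bar>l $ i\<bar> \<le> (if w dvd i \<and> 0 < i then real w else 0)"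
proof -
  define l :: "real fps" where "l = of_nat w * (fps_const (-1) * fps_X ^ w * inverse (1 - fps_const (-1) * fps_X ^ w))"
  have "has_log_deriv (1 - fps_const (-1) * fps_X ^ w) (- l)"
    unfolding l_def by (rule has_log_deriv_one_minus_cX_power(1)[OF assms])
  moreover have "1 - fps_const (-1) * fps_X ^ w = (1 + fps_X ^ w :: real fps)"
    by (simp add: fps_const_neg[symmetric] del: fps_const_neg)
  moreover have "\<bar>(- l) $ i\<bar> \<le> (if w dvd i \<and> 0 < i then real w else 0)" for i
    unfolding l_def fps_neg_nth log_deriv_coeff[OF assms] by (simp add: abs_mult power_abs)
  ultimately show ?thesis using that by metis
qed

lemma has_log_deriv_inverse_bounded:
  assumes "0 < w"
  obtains l where "has_log_deriv (inverse (1 - fps_X ^ w)) l"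
    "\<And>i. \<bar>l $ i\<bar> \<le> (if w dvd i \<and> 0 < i then real w else 0)"
proof -
  define l :: "real fps" where "l = of_nat w * (fps_const 1 * fps_X ^ w * inverse (1 - fps_const 1 * fps_X ^ w))"
  have "has_log_deriv (inverse (1 - fps_const 1 * fps_X ^ w)) l"
    unfolding l_def by (rule has_log_deriv_one_minus_cX_power(2)[OF assms])
  moreover have "\<bar>l $ i\<bar> \<le> (if w dvd i \<and> 0 < i then real w else 0)" for i
    unfolding l_def log_deriv_coeff[OF assms] by simp
  ultimately show ?thesis using that[of l] by simp
qed

lemma has_log_deriv_nth:
  assumes "has_log_deriv f l"
  shows "real n * f $ n = (\<Sum>i=0..n. l $ i * f $ (n - i))"
proof -
  have "real n * f $ n = (fps_X * fps_deriv f) $ n" by (cases n) simp_all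
  also have "\<dots> = (l * f) $ n" using assms by (simp add: has_log_deriv_def mult.commute)
  finally show ?thesis by (simp add: fps_mult_nth)
qed

text \<open>\<open>n\<^sub>0\<close> is fixed before \<open>V\<close>, because \<open>V\<close> will
  depend on the cutoff of the product. Under differencing, indices of R from
  \<open>k\<^sub>0\<close> on keep only a fraction \<epsilon>/2, as linear is small against
  quadratic; the finitely many below are paid for by V(n - k) = O(h / n).\<close>

lemma coeff_difference_small:
  fixes R :: "real fps" and \<epsilon> C C' c :: real
  assumes R: "fps_nonneg R" and c: "0 < c" and \<epsilon>: "0 < \<epsilon>"
    and S: "fps_supp S R" "\<And>i j. i \<in> S \<Longrightarrow> j \<in> S \<Longrightarrow> i + j \<in> S"
    and low: "\<And>k. k \<in> S \<Longrightarrow> W \<le> k \<Longrightarrow> c * real k ^ 2 \<le> R $ k"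
    and up: "\<And>k. W \<le> k \<Longrightarrow> (R * (1 - fps_X ^ m)) $ k \<le> C' * real k"
    and C': "0 \<le> C'" and C: "0 \<le> C"
  obtains n\<^sub>0 where "\<And>V l n. fps_nonneg V \<Longrightarrow> has_log_deriv V l \<Longrightarrow>
    (\<And>i. \<bar>l $ i\<bar> \<le> C * real i ^ 2) \<Longrightarrow> (\<And>i. l $ i \<noteq> 0 \<Longrightarrow> i \<in> S \<and> W \<le> i) \<Longrightarrow> n\<^sub>0 \<le> n \<Longrightarrow>
    (R * V * (1 - fps_X ^ m)) $ n \<le> \<epsilon> * (R * V) $ n"
proof -
  \<comment> \<open>\<open>k\<^sub>0\<close> makes C' k at most (\<epsilon>/2) c k^2. In
    \<open>n\<^sub>0\<close>, the bound \<open>2 * k\<^sub>0\<close> ensures n - k \<ge> n / 2, and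
    the other one makes K times 2 C / (c n), the total of the initial terms relative to h, at most
    \<epsilon>/2.\<close>
  define k\<^sub>0 where "k\<^sub>0 = max (max W 1) (nat \<lceil>2 * C' / (\<epsilon> * c)\<rceil>)"
  define K where "K = (\<Sum>k<k\<^sub>0. R $ k)"
  define n\<^sub>0 where "n\<^sub>0 = max (2 * k\<^sub>0) (nat \<lceil>4 * C * K / (c * \<epsilon>)\<rceil>)"
  have K: "0 \<le> K" unfolding K_def using R by (intro sum_nonneg) (simp add: fps_nonneg_def)
  define B where "B = R * (1 - fps_X ^ m)"
  have B_le: "B $ k \<le> R $ k" for k
    using R by (simp add: B_def right_diff_distrib fps_X_power_mult_right_nth fps_nonneg_def)
  have B_small: "B $ k \<le> \<epsilon> / 2 * R $ k" if "k\<^sub>0 \<le> k" for k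
  proof (cases "k \<in> S")
    case True
    have "2 * C' / (\<epsilon> * c) \<le> real k" using that unfolding k\<^sub>0_def by linarith
    then have "C' \<le> \<epsilon> / 2 * c * real k" using \<epsilon> c by (simp add: field_simps)
    then have "C' * real k \<le> \<epsilon> / 2 * c * real k * real k" by (intro mult_right_mono) simp_all
    also have "\<dots> = \<epsilon> / 2 * (c * real k ^ 2)" by (simp add: power2_eq_square)
    also have "\<dots> \<le> \<epsilon> / 2 * R $ k"
      using True that \<epsilon> unfolding k\<^sub>0_def by (intro mult_left_mono low) auto
    finally show ?thesis using up[of k] that unfolding B_def k\<^sub>0_def by simp
  next
    case False
    then have "R $ k = 0" using S by (auto simp: fps_supp_def)
    then show ?thesis using B_le[of k] by simp
  qed
  show ?thesis
  proof (rule that[of n\<^sub>0])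
    fix V l n
    assume V: "fps_nonneg V" and l: "has_log_deriv V l" "\<And>i. \<bar>l $ i\<bar> \<le> C * real i ^ 2"
      "\<And>i. l $ i \<noteq> 0 \<Longrightarrow> i \<in> S \<and> W \<le> i" and n: "n\<^sub>0 \<le> n"
    define h where "h = (R * V) $ n"
    have h: "0 \<le> h" unfolding h_def using R V by (intro fps_nonnegD fps_nonneg_mult)
    have n_pos: "0 < n" and n_k: "2 * k\<^sub>0 \<le> n" using n by (auto simp: n\<^sub>0_def k\<^sub>0_def)
    \<comment> \<open>(n - k) V(n - k) is the convolution of l and V. Where l(i) is nonzero, k + i
      lies in \<open>S\<close> beyond \<open>W\<close>, so C i^2 is at most (C / c) R(k + i), and
      what results is part of the convolution defining h.\<close>
    have key: "R $ k * V $ (n - k) \<le> R $ k * (2 * C / (c * real n) * h)" if k: "k < k\<^sub>0" for k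
    proof (cases "R $ k = 0")
      case False
      then have kS: "k \<in> S" using S by (auto simp: fps_supp_def)
      have "real (n - k) * V $ (n - k) = (\<Sum>i=0..n - k. l $ i * V $ (n - k - i))"
        by (rule has_log_deriv_nth[OF l(1)])
      also have "\<dots> \<le> (\<Sum>i=0..n - k. C / c * (R $ (k + i) * V $ (n - (k + i))))"
      proof (rule sum_mono)
        fix i
        have "l $ i \<le> C / c * R $ (k + i)"
        proof (cases "l $ i = 0")
          case True
          then show ?thesis using R C c by (simp add: fps_nonneg_def)
        next
          case False
          then have i: "k + i \<in> S" "W \<le> k + i" using l(3) kS S(2) by (auto intro: trans_le_add2)
          have "l $ i \<le> C * real i ^ 2" using l(2)[of i] by simp
          also have "\<dots> \<le> C * real (k + i) ^ 2" using C by (intro mult_left_mono power_mono) auto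
          also have "\<dots> = C / c * (c * real (k + i) ^ 2)" using c by simp
          also have "\<dots> \<le> C / c * R $ (k + i)" using C c by (intro mult_left_mono low i) auto
          finally show ?thesis .
        qed
        then have "l $ i * V $ (n - (k + i)) \<le> C / c * R $ (k + i) * V $ (n - (k + i))"
          using V by (intro mult_right_mono) (simp_all add: fps_nonneg_def)
        then show "l $ i * V $ (n - k - i) \<le> C / c * (R $ (k + i) * V $ (n - (k + i)))"
          by (simp add: mult.assoc)
      qed
      also have "\<dots> = C / c * (\<Sum>j=k..n. R $ j * V $ (n - j))"
        unfolding sum_distrib_left[symmetric] using k n_k sum.shift_bounds_cl_nat_ivl[of "\<lambda>j. R $ j * V $ (n - j)" 0 k "n - k"]
        by (simp add: add.commute)
      also have "\<dots> \<le> C / c * h"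
        unfolding h_def fps_mult_nth using R V C c
        by (intro mult_left_mono sum_mono2) (auto simp: fps_nonneg_def)
      finally have 1: "real (n - k) * V $ (n - k) \<le> C / c * h" .
      have "real n / 2 \<le> real (n - k)" using k n_k by (simp add: of_nat_diff)
      then have "real n / 2 * V $ (n - k) \<le> real (n - k) * V $ (n - k)"
        using V by (intro mult_right_mono) (simp_all add: fps_nonneg_def)
      then have "real n / 2 * V $ (n - k) \<le> C / c * h" using 1 by linarith
      then have "V $ (n - k) \<le> 2 * C / (c * real n) * h"
        using n_pos c by (simp add: field_simps)
      then show ?thesis using R by (intro mult_left_mono) (auto simp: fps_nonneg_def)
    qed simp
    have "4 * C * K / (c * \<epsilon>) \<le> real n" using n unfolding n\<^sub>0_def by linarith
    then have bound: "K * (2 * C / (c * real n)) \<le> \<epsilon> / 2"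
      using c \<epsilon> n_pos by (simp add: field_simps)
    have "(R * V * (1 - fps_X ^ m)) $ n = (B * V) $ n"
      by (simp add: B_def mult_ac)
    also have "\<dots> = (\<Sum>k=0..n. B $ k * V $ (n - k))" by (rule fps_mult_nth)
    also have "\<dots> \<le> (\<Sum>k=0..n. (if k < k\<^sub>0 then R $ k * V $ (n - k) else 0) + \<epsilon> / 2 * (R $ k * V $ (n - k)))"
    proof (rule sum_mono)
      fix k
      have V': "0 \<le> V $ (n - k)" "0 \<le> R $ k" using V R by (simp_all add: fps_nonneg_def)
      show "B $ k * V $ (n - k) \<le> (if k < k\<^sub>0 then R $ k * V $ (n - k) else 0) + \<epsilon> / 2 * (R $ k * V $ (n - k))"
      proof (cases "k < k\<^sub>0")
        case True
        then show ?thesis using mult_right_mono[OF B_le[of k] V'(1)] V' \<epsilon> by (simp add: add_increasing2)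
      next
        case False
        then show ?thesis using mult_right_mono[OF B_small[of k] V'(1)] by simp
      qed
    qed
    also have "\<dots> = (\<Sum>k=0..n. if k < k\<^sub>0 then R $ k * V $ (n - k) else 0) + \<epsilon> / 2 * h"
      by (simp add: sum.distrib sum_distrib_left h_def fps_mult_nth)
    also have "(\<Sum>k=0..n. if k < k\<^sub>0 then R $ k * V $ (n - k) else 0) = (\<Sum>k<k\<^sub>0. R $ k * V $ (n - k))"
      using n_k by (intro sum.mono_neutral_cong_right) auto
    also have "\<dots> \<le> (\<Sum>k<k\<^sub>0. R $ k * (2 * C / (c * real n) * h))"
      by (intro sum_mono key) simp
    also have "\<dots> = K * (2 * C / (c * real n)) * h"
      by (simp only: K_def sum_distrib_right mult.assoc)
    also have "\<dots> \<le> \<epsilon> / 2 * h" using bound h by (intro mult_right_mono)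
    finally show "(R * V * (1 - fps_X ^ m)) $ n \<le> \<epsilon> * (R * V) $ n"
      by (simp add: h_def field_simps)
  qed
qed

text \<open>The coefficients of an Euler product may vanish in some residue classes modulo \<open>m\<close>; the set below
  contains all indices of nonzero coefficients.\<close>

definition residue_closure :: "nat \<Rightarrow> nat set \<Rightarrow> nat set" where
  "residue_closure m A = {n. \<exists>e. [n = (\<Sum>r\<in>A. e r * r)] (mod m)}"

lemma residue_closure_add:
  assumes "i \<in> residue_closure m A" "j \<in> residue_closure m A"
  shows "i + j \<in> residue_closure m A"
proof -
  obtain e e' where "[i = (\<Sum>r\<in>A. e r * r)] (mod m)" "[j = (\<Sum>r\<in>A. e' r * r)] (mod m)"
    using assms by (auto simp: residue_closure_def)
  then have "[i + j = (\<Sum>r\<in>A. (e r + e' r) * r)] (mod m)"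
    by (simp add: distrib_right sum.distrib cong_add)
  then show ?thesis unfolding residue_closure_def mem_Collect_eq
    by (intro exI[where x = "\<lambda>r. e r + e' r"])
qed

lemma residue_closure_multiple: "m dvd n \<Longrightarrow> n \<in> residue_closure m A"
  unfolding residue_closure_def by (auto simp: cong_def intro!: exI[of _ "\<lambda>_. 0"])

lemma residue_closure_mem:
  assumes "finite A" "n mod m \<in> A"
  shows "n \<in> residue_closure m A"
proof -
  have "(\<Sum>r\<in>A. (if r = n mod m then 1 else 0) * r) = n mod m"
    using assms by (simp add: if_distrib[of "\<lambda>x. x * _"] cong: if_cong)
  then have "[n = (\<Sum>r\<in>A. (if r = n mod m then 1 else 0) * r)] (mod m)" by (simp add: cong_def)
  then show ?thesis unfolding residue_closure_def mem_Collect_eq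
    by (intro exI[where x = "\<lambda>r. if r = n mod m then 1 else 0"])
qed

text \<open>A multiple e r * r is replaced by the sum of the distinct numbers r, r + m, r + 2 m,
  ..., with e r reduced modulo m. Distinctness matters because a factor 1 + q^k can be used only
  once.\<close>

lemma residue_closure_subset_sum:
  assumes "n \<in> residue_closure m A" "A \<subseteq> {1..<m}"
  obtains B where "B \<subseteq> {1..<m * m}" "\<And>k. k \<in> B \<Longrightarrow> k mod m \<in> A" "[n = \<Sum>B] (mod m)"
proof -
  obtain e where e: "[n = (\<Sum>r\<in>A. e r * r)] (mod m)"
    using assms by (auto simp: residue_closure_def)
  have fin: "finite A" using assms(2) finite_subset by blast
  define T where "T = Sigma A (\<lambda>r. {..<e r mod m})"
  define g where "g = (\<lambda>(r, j). r + m * j :: nat)"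
  have T: "r \<in> A \<and> r < m \<and> 0 < r \<and> j < m" if "(r, j) \<in> T" for r j
  proof -
    have r: "r \<in> A" "j < e r mod m" using that by (simp_all add: T_def)
    then have "r \<in> {1..<m}" using assms(2) by blast
    moreover have "j < m"
      using r(2) \<open>r \<in> {1..<m}\<close> by (intro less_trans[OF r(2)]) simp
    ultimately show ?thesis using r by simp
  qed
  have "inj_on g T"
  proof (rule inj_onI)
    fix p p' assume *: "p \<in> T" "p' \<in> T" "g p = g p'"
    obtain r j r' j' where p: "p = (r, j)" "p' = (r', j')" by fastforce
    have "r < m" "r' < m" using T * p by auto
    moreover have eq: "r + m * j = r' + m * j'" using * by (simp add: g_def p)
    ultimately have "r = r'" by (metis mod_less mod_mult_self2)
    then show "p = p'" using eq \<open>r < m\<close> by (simp add: p)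
  qed
  then have "\<Sum>(g ` T) = (\<Sum>(r, j)\<in>T. r + m * j)"
    by (simp add: sum.reindex g_def case_prod_unfold)
  also have "\<dots> = (\<Sum>r\<in>A. \<Sum>j<e r mod m. r + m * j)"
    unfolding T_def using fin by (subst sum.Sigma) auto
  also have "[\<dots> = (\<Sum>r\<in>A. e r * r)] (mod m)"
  proof (rule cong_sum)
    fix r
    have "[(\<Sum>j<e r mod m. r + m * j) = (\<Sum>j<e r mod m. r)] (mod m)"
      by (intro cong_sum) (simp add: cong_def)
    also have "(\<Sum>j<e r mod m. r) = (e r mod m) * r" by simp
    also have "[(e r mod m) * r = e r * r] (mod m)" by (simp add: cong_def mod_mult_left_eq)
    finally show "[(\<Sum>j<e r mod m. r + m * j) = e r * r] (mod m)" .
  qed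
  finally have "[\<Sum>(g ` T) = (\<Sum>r\<in>A. e r * r)] (mod m)" .
  with e have "[n = \<Sum>(g ` T)] (mod m)" using cong_sym cong_trans by blast
  moreover have "g p \<in> {1..<m * m} \<and> g p mod m \<in> A" if "p \<in> T" for p
  proof -
    obtain r j where p: "p = (r, j)" by fastforce
    have *: "r \<in> A" "r < m" "0 < r" "Suc j \<le> m" using T[of r j] that by (auto simp: p)
    have "r + m * j < m * Suc j" using * by simp
    also have "\<dots> \<le> m * m" using * by (intro mult_le_mono2)
    finally show ?thesis using * by (simp add: g_def p)
  qed
  ultimately show ?thesis by (intro that[of "g ` T"]) auto
qed

section \<open>The series with parts m, 2 m and 3 m\<close>

context
  fixes m :: nat
  assumes m: "0 < m"
begin

definition "three_parts = (\<Prod>k\<in>{m, 2 * m, 3 * m}. inverse (1 - fps_X ^ k) :: real fps)"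

lemma three_parts_eq: "three_parts =
    inverse (1 - fps_X ^ m) * inverse (1 - fps_X ^ (2 * m)) * inverse (1 - fps_X ^ (3 * m))"
  using m by (simp add: three_parts_def mult.assoc)

lemma nth_mult_inverse:
  fixes f :: "real fps"
  assumes "0 < c" "c \<le> i"
  shows "(f * inverse (1 - fps_X ^ (c * m))) $ (m * i) =
     f $ (m * i) + (f * inverse (1 - fps_X ^ (c * m))) $ (m * (i - c))"
proof -
  have "c * m \<le> m * i" "m * i - c * m = m * (i - c)"
    using assms by (simp_all add: diff_mult_distrib2 mult.commute)
  then show ?thesis
    using fps_nth_mult_inverse_one_minus[of "c * m" f 1 "m * i"] assms m by simp
qed

text \<open>Partitions of i into parts at most 3 number about i^2 / 12. With the shift to (i + 1)^2
  the induction closes: from i - 3 to i the bound grows by (2 i - 1) / 4, less than the (i + 1) / 2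
  contributed by parts at most 2.\<close>

lemma three_parts_lower: "(real i + 1) ^ 2 / 12 \<le> three_parts $ (m * i)"
proof -
  define u where "u = (inverse (1 - fps_X ^ m) * inverse (1 - fps_X ^ (2 * m)) :: real fps)"
  have t: "three_parts = u * inverse (1 - fps_X ^ (3 * m))" by (simp add: three_parts_eq u_def)
  have one: "inverse (1 - fps_X ^ m) $ (m * i) = (1 :: real)" for i
    using m by (simp add: inverse_one_minus_X_power_nth)
  have nonneg: "fps_nonneg u" "fps_nonneg three_parts"
    using m by (auto simp: u_def t intro!: fps_nonneg_intros)
  have u: "(real i + 1) / 2 \<le> u $ (m * i)" for i
  proof (induction i rule: less_induct)
    case (less i)
    have "1 \<le> u $ (m * i)"
      using fps_mult_nth_ge[of "inverse (1 - fps_X ^ m)" "inverse (1 - fps_X ^ (2 * m))" "m * i" 0] m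
      by (simp add: u_def one fps_nonneg_intros)
    moreover have "u $ (m * i) = 1 + u $ (m * (i - 2))" if "2 \<le> i"
      using nth_mult_inverse[of 2 i "inverse (1 - fps_X ^ m)"] that unfolding u_def by (simp add: one)
    ultimately show ?case
      using less.IH[of "i - 2"] by (cases "2 \<le> i") (simp_all add: of_nat_diff)
  qed
  show ?thesis
  proof (induction i rule: less_induct)
    case (less i)
    show ?case
    proof (cases "3 \<le> i")
      case True
      have "(real i + 1) ^ 2 / 12 \<le> (real i + 1) / 2 + (real (i - 3) + 1) ^ 2 / 12"
        using True by (simp add: of_nat_diff power2_eq_square field_simps)
      moreover have "three_parts $ (m * i) = u $ (m * i) + three_parts $ (m * (i - 3))"
        unfolding t using nth_mult_inverse[of 3 i u] True by simp
      moreover have "(real (i - 3) + 1) ^ 2 / 12 \<le> three_parts $ (m * (i - 3))"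
        using True by (intro less.IH) simp
      ultimately show ?thesis using u[of i] by linarith
    next
      case False
      have "u $ (m * i) * 1 \<le> three_parts $ (m * i)"
        using fps_mult_nth_ge[of u "inverse (1 - fps_X ^ (3 * m))" "m * i" 0] m nonneg
        by (simp add: t fps_nonneg_intros)
      then have "(real i + 1) / 2 \<le> three_parts $ (m * i)" using u[of i] by simp
      moreover have "(real i + 1) ^ 2 / 12 \<le> (real i + 1) / 2"
      proof -
        have "i = 0 \<or> i = 1 \<or> i = 2" using False by arith
        then show ?thesis by (auto simp: power2_eq_square)
      qed
      ultimately show ?thesis by linarith
    qed
  qed
qed

text \<open>Differencing removes the factor 1 / (1 - q^m) and leaves a convolution of k + 1 terms,
  each at most 1.\<close>

lemma three_parts_diff: "(three_parts * (1 - fps_X ^ m)) $ k \<le> real k + 1"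
proof -
  have inv: "inverse (1 - fps_X ^ m) * (1 - fps_X ^ m :: real fps) = 1"
    using m by (intro inverse_mult_eq_1) simp
  have "three_parts * (1 - fps_X ^ m) = inverse (1 - fps_X ^ m) * (1 - fps_X ^ m) *
     (inverse (1 - fps_X ^ (2 * m)) * inverse (1 - fps_X ^ (3 * m)))"
    unfolding three_parts_eq by (simp only: mult_ac)
  then have eq: "three_parts * (1 - fps_X ^ m) = inverse (1 - fps_X ^ (2 * m)) * inverse (1 - fps_X ^ (3 * m))"
    unfolding inv by simp
  have "(inverse (1 - fps_X ^ (2 * m)) * inverse (1 - fps_X ^ (3 * m))) $ k \<le> (\<Sum>i=0..k. 1 :: real)"
    unfolding fps_mult_nth using m by (intro sum_mono) (simp add: inverse_one_minus_X_power_nth)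
  then show "(three_parts * (1 - fps_X ^ m)) $ k \<le> real k + 1" unfolding eq by simp
qed

lemma three_parts_nonneg: "fps_nonneg three_parts"
  unfolding three_parts_eq using m by (intro fps_nonneg_intros) auto

text \<open>One coefficient of \<open>P\<close> in the residue class of k suffices. From k - f = m i
  and 2 f \<le> k follows k \<le> 2 m (i + 1), which turns 1 / 12 into 1 / (48 m^2).\<close>

lemma three_parts_mult_lower:
  assumes P: "fps_nonneg P" and f: "[k = f] (mod m)" "2 * f \<le> k" "1 \<le> P $ f"
  shows "1 / (48 * real m ^ 2) * real k ^ 2 \<le> (three_parts * P) $ k"
proof -
  have "m dvd k - f" using f by (simp add: cong_altdef_nat)
  then obtain i where i: "k - f = m * i" by blast
  then have k: "k = m * i + f" using f by linarith
  have "real k \<le> 2 * (real m * (real i + 1))"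
  proof -
    have "real k \<le> 2 * real (m * i)" using f(2) k by linarith
    then show ?thesis using m by (simp add: algebra_simps)
  qed
  then have "real k ^ 2 \<le> (2 * (real m * (real i + 1))) ^ 2" by (intro power_mono) simp_all
  then have "1 / (48 * real m ^ 2) * real k ^ 2 \<le> 1 / (48 * real m ^ 2) * (2 * (real m * (real i + 1))) ^ 2"
    by (intro mult_left_mono) simp_all
  also have "\<dots> = (real i + 1) ^ 2 / 12"
    using m by (simp add: power_mult_distrib)
  also have "\<dots> \<le> three_parts $ (m * i)" by (rule three_parts_lower)
  also have "\<dots> \<le> three_parts $ (m * i) * P $ f"
    using mult_left_mono[OF f(3) fps_nonnegD[OF three_parts_nonneg]] by simp
  also have "\<dots> \<le> (three_parts * P) $ k"
    unfolding k by (intro fps_mult_nth_ge P three_parts_nonneg)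
  finally show ?thesis .
qed

lemma three_parts_mult_diff:
  assumes P: "fps_nonneg P" and D: "\<And>k. D \<le> k \<Longrightarrow> P $ k = 0"
  shows "(three_parts * P * (1 - fps_X ^ m)) $ k \<le> (\<Sum>f<D. P $ f) * (real k + 1)"
proof -
  have "(three_parts * P * (1 - fps_X ^ m)) $ k = (P * (three_parts * (1 - fps_X ^ m))) $ k"
    by (simp only: mult_ac)
  also have "\<dots> = (\<Sum>f=0..k. P $ f * (three_parts * (1 - fps_X ^ m)) $ (k - f))"
    by (rule fps_mult_nth)
  also have "\<dots> \<le> (\<Sum>f=0..k. P $ f * (real k + 1))"
  proof (intro sum_mono mult_left_mono)
    fix f
    have "(three_parts * (1 - fps_X ^ m)) $ (k - f) \<le> real (k - f) + 1" by (rule three_parts_diff)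
    then show "(three_parts * (1 - fps_X ^ m)) $ (k - f) \<le> real k + 1" by linarith
  qed (use P in \<open>simp add: fps_nonneg_def\<close>)
  also have "\<dots> = (\<Sum>f=0..k. P $ f) * (real k + 1)" by (simp add: sum_distrib_right)
  also have "(\<Sum>f=0..k. P $ f) \<le> (\<Sum>f<D. P $ f)"
  proof -
    have "(\<Sum>f=0..k. P $ f) = (\<Sum>f\<in>{0..k} \<inter> {..<D}. P $ f)"
      using D by (intro sum.mono_neutral_right) (auto, meson not_le)
    also have "\<dots> \<le> (\<Sum>f<D. P $ f)"
      using P by (intro sum_mono2) (auto simp: fps_nonneg_def)
    finally show ?thesis .
  qed
  finally show ?thesis by (simp add: mult_right_mono)
qed

end

text \<open>Recording absolute values only, 1 + q^w and 1 / (1 - q^w) share one bound.\<close>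

definition log_deriv_bounded :: "real fps \<Rightarrow> (nat \<Rightarrow> real) \<Rightarrow> bool" where
  "log_deriv_bounded f b \<longleftrightarrow> (\<exists>l. has_log_deriv f l \<and> (\<forall>i. \<bar>l $ i\<bar> \<le> b i))"

lemma log_deriv_bounded_mult:
  assumes "log_deriv_bounded f b" "log_deriv_bounded g b'"
  shows "log_deriv_bounded (f * g) (\<lambda>i. b i + b' i)"
proof -
  obtain l l' where *: "has_log_deriv f l" "has_log_deriv g l'" "\<And>i. \<bar>l $ i\<bar> \<le> b i" "\<And>i. \<bar>l' $ i\<bar> \<le> b' i"
    using assms by (auto simp: log_deriv_bounded_def)
  have "\<bar>(l + l') $ i\<bar> \<le> b i + b' i" for i
    using *(3,4)[of i] by simp
  then show ?thesis using has_log_deriv_mult[OF *(1,2)] by (auto simp: log_deriv_bounded_def)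
qed

lemma log_deriv_bounded_1: "log_deriv_bounded 1 (\<lambda>i. 0)"
  using has_log_deriv_1 by (force simp: log_deriv_bounded_def)

lemma log_deriv_bounded_power:
  assumes "log_deriv_bounded f b"
  shows "log_deriv_bounded (f ^ k) (\<lambda>i. real k * b i)"
proof (induction k)
  case (Suc k)
  then show ?case using log_deriv_bounded_mult[OF assms Suc] by (simp add: algebra_simps)
qed (simp add: log_deriv_bounded_1)

lemma log_deriv_bounded_prod:
  assumes "finite I" "\<And>j. j \<in> I \<Longrightarrow> log_deriv_bounded (f j) (b j)"
  shows "log_deriv_bounded (prod f I) (\<lambda>i. \<Sum>j\<in>I. b j i)"
  using assms
  by (induction I rule: finite_induct) (simp_all add: log_deriv_bounded_mult log_deriv_bounded_1)

definition divisor_bound :: "nat \<Rightarrow> nat \<Rightarrow> real" where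
  "divisor_bound w i = (if w dvd i \<and> 0 < i then real w else 0)"

lemma log_deriv_bounded_one_plus:
  assumes "0 < w"
  shows "log_deriv_bounded (1 + fps_X ^ w) (divisor_bound w)"
  unfolding log_deriv_bounded_def divisor_bound_def
  by (rule has_log_deriv_bounded[OF assms]) blast

lemma log_deriv_bounded_inverse:
  assumes "0 < w"
  shows "log_deriv_bounded (inverse (1 - fps_X ^ w)) (divisor_bound w)"
  unfolding log_deriv_bounded_def divisor_bound_def
  by (rule has_log_deriv_inverse_bounded[OF assms]) blast

section \<open>Splitting polynomial factors off the product\<close>

definition fps_finite :: "real fps \<Rightarrow> bool" where
  "fps_finite f \<longleftrightarrow> (\<exists>D. \<forall>k\<ge>D. f $ k = 0)"

lemma fps_finite_mult:
  assumes "fps_finite f" "fps_finite g"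
  shows "fps_finite (f * g)"
proof -
  obtain D D' where D: "\<And>k. D \<le> k \<Longrightarrow> f $ k = 0" "\<And>k. D' \<le> k \<Longrightarrow> g $ k = 0"
    using assms by (auto simp: fps_finite_def)
  have "(f * g) $ k = 0" if "D + D' \<le> k" for k
    unfolding fps_mult_nth
  proof (intro sum.neutral ballI)
    fix i
    show "f $ i * g $ (k - i) = 0"
      using that by (cases "D \<le> i") (simp_all add: D)
  qed
  then show ?thesis by (auto simp: fps_finite_def)
qed

lemma fps_finite_1: "fps_finite 1"
  by (auto simp: fps_finite_def intro!: exI[of _ 1])

lemma fps_finite_power: "fps_finite f \<Longrightarrow> fps_finite (f ^ k)"
  by (induction k) (simp_all add: fps_finite_mult fps_finite_1)

lemma fps_finite_prod: "(\<And>i. i \<in> I \<Longrightarrow> fps_finite (f i)) \<Longrightarrow> fps_finite (prod f I)"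
  by (induction I rule: infinite_finite_induct) (simp_all add: fps_finite_mult fps_finite_1)

definition fps_geometric :: "nat \<Rightarrow> nat \<Rightarrow> real fps" where
  "fps_geometric W k = (\<Sum>s<W. fps_X ^ (k * s))"

text \<open>Moves the low order part of a factor into a polynomial. The logarithmic derivative of
  the remaining 1 / (1 - q^(W k)) starts at W k \<ge> W, where the lower bound for \<open>R\<close>
  is available.\<close>

lemma inverse_one_minus_X_power_geometric:
  assumes "0 < W" "0 < k"
  shows "inverse (1 - fps_X ^ k) = fps_geometric W k * inverse (1 - fps_X ^ (W * k))"
proof -
  have "(1 - fps_X ^ k) * (\<Sum>s<W. (fps_X ^ k) ^ s) = (1 - (fps_X ^ k) ^ W :: real fps)"
    by (rule sum_gp_strict[symmetric, unfolded diff_eq_eq] one_diff_power_eq[symmetric])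
  then have g: "(1 - fps_X ^ k) * fps_geometric W k = 1 - fps_X ^ (W * k)"
    by (simp add: fps_geometric_def power_mult[symmetric] mult.commute[of W k])
  have i1: "inverse (1 - fps_X ^ k) * (1 - fps_X ^ k :: real fps) = 1"
    and i2: "inverse (1 - fps_X ^ (W * k)) * (1 - fps_X ^ (W * k) :: real fps) = 1"
    using assms by (intro inverse_mult_eq_1; simp)+
  have "inverse (1 - fps_X ^ k) = inverse (1 - fps_X ^ k) * (inverse (1 - fps_X ^ (W * k)) * ((1 - fps_X ^ k) * fps_geometric W k))"
    unfolding g i2 by simp
  also have "\<dots> = (inverse (1 - fps_X ^ k) * (1 - fps_X ^ k)) * (fps_geometric W k * inverse (1 - fps_X ^ (W * k)))"
    by (simp only: mult_ac)
  finally show ?thesis unfolding i1 by simp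
qed

lemma fps_geometric_nth:
  "fps_geometric W k $ n = (\<Sum>s<W. if n = k * s then 1 else 0)"
  by (simp add: fps_geometric_def fps_sum_nth)

lemma fps_geometric_nth_nonzero: "fps_geometric W k $ n \<noteq> 0 \<Longrightarrow> k dvd n"
proof (rule ccontr)
  assume "fps_geometric W k $ n \<noteq> 0" "\<not> k dvd n"
  moreover from this(2) have "n \<noteq> k * s" for s by auto
  ultimately show False by (simp add: fps_geometric_nth)
qed

lemma fps_geometric_nonneg: "fps_nonneg (fps_geometric W k)"
  by (simp add: fps_nonneg_def fps_geometric_nth sum_nonneg)

lemma fps_geometric_nth_0: "0 < W \<Longrightarrow> 0 < k \<Longrightarrow> fps_geometric W k $ 0 = 1"
  by (simp add: fps_geometric_nth)

lemma fps_geometric_nth_1: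
  assumes "1 < W" "0 < k"
  shows "1 \<le> fps_geometric W k $ k"
proof -
  have "(\<Sum>s<W. if k = k * s then 1 else 0) = (\<Sum>s<W. if s = 1 then 1 else 0 :: real)"
    using assms by (intro sum.cong) auto
  then show ?thesis using assms by (simp add: fps_geometric_nth)
qed

lemma fps_geometric_finite: "fps_finite (fps_geometric W k)"
  unfolding fps_finite_def
proof (intro exI allI impI)
  fix n assume "Suc (k * W) \<le> n"
  then have "n \<noteq> k * s" if "s < W" for s using that by (metis Suc_n_not_le_n le_trans less_imp_le mult_le_mono2)
  then show "fps_geometric W k $ n = 0" by (simp add: fps_geometric_nth)
qed

definition euler_factor :: "(nat \<Rightarrow> nat) \<Rightarrow> (nat \<Rightarrow> nat) \<Rightarrow> nat \<Rightarrow> real fps" where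
  "euler_factor \<alpha> \<beta> k = (1 + fps_X ^ k) ^ \<alpha> k * inverse (1 - fps_X ^ k) ^ \<beta> k"

lemma euler_factor_nonneg: "0 < k \<Longrightarrow> fps_nonneg (euler_factor \<alpha> \<beta> k)"
  unfolding euler_factor_def by (intro fps_nonneg_intros) simp

text \<open>Factors with k < W go into \<open>R\<close> except for their tails 1 / (1 - q^(W k)),
  which join the factors with k \<ge> W in \<open>V\<close>. The assumption on multiples of m
  supplies \<open>three_parts\<close>, and periodicity makes the support a union of residue
  classes.\<close>

lemma euler_product_difference_small:
  fixes \<alpha> \<beta> :: "nat \<Rightarrow> nat" and \<epsilon> :: real
  assumes m: "0 < m" and \<epsilon>: "0 < \<epsilon>"
    and bnd: "\<And>k. \<alpha> k \<le> c" "\<And>k. \<beta> k \<le> c"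
    and per: "\<And>k k'. 0 < k \<Longrightarrow> 0 < k' \<Longrightarrow> [k = k'] (mod m) \<Longrightarrow> 0 < \<alpha> k + \<beta> k \<Longrightarrow> 0 < \<alpha> k' + \<beta> k'"
    and mult: "\<And>k. 0 < k \<Longrightarrow> m dvd k \<Longrightarrow> 1 \<le> \<beta> k"
  obtains n\<^sub>0 where "\<And>n N. n\<^sub>0 \<le> n \<Longrightarrow> n \<le> N \<Longrightarrow>
    ((\<Prod>k=1..N. euler_factor \<alpha> \<beta> k) * (1 - fps_X ^ m)) $ n \<le> \<epsilon> * (\<Prod>k=1..N. euler_factor \<alpha> \<beta> k) $ n"
proof -
  define A where "A = {r \<in> {1..<m}. 0 < \<alpha> r + \<beta> r}"
  define S where "S = residue_closure m A"
  \<comment> \<open>The summand 2 m^4 dominates twice the sum of any subset of {1..<m * m}; 3 m puts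
    m, 2 m and 3 m below \<open>W\<close>.\<close>
  define W where "W = 2 * (m * m * (m * m)) + 3 * m + 2"
  \<comment> \<open>Reserves one power of 1 / (1 - q^k) at each of k = m, 2 m, 3 m for
    \<open>three_parts\<close>.\<close>
  define t :: "nat \<Rightarrow> nat" where "t = (\<lambda>k. if k \<in> {m, 2 * m, 3 * m} then 1 else 0)"
  define P where "P = (\<Prod>k\<in>{1..<W}. (1 + fps_X ^ k) ^ \<alpha> k * fps_geometric W k ^ (\<beta> k - t k))"
  define R where "R = three_parts m * P"
  define V where "V = (\<lambda>N. (\<Prod>k\<in>{1..<W}. inverse (1 - fps_X ^ (W * k)) ^ (\<beta> k - t k)) *
      (\<Prod>k\<in>{W..N}. euler_factor \<alpha> \<beta> k))"
  have W: "1 < W" "3 * m < W" by (simp_all add: W_def)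
  have S0: "0 \<in> S" and Sm: "m dvd k \<Longrightarrow> k \<in> S" for k
    by (auto simp: S_def residue_closure_multiple)
  have Sadd: "i \<in> S \<Longrightarrow> j \<in> S \<Longrightarrow> i + j \<in> S" for i j
    unfolding S_def by (rule residue_closure_add)
  have Smem: "k \<in> S" if "0 < k" "0 < \<alpha> k + \<beta> k" for k
  proof (cases "m dvd k")
    case False
    then have "0 < k mod m" by (simp add: mod_greater_zero_iff_not_dvd)
    then have "k mod m \<in> A" using per[of k "k mod m"] that m by (auto simp: A_def cong_def)
    then show ?thesis unfolding S_def by (intro residue_closure_mem) (simp_all add: A_def)
  qed (rule Sm)
  have P_nonneg: "fps_nonneg P"
    unfolding P_def by (intro fps_nonneg_intros fps_geometric_nonneg)
  have "fps_finite (1 + fps_X ^ k)" for k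
    by (auto simp: fps_finite_def intro!: exI[of _ "k + 1"])
  then have "fps_finite P"
    unfolding P_def by (intro fps_finite_prod fps_finite_mult fps_finite_power fps_geometric_finite)
  then obtain D where D: "\<And>k. D \<le> k \<Longrightarrow> P $ k = 0" by (auto simp: fps_finite_def)
  have P_supp: "fps_supp S P"
    unfolding P_def
  proof (intro fps_supp_prod fps_supp_mult S0 Sadd)
    fix k assume k: "k \<in> {1..<W}"
    have "fps_supp S (1 + fps_X ^ k)" "fps_supp S (fps_geometric W k)" if "0 < \<alpha> k + \<beta> k"
    proof -
      have "k \<in> S" using Smem[of k] k that by simp
      then show "fps_supp S (1 + fps_X ^ k)" using Sadd by (intro fps_supp_one_plus_X_power[OF S0]) auto
      show "fps_supp S (fps_geometric W k)"
        unfolding fps_supp_def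
      proof (intro allI impI)
        fix n assume "fps_geometric W k $ n \<noteq> 0"
        then have "k dvd n" by (rule fps_geometric_nth_nonzero)
        then show "n \<in> S" using multiple_mem[OF S0 Sadd \<open>k \<in> S\<close>] by (auto elim!: dvdE)
      qed
    qed
    note supp = this
    have power: "fps_supp S (f ^ n)" if "0 < n \<Longrightarrow> fps_supp S f" for f n
    proof (cases n)
      case 0
      then show ?thesis using fps_supp_1[OF S0] Sadd by simp
    next
      case (Suc l)
      then have "fps_supp S f" using that by simp
      then show ?thesis using S0 Sadd by (intro fps_supp_power)
    qed
    show "fps_supp S ((1 + fps_X ^ k) ^ \<alpha> k)" using supp(1) by (intro power) simp
    show "fps_supp S (fps_geometric W k ^ (\<beta> k - t k))" using supp(2) by (intro power) simp
  qed
  have q_supp: "fps_supp S (three_parts m)"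
    unfolding three_parts_eq[OF m]
    by (intro fps_supp_mult fps_supp_inverse_one_minus_X_power S0 Sadd) (use m Sm in auto)
  have R_supp: "fps_supp S R"
    unfolding R_def by (intro fps_supp_mult S0 Sadd P_supp q_supp)
  have R_nonneg: "fps_nonneg R"
    unfolding R_def by (intro fps_nonneg_mult three_parts_nonneg P_nonneg m)
  have R_low: "1 / (48 * real m ^ 2) * real k ^ 2 \<le> R $ k" if k: "k \<in> S" "W \<le> k" for k
  proof -
    have "A \<subseteq> {1..<m}" by (auto simp: A_def)
    with k(1) obtain B where B: "B \<subseteq> {1..<m * m}" "\<And>j. j \<in> B \<Longrightarrow> j mod m \<in> A" "[k = \<Sum>B] (mod m)"
      unfolding S_def by (rule residue_closure_subset_sum) blast
    have fin: "finite B" using B(1) finite_subset by blast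
    have "\<Sum>B \<le> (\<Sum>j\<in>B. m * m)" using B(1) by (intro sum_mono) auto
    also have "\<dots> = card B * (m * m)" by simp
    also have "card B \<le> m * m"
    proof -
      have "card B \<le> card {1..<m * m}" using B(1) by (intro card_mono) simp_all
      also have "\<dots> \<le> m * m" by simp
      finally show ?thesis .
    qed
    then have "card B * (m * m) \<le> m * m * (m * m)" by (rule mult_le_mono1)
    finally have small: "2 * \<Sum>B \<le> k" using k(2) by (simp add: W_def)
    have BW: "B \<subseteq> {1..<W}"
    proof -
      have "m * m * 1 \<le> m * m * (m * m)" using m by (intro mult_le_mono2) simp
      then have "m * m \<le> W" unfolding W_def by linarith
      then show ?thesis by (intro subset_trans[OF B(1)]) auto
    qed
    \<comment> \<open>Takes q^j from the factor of each j in \<open>B\<close> and the constant term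
      elsewhere. Such a j is no multiple of m, so \<open>t\<close> has removed nothing from its
      factor.\<close>
    have "1 \<le> P $ (\<Sum>j\<in>{1..<W}. if j \<in> B then j else 0)"
      unfolding P_def
    proof (intro fps_prod_nth_ge_1)
      fix j assume j: "j \<in> {1..<W}"
      have nn: "fps_nonneg ((1 + fps_X ^ j) ^ \<alpha> j)" "fps_nonneg (fps_geometric W j ^ (\<beta> j - t j))"
        by (intro fps_nonneg_intros fps_geometric_nonneg)+
      then show "fps_nonneg ((1 + fps_X ^ j) ^ \<alpha> j * fps_geometric W j ^ (\<beta> j - t j))"
        by (rule fps_nonneg_mult)
      have pow0: "(f ^ n) $ 0 = 1" if "f $ 0 = 1" for f :: "real fps" and n
        using that by (induction n) simp_all
      have z: "((1 + fps_X ^ j) ^ \<alpha> j) $ 0 = (1 :: real)" "(fps_geometric W j ^ (\<beta> j - t j)) $ 0 = 1"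
        using j W by (auto intro!: pow0 simp: fps_geometric_nth_0)
      show "1 \<le> ((1 + fps_X ^ j) ^ \<alpha> j * fps_geometric W j ^ (\<beta> j - t j)) $ (if j \<in> B then j else 0)"
      proof (cases "j \<in> B")
        case True
        have jA: "j mod m \<in> A" using B(2) True .
        then have "\<not> m dvd j" by (auto simp: A_def)
        then have tj: "t j = 0" by (auto simp: t_def)
        have "0 < \<alpha> j + \<beta> j"
          using per[of "j mod m" j] jA j by (auto simp: A_def cong_def)
        then show ?thesis
        proof (cases "0 < \<alpha> j")
          case True
          have "(1::real) \<le> ((1 + fps_X ^ j) ^ \<alpha> j) $ j"
            using True j by (intro fps_power_nth_ge_1 fps_nonneg_intros) auto
          then show ?thesis
            using fps_mult_nth_ge_1[OF nn, of j 0] z \<open>j \<in> B\<close> by simp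
        next
          case False
          then have "0 < \<beta> j - t j" using \<open>0 < \<alpha> j + \<beta> j\<close> tj by simp
          then have "1 \<le> (fps_geometric W j ^ (\<beta> j - t j)) $ j"
            using j W by (intro fps_power_nth_ge_1 fps_geometric_nonneg fps_geometric_nth_1) (auto simp: fps_geometric_nth_0)
          then show ?thesis
            using fps_mult_nth_ge_1[OF nn, of 0 j] z \<open>j \<in> B\<close> by simp
        qed
      qed (use z in simp)
    qed simp
    also have "(\<Sum>j\<in>{1..<W}. if j \<in> B then j else 0) = \<Sum>B"
      using BW by (simp add: sum.inter_restrict[symmetric] Int_absorb1)
    finally show ?thesis
      unfolding R_def using B(3) small by (intro three_parts_mult_lower m P_nonneg)
  qed
  define C' where "C' = 2 * (\<Sum>f<D. P $ f)"
  have sumP: "0 \<le> (\<Sum>f<D. P $ f)" using P_nonneg by (intro sum_nonneg) (simp add: fps_nonneg_def)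
  have R_up: "(R * (1 - fps_X ^ m)) $ k \<le> C' * real k" if "W \<le> k" for k
  proof -
    have "(R * (1 - fps_X ^ m)) $ k \<le> (\<Sum>f<D. P $ f) * (real k + 1)"
      unfolding R_def by (rule three_parts_mult_diff[OF m P_nonneg D])
    also have "\<dots> \<le> (\<Sum>f<D. P $ f) * (2 * real k)"
      using that W sumP by (intro mult_left_mono) auto
    finally show ?thesis by (simp add: C'_def)
  qed
  define C where "C = real (c * W + 2 * c)"
  have prod_eq: "(\<Prod>k=1..N. euler_factor \<alpha> \<beta> k) = R * V N" if N: "W \<le> N" for N
  proof -
    have "(\<Prod>k=1..N. euler_factor \<alpha> \<beta> k) = (\<Prod>k\<in>{1..<W}. euler_factor \<alpha> \<beta> k) * (\<Prod>k\<in>{W..N}. euler_factor \<alpha> \<beta> k)"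
      using N W by (subst prod.union_disjoint[symmetric]) (auto intro!: prod.cong)
    also have "(\<Prod>k\<in>{1..<W}. euler_factor \<alpha> \<beta> k) = (\<Prod>k\<in>{1..<W}. inverse (1 - fps_X ^ k) ^ t k *
        ((1 + fps_X ^ k) ^ \<alpha> k * fps_geometric W k ^ (\<beta> k - t k)) * inverse (1 - fps_X ^ (W * k)) ^ (\<beta> k - t k))"
    proof (rule prod.cong)
      fix k assume k: "k \<in> {1..<W}"
      have "t k \<le> \<beta> k" using mult[of k] k by (auto simp: t_def)
      then have "inverse (1 - fps_X ^ k) ^ \<beta> k =
          (inverse (1 - fps_X ^ k) ^ t k * inverse (1 - fps_X ^ k) ^ (\<beta> k - t k) :: real fps)"
        by (simp flip: power_add)
      also have "inverse (1 - fps_X ^ k) ^ (\<beta> k - t k) =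
          fps_geometric W k ^ (\<beta> k - t k) * inverse (1 - fps_X ^ (W * k)) ^ (\<beta> k - t k)"
        using k W by (subst inverse_one_minus_X_power_geometric[of W]) (auto simp: power_mult_distrib)
      finally show "euler_factor \<alpha> \<beta> k = inverse (1 - fps_X ^ k) ^ t k *
        ((1 + fps_X ^ k) ^ \<alpha> k * fps_geometric W k ^ (\<beta> k - t k)) * inverse (1 - fps_X ^ (W * k)) ^ (\<beta> k - t k)"
        by (simp only: euler_factor_def mult_ac)
    qed simp
    also have "\<dots> = (\<Prod>k\<in>{1..<W}. inverse (1 - fps_X ^ k) ^ t k) * P *
       (\<Prod>k\<in>{1..<W}. inverse (1 - fps_X ^ (W * k)) ^ (\<beta> k - t k))"
      by (simp only: prod.distrib P_def)
    also have "(\<Prod>k\<in>{1..<W}. inverse (1 - fps_X ^ k) ^ t k) = three_parts m"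
      unfolding three_parts_def[OF m] using W m
      by (intro prod.mono_neutral_cong_right) (auto simp: t_def)
    finally show ?thesis by (simp only: R_def V_def mult_ac)
  qed
  have V_nonneg: "fps_nonneg (V N)" for N
    unfolding V_def using W by (intro fps_nonneg_intros euler_factor_nonneg) auto
  define b where "b = (\<lambda>N i. (\<Sum>k\<in>{1..<W}. real (\<beta> k - t k) * divisor_bound (W * k) i) +
      (\<Sum>k\<in>{W..N}. real (\<alpha> k) * divisor_bound k i + real (\<beta> k) * divisor_bound k i))"
  have V_log: "log_deriv_bounded (V N) (b N)" for N
    unfolding V_def b_def euler_factor_def using W
    by (intro log_deriv_bounded_mult log_deriv_bounded_prod log_deriv_bounded_power
        log_deriv_bounded_one_plus log_deriv_bounded_inverse) auto
  \<comment> \<open>Each of the fewer than W small factors contributes at most c i. Of the others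
    only those with k \<le> i matter, each giving at most 2 c i.\<close>
  have b_le: "b N i \<le> C * real i ^ 2" for N i
  proof -
    have d_le: "divisor_bound w i \<le> (if w \<le> i then real i else 0)" for w
      by (auto simp: divisor_bound_def dest: dvd_imp_le)
    have "(\<Sum>k\<in>{1..<W}. real (\<beta> k - t k) * divisor_bound (W * k) i) \<le> (\<Sum>k\<in>{1..<W}. real c * real i)"
    proof (intro sum_mono mult_mono)
      fix k
      show "real (\<beta> k - t k) \<le> real c" using bnd(2)[of k] by simp
      show "divisor_bound (W * k) i \<le> real i" using d_le[of "W * k"] by (auto split: if_splits)
    qed (simp_all add: divisor_bound_def)
    also have "\<dots> \<le> real (c * W) * real i"
      using W by (simp add: of_nat_diff algebra_simps)
    also have "\<dots> \<le> real (c * W) * (real i ^ 2)"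
      by (cases i) (auto simp: power2_eq_square intro!: mult_left_mono)
    finally have 1: "(\<Sum>k\<in>{1..<W}. real (\<beta> k - t k) * divisor_bound (W * k) i) \<le> real (c * W) * (real i ^ 2)" .
    have "(\<Sum>k\<in>{W..N}. real (\<alpha> k) * divisor_bound k i + real (\<beta> k) * divisor_bound k i) \<le>
        (\<Sum>k\<in>{W..N}. if k \<in> {1..i} then real (2 * c) * real i else 0)"
    proof (rule sum_mono)
      fix k assume k: "k \<in> {W..N}"
      have "real (\<alpha> k) * divisor_bound k i + real (\<beta> k) * divisor_bound k i = real (\<alpha> k + \<beta> k) * divisor_bound k i"
        by (simp add: distrib_right)
      also have "\<dots> \<le> real (2 * c) * (if k \<le> i then real i else 0)"
        using bnd[of k] d_le[of k] by (intro mult_mono) (auto simp: divisor_bound_def)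
      finally show "real (\<alpha> k) * divisor_bound k i + real (\<beta> k) * divisor_bound k i \<le>
          (if k \<in> {1..i} then real (2 * c) * real i else 0)" using k W by (auto split: if_splits)
    qed
    also have "\<dots> = (\<Sum>k\<in>{W..N} \<inter> {1..i}. real (2 * c) * real i)"
      by (simp only: sum.inter_restrict finite_atLeastAtMost)
    also have "\<dots> \<le> (\<Sum>k\<in>{1..i}. real (2 * c) * real i)"
      by (intro sum_mono2) auto
    also have "\<dots> = real (2 * c) * real i ^ 2" by (simp add: power2_eq_square)
    finally show ?thesis using 1 unfolding b_def C_def by (simp add: algebra_simps)
  qed
  have b_supp: "i \<in> S \<and> W \<le> i" if "b N i \<noteq> 0" for N i
  proof -
    have nz: "k dvd i \<and> k \<le> i" if "divisor_bound k i \<noteq> 0" for k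
      using that by (auto simp: divisor_bound_def dvd_imp_le split: if_splits)
    have dvdS: "i \<in> S" if "k \<in> S" "k dvd i" for k
      using that multiple_mem[OF S0 Sadd] by (auto elim!: dvdE)
    have "(\<Sum>k\<in>{1..<W}. real (\<beta> k - t k) * divisor_bound (W * k) i) \<noteq> 0 \<or>
        (\<Sum>k\<in>{W..N}. real (\<alpha> k) * divisor_bound k i + real (\<beta> k) * divisor_bound k i) \<noteq> 0"
      using that unfolding b_def by linarith
    then consider k where "k \<in> {1..<W}" "real (\<beta> k - t k) * divisor_bound (W * k) i \<noteq> 0"
      | k where "k \<in> {W..N}" "real (\<alpha> k) * divisor_bound k i + real (\<beta> k) * divisor_bound k i \<noteq> 0"
      by (elim disjE sum.not_neutral_contains_not_neutral) blast+
    then show ?thesis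
    proof cases
      case (1 k)
      then have "k \<in> S" "W * k dvd i" "W * k \<le> i" using Smem[of k] nz[of "W * k"] by auto
      moreover have "W * 1 \<le> W * k" using 1 by (intro mult_le_mono2) simp
      ultimately show ?thesis using dvdS[of k] by (auto intro: dvd_mult_right)
    next
      case (2 k)
      then have "divisor_bound k i \<noteq> 0" "0 < \<alpha> k + \<beta> k" by auto
      then show ?thesis using Smem[of k] nz[of k] dvdS[of k] 2 W by auto
    qed
  qed
  have c: "0 < 1 / (48 * real m ^ 2)" using m by simp
  obtain n\<^sub>1 where n\<^sub>1: "\<And>V l n. fps_nonneg V \<Longrightarrow> has_log_deriv V l \<Longrightarrow>
    (\<And>i. \<bar>l $ i\<bar> \<le> C * real i ^ 2) \<Longrightarrow> (\<And>i. l $ i \<noteq> 0 \<Longrightarrow> i \<in> S \<and> W \<le> i) \<Longrightarrow> n\<^sub>1 \<le> n \<Longrightarrow>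
    (R * V * (1 - fps_X ^ m)) $ n \<le> \<epsilon> * (R * V) $ n"
  proof (rule coeff_difference_small[OF R_nonneg c \<epsilon> R_supp Sadd R_low R_up])
    show "0 \<le> C'" "0 \<le> C" using sumP by (simp_all add: C'_def C_def)
  qed (assumption | erule that)+
  show ?thesis
  proof (rule that[of "max n\<^sub>1 W"])
    fix n N assume n: "max n\<^sub>1 W \<le> n" "n \<le> N"
    obtain l where l: "has_log_deriv (V N) l" "\<And>i. \<bar>l $ i\<bar> \<le> b N i"
      using V_log by (auto simp: log_deriv_bounded_def)
    have "(R * V N * (1 - fps_X ^ m)) $ n \<le> \<epsilon> * (R * V N) $ n"
    proof (rule n\<^sub>1[OF V_nonneg l(1)])
      show "\<bar>l $ i\<bar> \<le> C * real i ^ 2" for i using l(2)[of i] b_le[of N i] by linarith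
      show "i \<in> S \<and> W \<le> i" if "l $ i \<noteq> 0" for i
        using l(2)[of i] that b_supp[of N i] by auto
    qed (use n in simp)
    then show "((\<Prod>k=1..N. euler_factor \<alpha> \<beta> k) * (1 - fps_X ^ m)) $ n \<le> \<epsilon> * (\<Prod>k=1..N. euler_factor \<alpha> \<beta> k) $ n"
      using n by (simp only: prod_eq)
  qed
qed

section \<open>Sums of slowly varying sequences\<close>

lemma alternating_sum_bounds:
  fixes t :: "nat \<Rightarrow> real"
  assumes "\<And>j. 0 \<le> t j" "\<And>j. t (Suc j) \<le> t j"
  shows "0 \<le> (\<Sum>j<n. (-1) ^ j * t j)" "(\<Sum>j<n. (-1) ^ j * t j) \<le> t 0"
proof -
  have "0 \<le> (\<Sum>j<n. (-1) ^ j * t j) \<and> (\<Sum>j<n. (-1) ^ j * t j) \<le> t 0"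
    using assms
  proof (induction n arbitrary: t)
    case (Suc n)
    have "(\<Sum>j<Suc n. (-1) ^ j * t j) = t 0 - (\<Sum>j<n. (-1) ^ j * t (Suc j))"
      by (subst sum.lessThan_Suc_shift) (simp add: sum_negf)
    moreover have "0 \<le> (\<Sum>j<n. (-1) ^ j * t (Suc j)) \<and> (\<Sum>j<n. (-1) ^ j * t (Suc j)) \<le> t (Suc 0)"
      using Suc.IH[of "\<lambda>j. t (Suc j)"] Suc.prems by blast
    ultimately show ?case using Suc.prems(2)[of 0] by linarith
  qed simp
  then show "0 \<le> (\<Sum>j<n. (-1) ^ j * t j)" "(\<Sum>j<n. (-1) ^ j * t j) \<le> t 0" by blast+
qed

text \<open>Leibniz bounds: a fixed even cutoff bounds from below and a fixed odd one from above,
  however long the sum is. Only boundedly many terms then need an asymptotic evaluation.\<close>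

lemma alternating_sum_bracket:
  fixes t :: "nat \<Rightarrow> real"
  assumes "\<And>j. 0 \<le> t j" "\<And>j. t (Suc j) \<le> t j" "2 * J + 1 \<le> n"
  shows "(\<Sum>j<2 * J. (-1) ^ j * t j) \<le> (\<Sum>j<n. (-1) ^ j * t j)"
    and "(\<Sum>j<n. (-1) ^ j * t j) \<le> (\<Sum>j<2 * J + 1. (-1) ^ j * t j)"
proof -
  have split: "(\<Sum>j<p + l. (-1) ^ j * t j) = (\<Sum>j<p. (-1) ^ j * t j) + (-1) ^ p * (\<Sum>j<l. (-1) ^ j * t (p + j))" for p l
    by (induction l) (simp_all add: power_add algebra_simps)
  have nonneg: "0 \<le> (\<Sum>j<l. (-1) ^ j * t (p + j))" for p l
    using assms by (intro alternating_sum_bounds) auto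
  have n: "2 * J + (n - 2 * J) = n" "2 * J + 1 + (n - (2 * J + 1)) = n" using assms(3) by simp_all
  have sign: "(-1) ^ (2 * J) = (1 :: real)" "(-1) ^ (2 * J + 1) = (-1 :: real)" by simp_all
  show "(\<Sum>j<2 * J. (-1) ^ j * t j) \<le> (\<Sum>j<n. (-1) ^ j * t j)"
    using split[of "2 * J" "n - 2 * J"] nonneg[where p = "2 * J" and l = "n - 2 * J"] unfolding n sign by linarith
  show "(\<Sum>j<n. (-1) ^ j * t j) \<le> (\<Sum>j<2 * J + 1. (-1) ^ j * t j)"
    using split[of "2 * J + 1" "n - (2 * J + 1)"] nonneg[where p = "2 * J + 1" and l = "n - (2 * J + 1)"]
    unfolding n sign by linarith
qed

text \<open>Sequences are extended by zero to negative arguments, so that the sums below can be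
  truncated at any sufficiently large index.\<close>

definition zext :: "(nat \<Rightarrow> real) \<Rightarrow> int \<Rightarrow> real" where
  "zext h i = (if i < 0 then 0 else h (nat i))"

text \<open>As b is -a modulo m, replacing r by m - r exchanges the two sums.\<close>

lemma sum_residue_complement:
  fixes g :: "nat \<Rightarrow> real"
  assumes "a + b = (m :: nat)"
  shows "(\<Sum>r<m. g (r * b mod m)) = (\<Sum>r<m. g (r * a mod m))"
proof (cases "m = 0")
  case False
  have *: "((m - r) mod m) * a mod m = r * b mod m" if "r < m" "a + b = m" for r a b
  proof -
    have "((m - r) mod m) * a mod m = (m - r) * a mod m" by (simp add: mod_mult_left_eq)
    also have "(m - r) * a + r * m = r * b + a * m"
    proof -
      have "(m - r) * a + r * a = m * a" using that by (simp flip: distrib_right)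
      then show ?thesis using that by (metis add.assoc add.commute distrib_left mult.commute)
    qed
    then have "(m - r) * a mod m = r * b mod m" by (metis mod_mult_self1)
    finally show ?thesis .
  qed
  show ?thesis
  proof (rule sum.reindex_bij_witness[where i = "\<lambda>r. (m - r) mod m" and j = "\<lambda>r. (m - r) mod m"])
    fix r assume r: "r \<in> {..<m}"
    show "(m - (m - r) mod m) mod m = r" "(m - r) mod m \<in> {..<m}"
      using r False by (cases "r = 0"; simp)+
    show "g (((m - r) mod m) * a mod m) = g (r * b mod m)" using * r assms by simp
  qed (use False in \<open>auto simp: mod_if\<close>)
qed simp

text \<open>Both monotonicity and slow variation concern steps of m, because values in different
  residue classes need not be comparable.\<close>

locale slow_sequence =
  fixes h :: "nat \<Rightarrow> real" and m :: nat
  assumes m: "0 < m"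
    and h_nonneg: "\<And>n. 0 \<le> h n"
    and h_mono: "\<And>n. m \<le> n \<Longrightarrow> h (n - m) \<le> h n"
    and h_slow: "\<And>\<epsilon>. 0 < \<epsilon> \<Longrightarrow> \<exists>n\<^sub>0. \<forall>n\<ge>n\<^sub>0. m \<le> n \<longrightarrow> h n - h (n - m) \<le> \<epsilon> * h n"
begin

abbreviation (input) "H \<equiv> zext h"

lemma H_nonneg: "0 \<le> H i"
  by (simp add: zext_def h_nonneg)

lemma H_step: "H (i - int m) \<le> H i"
proof (cases "i < int m")
  case False
  then have "nat (i - int m) = nat i - m" by (simp add: nat_diff_distrib)
  then show ?thesis using False h_mono[of "nat i"] by (simp add: zext_def)
qed (simp add: zext_def h_nonneg)

lemma H_mono: "H (i - int m * int r) \<le> H i"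
proof (induction r)
  case (Suc r)
  have e: "i - int m * int (Suc r) = i - int m * int r - int m" by (simp add: algebra_simps)
  show ?case using H_step[of "i - int m * int r"] Suc unfolding e by linarith
qed simp

lemma H_mono': "j \<le> i \<Longrightarrow> int m dvd i - j \<Longrightarrow> H j \<le> H i"
proof -
  assume *: "j \<le> i" "int m dvd i - j"
  then obtain r where r: "i - j = int m * r" by blast
  then have "0 \<le> r" using * m by (metis diff_ge_0_iff_ge of_nat_0_less_iff zero_le_mult_iff not_less)
  then have "j = i - int m * int (nat r)" using r by simp
  then show ?thesis using H_mono by metis
qed

lemma H_slow:
  "\<exists>n\<^sub>0. \<forall>i\<ge>n\<^sub>0. \<forall>r\<le>R. H i / 2 \<le> H (i - int m * int r)"
proof -
  \<comment> \<open>Each step of m loses at most \<delta> * H i, so R steps lose at most half of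
    it.\<close>
  define \<delta> where "\<delta> = 1 / (2 * (real R + 1))"
  have \<delta>: "0 < \<delta>" by (simp add: \<delta>_def)
  from h_slow[OF \<delta>] obtain n\<^sub>0 where n\<^sub>0: "\<And>n. n\<^sub>0 \<le> n \<Longrightarrow> m \<le> n \<Longrightarrow> h n - h (n - m) \<le> \<delta> * h n"
    by blast
  have step: "H i - H (i - int m) \<le> \<delta> * H i" if "int (n\<^sub>0 + m) \<le> i" for i
  proof -
    have "nat (i - int m) = nat i - m" using that by (simp add: nat_diff_distrib)
    then show ?thesis using that n\<^sub>0[of "nat i"] by (simp add: zext_def)
  qed
  have "(1 - real r * \<delta>) * H i \<le> H (i - int m * int r)" if "int (n\<^sub>0 + m + m * R) \<le> i" "r \<le> R" for i r
    using that(2)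
  proof (induction r)
    case (Suc r)
    have e: "i - int m * int (Suc r) = i - int m * int r - int m" by (simp add: algebra_simps)
    have "int m * int r \<le> int (m * R)"
      unfolding of_nat_mult using Suc.prems by (intro mult_left_mono) simp_all
    then have "H (i - int m * int r) - H (i - int m * int r - int m) \<le> \<delta> * H (i - int m * int r)"
      using that(1) by (intro step) simp
    also have "\<dots> \<le> \<delta> * H i" using \<delta> by (intro mult_left_mono H_mono) simp
    finally show ?case using Suc unfolding e by (simp add: algebra_simps)
  qed simp
  moreover have "H i / 2 \<le> (1 - real r * \<delta>) * H i" if "r \<le> R" for r i
  proof -
    have "real r * \<delta> \<le> real R * \<delta>" using that \<delta> by (intro mult_right_mono) auto
    also have "real R * \<delta> \<le> 1 / 2" by (simp add: \<delta>_def field_simps)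
    finally have "1 / 2 * H i \<le> (1 - real r * \<delta>) * H i" using H_nonneg by (intro mult_right_mono) auto
    then show ?thesis by simp
  qed
  ultimately show ?thesis by (meson order_trans)
qed

text \<open>The total of \<open>h\<close> over the residue class of N, up to N. The range is
  generous: beyond it all arguments are negative.\<close>

definition progression_sum :: "int \<Rightarrow> real" where
  "progression_sum N = (\<Sum>i<nat (N + 1). H (N - int m * int i))"

abbreviation (input) "T \<equiv> progression_sum"

lemma H_vanish: "N < int i \<Longrightarrow> 1 \<le> k \<Longrightarrow> H (N - k * int i) = 0"
proof -
  assume *: "N < int i" "1 \<le> k"
  have "1 * int i \<le> k * int i" using * by (intro mult_right_mono) auto
  then show ?thesis using * by (simp add: zext_def)
qed

lemma T_eq: "N < int L \<Longrightarrow> (\<Sum>i<L. H (N - int m * int i)) = T N"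
  unfolding progression_sum_def
proof (rule sum.mono_neutral_right)
  assume "N < int L"
  show "\<forall>i\<in>{..<L} - {..<nat (N + 1)}. H (N - int m * int i) = 0"
    using m by (intro ballI H_vanish) auto
qed auto

lemma T_nonneg: "0 \<le> T N"
  by (simp add: progression_sum_def sum_nonneg H_nonneg)

lemma T_step: "T N = H N + T (N - int m)"
proof -
  define L where "L = nat (N + 1)"
  have "T N = (\<Sum>i<Suc L. H (N - int m * int i))" by (rule T_eq[symmetric]) (simp add: L_def)
  also have "\<dots> = H N + (\<Sum>i<L. H (N - int m - int m * int i))"
    by (subst sum.lessThan_Suc_shift) (simp add: algebra_simps)
  also have "(\<Sum>i<L. H (N - int m - int m * int i)) = T (N - int m)"
    using m by (intro T_eq) (simp add: L_def)
  finally show ?thesis .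
qed

lemma T_shift: "T (N - int m * int r) \<le> T N" "T N - real r * H N \<le> T (N - int m * int r)"
proof -
  have "T (N - int m * int r) \<le> T N \<and> T N - real r * H N \<le> T (N - int m * int r)"
  proof (induction r)
    case (Suc r)
    have e: "N - int m * int (Suc r) = N - int m * int r - int m" by (simp add: algebra_simps)
    have "T (N - int m * int r) = H (N - int m * int r) + T (N - int m * int r - int m)"
      by (rule T_step)
    moreover have "H (N - int m * int r) \<le> H N" by (rule H_mono)
    moreover have "0 \<le> H (N - int m * int r)" by (rule H_nonneg)
    ultimately show ?case using Suc unfolding e of_nat_Suc by (simp add: algebra_simps)
  qed simp
  then show "T (N - int m * int r) \<le> T N" "T N - real r * H N \<le> T (N - int m * int r)" by blast+
qed

text \<open>A single value is negligible against the sum, since 2 K terms of the progression are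
  each at least half of it.\<close>

lemma T_large: "\<exists>n\<^sub>0. \<forall>i\<ge>n\<^sub>0. real K * H i \<le> T i"
proof -
  obtain n\<^sub>0 where n\<^sub>0: "\<And>i r. n\<^sub>0 \<le> i \<Longrightarrow> r \<le> 2 * K \<Longrightarrow> H i / 2 \<le> H (i - int m * int r)"
    using H_slow by blast
  have "real K * H i \<le> T i" if "max n\<^sub>0 (int (2 * K)) \<le> i" for i
  proof -
    have "real K * H i = (\<Sum>r<2 * K. H i / 2)" by simp
    also have "\<dots> \<le> (\<Sum>r<2 * K. H (i - int m * int r))"
      using that by (intro sum_mono n\<^sub>0) auto
    also have "\<dots> \<le> T i"
      unfolding progression_sum_def using that by (intro sum_mono2 H_nonneg) auto
    finally show ?thesis .
  qed
  then show ?thesis by blast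
qed

text \<open>By monotonicity a block of k consecutive terms lies between k times its first term and k
  times the term following it.\<close>

lemma T_coarse:
  assumes "1 \<le> k" "N < int L"
  shows "T N \<le> real k * (\<Sum>i<L. H (N - int m * int k * int i))"
    and "real k * ((\<Sum>i<L. H (N - int m * int k * int i)) - H N) \<le> T N"
proof -
  let ?Y = "\<lambda>L. \<Sum>i<L. H (N - int m * int k * int i)"
  have "N < int (L * k)" using assms
    by (smt (verit) mult_left_mono mult.right_neutral of_nat_0_le_iff of_nat_1 of_nat_le_iff of_nat_mult)
  then have T: "T N = (\<Sum>i<L. \<Sum>j\<in>{i * k..<i * k + k}. H (N - int m * int j))"
    unfolding sum.nat_group by (rule T_eq[symmetric])
  also have "\<dots> \<le> (\<Sum>i<L. \<Sum>j\<in>{i * k..<i * k + k}. H (N - int m * int k * int i))"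
  proof (intro sum_mono)
    fix i j assume "j \<in> {i * k..<i * k + k}"
    then have "N - int m * int j = N - int m * int k * int i - int m * int (j - i * k)"
      by (simp add: of_nat_diff algebra_simps)
    then show "H (N - int m * int j) \<le> H (N - int m * int k * int i)" using H_mono by metis
  qed
  also have "\<dots> = real k * ?Y L" by (simp add: sum_distrib_left)
  finally show "T N \<le> real k * ?Y L" .
  have "?Y (Suc L) = ?Y L + H (N - int (m * k) * int L)" by simp
  also have "H (N - int (m * k) * int L) = 0"
    using assms m by (intro H_vanish) (auto simp: Suc_le_eq simp flip: of_nat_mult)
  finally have "?Y L - H N = (\<Sum>i<L. H (N - int m * int k * int (Suc i)))"
    by (subst (asm) sum.lessThan_Suc_shift) simp
  then have "real k * (?Y L - H N) = (\<Sum>i<L. \<Sum>j\<in>{i * k..<i * k + k}. H (N - int m * int k * int (Suc i)))"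
    by (simp add: sum_distrib_left)
  also have "\<dots> \<le> (\<Sum>i<L. \<Sum>j\<in>{i * k..<i * k + k}. H (N - int m * int j))"
  proof (intro sum_mono)
    fix i j assume "j \<in> {i * k..<i * k + k}"
    then have "N - int m * int k * int (Suc i) = N - int m * int j - int m * int (i * k + k - j)"
      by (simp add: of_nat_diff algebra_simps)
    then show "H (N - int m * int k * int (Suc i)) \<le> H (N - int m * int j)" using H_mono by metis
  qed
  finally show "real k * (?Y L - H N) \<le> T N" unfolding T .
qed

text \<open>One summand for the residue class of each N - r a. If a and m have a common factor,
  classes simply repeat, so the greatest common divisor never has to be named.\<close>

definition class_sum :: "nat \<Rightarrow> int \<Rightarrow> real" where
  "class_sum a N = (\<Sum>r<m. T (N - int (r * a mod m)))"

definition class_term :: "nat \<Rightarrow> int \<Rightarrow> real" where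
  "class_term a N = (\<Sum>r<m. H (N - int (r * a mod m)))"

abbreviation (input) "U \<equiv> class_sum"
abbreviation (input) "B \<equiv> class_term"

lemma B_nonneg: "0 \<le> B a N"
  by (simp add: class_term_def sum_nonneg H_nonneg)

lemma U_nonneg: "0 \<le> U a N"
  by (simp add: class_sum_def sum_nonneg T_nonneg)

lemma H_le_B: "r < m \<Longrightarrow> H (N - int (r * a mod m)) \<le> B a N"
  unfolding class_term_def by (intro member_le_sum) (auto simp: H_nonneg)

text \<open>This is why the counts for a and for b can be measured against the same
  quantity.\<close>

lemma U_complement: "a + b = m \<Longrightarrow> U b N = U a N"
  unfolding class_sum_def by (rule sum_residue_complement[where g = "\<lambda>r. T (N - int r)"])

lemma B_complement: "a + b = m \<Longrightarrow> B b N = B a N"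
  unfolding class_term_def by (rule sum_residue_complement[where g = "\<lambda>r. H (N - int r)"])

lemma U_shift: "U a (N - int m * int s) \<le> U a N" "U a N - real s * B a N \<le> U a (N - int m * int s)"
proof -
  have e: "N - int m * int s - int c = N - int c - int m * int s" for c by simp
  show "U a (N - int m * int s) \<le> U a N"
    unfolding class_sum_def e by (intro sum_mono T_shift)
  have "U a N - real s * B a N = (\<Sum>r<m. T (N - int (r * a mod m)) - real s * H (N - int (r * a mod m)))"
    by (simp add: class_sum_def class_term_def sum_subtractf sum_distrib_left)
  also have "\<dots> \<le> U a (N - int m * int s)"
    unfolding class_sum_def e by (intro sum_mono T_shift)
  finally show "U a N - real s * B a N \<le> U a (N - int m * int s)" .
qed

lemma B_shift: "B a (N - int m * int s) \<le> B a N"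
proof -
  have e: "N - int m * int s - int c = N - int c - int m * int s" for c by simp
  show ?thesis unfolding class_term_def e by (intro sum_mono H_mono)
qed

lemma U_large: "\<exists>n\<^sub>0. \<forall>N\<ge>n\<^sub>0. real K * B a N \<le> U a N"
proof -
  obtain n\<^sub>0 where n\<^sub>0: "\<And>i. n\<^sub>0 \<le> i \<Longrightarrow> real K * H i \<le> T i" using T_large by blast
  have "real K * B a N \<le> U a N" if "n\<^sub>0 + int m \<le> N" for N
    unfolding class_term_def class_sum_def sum_distrib_left
  proof (intro sum_mono n\<^sub>0)
    fix r
    have "r * a mod m < m" using m by simp
    then show "n\<^sub>0 \<le> N - int (r * a mod m)" using that by linarith
  qed
  then show ?thesis by blast
qed

text \<open>Writing d = i m + r splits the sum into m progressions of step m k, each evaluated as T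
  / k by \<open>T_coarse\<close>. This costs one \<open>B\<close>, and the omitted term d = 0
  another.\<close>

lemma progression_average:
  assumes k: "1 \<le> k" "k mod m = a mod m" and L: "N < int L"
  shows "\<bar>(\<Sum>d\<in>{1..<L * m}. H (N - int k * int d)) - U a N / real k\<bar> \<le> 2 * B a N"
proof -
  define Y where "Y = (\<lambda>r. \<Sum>i<L. H (N - int (r * k) - int m * int k * int i))"
  have "0 < L * m \<Longrightarrow> (\<Sum>d<L * m. H (N - int k * int d)) = H N + (\<Sum>d\<in>{1..<L * m}. H (N - int k * int d))"
    by (simp add: lessThan_atLeast0 sum.atLeast_Suc_lessThan)
  moreover have "H N = 0 \<and> (\<Sum>d\<in>{1..<L * m}. H (N - int k * int d)) = 0" if "L = 0"
    using that L by (simp add: zext_def)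
  ultimately have Z: "(\<Sum>d\<in>{1..<L * m}. H (N - int k * int d)) = (\<Sum>d<L * m. H (N - int k * int d)) - H N"
    using m by (cases "L = 0") auto
  have "(\<Sum>d<L * m. H (N - int k * int d)) = (\<Sum>i<L. \<Sum>d\<in>{i * m..<i * m + m}. H (N - int k * int d))"
    by (rule sum.nat_group[symmetric])
  also have "\<dots> = (\<Sum>i<L. \<Sum>r<m. H (N - int (r * k) - int m * int k * int i))"
  proof (rule sum.cong)
    fix i
    show "(\<Sum>d\<in>{i * m..<i * m + m}. H (N - int k * int d)) = (\<Sum>r<m. H (N - int (r * k) - int m * int k * int i))"
      by (rule sum.reindex_bij_witness[where i = "\<lambda>r. i * m + r" and j = "\<lambda>d. d - i * m"])
        (auto simp: of_nat_diff algebra_simps)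
  qed simp
  also have "\<dots> = (\<Sum>r<m. Y r)" unfolding Y_def by (rule sum.swap)
  finally have sumY: "(\<Sum>d<L * m. H (N - int k * int d)) = (\<Sum>r<m. Y r)" .
  \<comment> \<open>The two starting points lie in one class, at most k steps of m apart, so
    exchanging them changes T / k by at most one value of \<open>H\<close>.\<close>
  have *: "\<exists>s\<le>k. N - int (r * k) = N - int (r * a mod m) - int m * int s" if "r < m" for r
  proof (intro exI conjI)
    have eq: "(r * k) mod m = r * a mod m" using k(2) by (metis mod_mult_right_eq)
    have "r * k = r * a mod m + m * ((r * k) div m)"
      using mod_mult_div_eq[of "r * k" m] unfolding eq by (rule sym)
    then have "int (r * k) = int (r * a mod m) + int m * int ((r * k) div m)"
      by (simp only: flip: of_nat_mult of_nat_add)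
    then show "N - int (r * k) = N - int (r * a mod m) - int m * int ((r * k) div m)" by simp
    have "r * k div m \<le> m * k div m" using that by (intro div_le_mono mult_le_mono1) simp
    then show "r * k div m \<le> k" using m by simp
  qed
  have N_less: "N - int (r * k) < int L" for r
    using L of_nat_0_le_iff[of "r * k"] by linarith
  have upper: "Y r \<le> T (N - int (r * a mod m)) / real k + H (N - int (r * a mod m))" if r: "r < m" for r
  proof -
    obtain s where s: "N - int (r * k) = N - int (r * a mod m) - int m * int s" using * r by blast
    have "real k * (Y r - H (N - int (r * k))) \<le> T (N - int (r * k))"
      unfolding Y_def by (rule T_coarse[OF k(1) N_less])
    also have "\<dots> \<le> T (N - int (r * a mod m))" unfolding s by (rule T_shift)
    finally have "Y r - H (N - int (r * k)) \<le> T (N - int (r * a mod m)) / real k"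
      using k(1) by (simp add: field_simps)
    moreover have "H (N - int (r * k)) \<le> H (N - int (r * a mod m))" unfolding s by (rule H_mono)
    ultimately show ?thesis by linarith
  qed
  have lower: "T (N - int (r * a mod m)) / real k - H (N - int (r * a mod m)) \<le> Y r" if r: "r < m" for r
  proof -
    obtain s where s: "s \<le> k" "N - int (r * k) = N - int (r * a mod m) - int m * int s" using * r by blast
    have "real s * H (N - int (r * a mod m)) \<le> real k * H (N - int (r * a mod m))"
      using s(1) by (intro mult_right_mono H_nonneg) simp
    then have "T (N - int (r * a mod m)) - real k * H (N - int (r * a mod m)) \<le> T (N - int (r * k))"
      unfolding s(2) using T_shift(2)[of "N - int (r * a mod m)" s] by linarith
    also have "\<dots> \<le> real k * Y r"
      unfolding Y_def by (rule T_coarse[OF k(1) N_less])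
    finally show ?thesis using k(1) by (simp add: field_simps)
  qed
  have "(\<Sum>r<m. Y r) \<le> U a N / real k + B a N"
    unfolding class_sum_def class_term_def sum_divide_distrib sum.distrib[symmetric]
    by (intro sum_mono upper) simp
  moreover have "U a N / real k - B a N \<le> (\<Sum>r<m. Y r)"
    unfolding class_sum_def class_term_def sum_divide_distrib sum_subtractf[symmetric]
    by (intro sum_mono lower) simp
  moreover have "H N \<le> B a N" using H_le_B[of 0 N a] m by simp
  ultimately show ?thesis
    using H_nonneg[of N] B_nonneg[of a N] unfolding Z sumY by linarith
qed

text \<open>The exponent is m s(j) + d (a + m j): for fixed j the sum over d has step a + m j and
  starts m s(j) lower, which costs s(j) times \<open>B\<close>. The shift is j (j + 1) / 2 for
  partitions and 0 for overpartitions.\<close>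

lemma alternating_count_asymptotic:
  fixes s L :: "nat \<Rightarrow> nat"
  assumes a: "0 < a" and s: "\<And>j. s j \<le> s (Suc j)" and L: "\<And>n. n \<le> L n"
    and lim: "(\<lambda>J. \<Sum>j<2 * J. (-1) ^ j / real (a + m * j)) \<longlonglongrightarrow> S"
    and F: "\<And>n. F n = (\<Sum>d=1..n. \<Sum>j<L n. (-1) ^ j * H (int n - int (a * d + m * (s j + j * d))))"
    and \<epsilon>: "0 < \<epsilon>"
  shows "\<exists>n\<^sub>0. \<forall>n\<ge>n\<^sub>0. \<bar>F n - S * U a (int n)\<bar> \<le> \<epsilon> * U a (int n)"
proof -
  define A where "A = (\<lambda>p. \<Sum>j<p. (-1) ^ j / real (a + m * j))"
  have "(\<lambda>J. 1 / real (a + m * (2 * J))) \<longlonglongrightarrow> 0"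
  proof (rule real_tendsto_sandwich[of "\<lambda>_. 0" _ _ "\<lambda>J. 1 / real J"])
    show "eventually (\<lambda>J. 1 / real (a + m * (2 * J)) \<le> 1 / real J) sequentially"
    proof (rule eventually_mono[OF eventually_gt_at_top[of 0]])
      fix J :: nat assume J: "0 < J"
      have "1 * J \<le> m * (2 * J)" using m by (intro mult_le_mono) auto
      then have le: "real J \<le> real (a + m * (2 * J))" unfolding of_nat_le_iff by linarith
      show "1 / real (a + m * (2 * J)) \<le> 1 / real J" by (rule frac_le[OF _ _ _ le]) (use J in simp_all)
    qed
  qed (simp_all add: lim_1_over_n)
  then have lim0: "(\<lambda>J. \<bar>A (2 * J) - S\<bar> + 1 / real (a + m * (2 * J))) \<longlonglongrightarrow> \<bar>S - S\<bar> + 0"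
    using lim unfolding A_def by (intro tendsto_intros)
  then have "eventually (\<lambda>J. \<bar>A (2 * J) - S\<bar> + 1 / real (a + m * (2 * J)) < \<epsilon> / 2) sequentially"
    using \<epsilon> by (intro order_tendstoD(2)[OF lim0]) simp
  \<comment> \<open>A fixed cutoff, depending on \<epsilon> only: the partial sums of length 2 J and
    2 J + 1 are both within \<epsilon>/2 of \<open>S\<close>.\<close>
  then obtain J where J: "\<bar>A (2 * J) - S\<bar> + 1 / real (a + m * (2 * J)) < \<epsilon> / 2"
    using eventually_happens' sequentially_bot by blast
  have A_odd: "A (2 * J + 1) = A (2 * J) + 1 / real (a + m * (2 * J))" by (simp add: A_def)
  define C where "C = (\<Sum>j<2 * J + 1. 2 + real (s j))"
  define Z where "Z = (\<lambda>n j. \<Sum>d=1..n. H (int n - int (a * d + m * (s j + j * d))))"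
  have Z_approx: "\<bar>Z n j - U a (int n) / real (a + m * j)\<bar> \<le> (2 + real (s j)) * B a (int n)" for n j
  proof -
    define N where "N = int n - int m * int (s j)"
    define k where "k = a + m * j"
    have k: "1 \<le> k" "k mod m = a mod m" using a by (simp_all add: k_def)
    have "Z n j = (\<Sum>d\<in>{1..<Suc n * m}. H (N - int k * int d))"
    proof -
      have "Z n j = (\<Sum>d=1..n. H (N - int k * int d))"
        unfolding Z_def by (intro sum.cong arg_cong[where f = H]) (simp_all add: N_def k_def algebra_simps)
      also have "\<dots> = (\<Sum>d\<in>{1..<Suc n * m}. H (N - int k * int d))"
      proof (rule sum.mono_neutral_left)
        have "Suc n * 1 \<le> Suc n * m" using m by (intro mult_le_mono2) simp
        then show "{1..n} \<subseteq> {1..<Suc n * m}" by auto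
        show "\<forall>d\<in>{1..<Suc n * m} - {1..n}. H (N - int k * int d) = 0"
        proof
          fix d assume "d \<in> {1..<Suc n * m} - {1..n}"
          then have "int n < int d" by auto
          moreover have "0 \<le> int m * int (s j)" by simp
          ultimately have "N < int d" unfolding N_def by linarith
          then show "H (N - int k * int d) = 0" using k by (intro H_vanish) auto
        qed
      qed simp
      finally show ?thesis .
    qed
    moreover have "0 \<le> int m * int (s j)" by simp
    then have "N < int (Suc n)" unfolding N_def by linarith
    ultimately have 1: "\<bar>Z n j - U a N / real k\<bar> \<le> 2 * B a N"
      by (simp only: progression_average[OF k])
    have B_le: "B a N \<le> B a (int n)" unfolding N_def by (rule B_shift)
    have "\<bar>U a N - U a (int n)\<bar> \<le> real (s j) * B a (int n)"
      using U_shift[of a "int n" "s j"] unfolding N_def by linarith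
    then have "\<bar>U a N / real k - U a (int n) / real k\<bar> \<le> real (s j) * B a (int n) / real k"
      using k(1) by (simp add: divide_right_mono flip: diff_divide_distrib)
    also have "\<dots> \<le> real (s j) * B a (int n) / 1"
      using k(1) B_nonneg by (intro divide_left_mono) auto
    finally have 2: "\<bar>U a N / real k - U a (int n) / real k\<bar> \<le> real (s j) * B a (int n)" by simp
    have "\<bar>Z n j - U a (int n) / real k\<bar> \<le>
        \<bar>Z n j - U a N / real k\<bar> + \<bar>U a N / real k - U a (int n) / real k\<bar>"
      using abs_triangle_ineq[of "Z n j - U a N / real k" "U a N / real k - U a (int n) / real k"] by simp
    also have "\<dots> \<le> 2 * B a N + real (s j) * B a (int n)" by (intro add_mono 1 2)
    also have "\<dots> \<le> (2 + real (s j)) * B a (int n)" using B_le by (simp add: distrib_right)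
    finally show ?thesis unfolding k_def .
  qed
  have partial: "\<bar>(\<Sum>j<p. (-1) ^ j * Z n j) - A p * U a (int n)\<bar> \<le> C * B a (int n)" if "p \<le> 2 * J + 1" for n p
  proof -
    have "(\<Sum>j<p. (-1) ^ j * Z n j) - A p * U a (int n) =
        (\<Sum>j<p. (-1) ^ j * (Z n j - U a (int n) / real (a + m * j)))"
      by (simp add: A_def sum_distrib_right sum_subtractf right_diff_distrib)
    also have "\<bar>\<dots>\<bar> \<le> (\<Sum>j<p. \<bar>(-1) ^ j * (Z n j - U a (int n) / real (a + m * j))\<bar>)" by (rule sum_abs)
    also have "\<dots> \<le> (\<Sum>j<p. (2 + real (s j)) * B a (int n))"
      using Z_approx by (intro sum_mono) (simp add: abs_mult power_abs)
    also have "\<dots> = (\<Sum>j<p. 2 + real (s j)) * B a (int n)" by (simp add: sum_distrib_right)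
    also have "\<dots> \<le> C * B a (int n)"
      unfolding C_def using that B_nonneg by (intro mult_right_mono sum_mono2) auto
    finally show ?thesis .
  qed
  obtain K :: nat where K: "2 * C / \<epsilon> \<le> real K" using real_arch_simple by blast
  obtain n\<^sub>0 where n\<^sub>0: "\<And>N. n\<^sub>0 \<le> N \<Longrightarrow> real K * B a N \<le> U a N" using U_large by blast
  have "\<bar>F n - S * U a (int n)\<bar> \<le> \<epsilon> * U a (int n)" if n: "nat n\<^sub>0 + 2 * J + 1 \<le> n" for n
  proof -
    have C: "C * B a (int n) \<le> \<epsilon> / 2 * U a (int n)"
    proof -
      have "C \<le> \<epsilon> / 2 * real K" using K \<epsilon> by (simp add: field_simps)
      then have "C * B a (int n) \<le> \<epsilon> / 2 * real K * B a (int n)" by (intro mult_right_mono B_nonneg)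
      also have "\<dots> = \<epsilon> / 2 * (real K * B a (int n))" by simp
      also have "\<dots> \<le> \<epsilon> / 2 * U a (int n)" using \<epsilon> n by (intro mult_left_mono n\<^sub>0) auto
      finally show ?thesis .
    qed
    define t where "t = (\<lambda>d j. H (int n - int (a * d + m * (s j + j * d))))"
    have t: "0 \<le> t d j" "t d (Suc j) \<le> t d j" for d j
    proof -
      have "int n - int (a * d + m * (s (Suc j) + Suc j * d)) =
          int n - int (a * d + m * (s j + j * d)) - int m * int (s (Suc j) - s j + d)"
        using s[of j] by (simp add: of_nat_diff algebra_simps)
      then show "t d (Suc j) \<le> t d j" unfolding t_def using H_mono by metis
    qed (simp add: t_def H_nonneg)
    have swap: "(\<Sum>j<p. (-1) ^ j * Z n j) = (\<Sum>d=1..n. \<Sum>j<p. (-1) ^ j * t d j)" for p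
      unfolding Z_def t_def sum_distrib_left by (rule sum.swap)
    have F_t: "F n = (\<Sum>d=1..n. \<Sum>j<L n. (-1) ^ j * t d j)" by (simp only: F t_def)
    have len: "2 * J + 1 \<le> L n" using n L[of n] by simp
    have "(\<Sum>j<2 * J. (-1) ^ j * Z n j) \<le> F n"
      unfolding swap F_t by (intro sum_mono alternating_sum_bracket t len)
    moreover have "F n \<le> (\<Sum>j<2 * J + 1. (-1) ^ j * Z n j)"
      unfolding swap F_t by (intro sum_mono alternating_sum_bracket t len)
    moreover have "\<bar>(\<Sum>j<2 * J. (-1) ^ j * Z n j) - A (2 * J) * U a (int n)\<bar> \<le> C * B a (int n)"
      "\<bar>(\<Sum>j<2 * J + 1. (-1) ^ j * Z n j) - A (2 * J + 1) * U a (int n)\<bar> \<le> C * B a (int n)"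
      by (intro partial; simp)+
    moreover have "(S - \<epsilon> / 2) * U a (int n) \<le> A (2 * J) * U a (int n)"
      "A (2 * J + 1) * U a (int n) \<le> (S + \<epsilon> / 2) * U a (int n)"
    proof -
      have pos: "0 \<le> 1 / real (a + m * (2 * J))" by simp
      show "(S - \<epsilon> / 2) * U a (int n) \<le> A (2 * J) * U a (int n)"
        using J pos by (intro mult_right_mono U_nonneg) linarith
      show "A (2 * J + 1) * U a (int n) \<le> (S + \<epsilon> / 2) * U a (int n)"
        unfolding A_odd using J pos by (intro mult_right_mono U_nonneg) linarith
    qed
    moreover have "\<epsilon> / 2 * U a (int n) + \<epsilon> / 2 * U a (int n) = \<epsilon> * U a (int n)" by simp
    ultimately show ?thesis using C unfolding left_diff_distrib distrib_right abs_le_iff by linarith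
  qed
  then show ?thesis by blast
qed

text \<open>All three parts of \<open>P\<close> are measured by \<open>U\<close>, which cancels in
  the ratio. The zero excess part is at most \<open>h\<close>, hence at most \<open>B\<close>, which
  is negligible.\<close>

lemma alternating_counts_ratio:
  fixes s L :: "nat \<Rightarrow> nat" and F G P Z :: "nat \<Rightarrow> real"
  assumes ab: "a + b = m" "0 < a" "0 < b"
    and s: "\<And>j. s j \<le> s (Suc j)" and L: "\<And>n. n \<le> L n"
    and lim: "(\<lambda>J. \<Sum>j<2 * J. (-1) ^ j / real (a + m * j)) \<longlonglongrightarrow> S"
      "(\<lambda>J. \<Sum>j<2 * J. (-1) ^ j / real (b + m * j)) \<longlonglongrightarrow> S'"
    and F: "\<And>n. F n = (\<Sum>d=1..n. \<Sum>j<L n. (-1) ^ j * H (int n - int (a * d + m * (s j + j * d))))"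
    and G: "\<And>n. G n = (\<Sum>d=1..n. \<Sum>j<L n. (-1) ^ j * H (int n - int (b * d + m * (s j + j * d))))"
    and Z: "\<And>n. 0 \<le> Z n" "\<And>n. Z n \<le> h n"
    and P: "\<And>n. P n = F n + G n + Z n" "\<And>n. 0 < P n"
    and SS: "0 < S + S'"
  shows "(\<lambda>n. F n / P n) \<longlonglongrightarrow> S / (S + S')"
proof -
  define u where "u = (\<lambda>n :: nat. U a (int n))"
  have approx: "(\<lambda>n. X n / u n) \<longlonglongrightarrow> c" if X: "\<And>\<epsilon>. 0 < \<epsilon> \<Longrightarrow> \<exists>n\<^sub>0. \<forall>n\<ge>n\<^sub>0. \<bar>X n - c * u n\<bar> \<le> \<epsilon> * u n"
    and u: "eventually (\<lambda>n. 0 < u n) sequentially" for X c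
  proof (rule tendstoI)
    fix \<epsilon> :: real assume "0 < \<epsilon>"
    then obtain n\<^sub>0 where n\<^sub>0: "\<And>n. n\<^sub>0 \<le> n \<Longrightarrow> \<bar>X n - c * u n\<bar> \<le> \<epsilon> / 2 * u n"
      using X[of "\<epsilon> / 2"] by auto
    show "eventually (\<lambda>n. dist (X n / u n) c < \<epsilon>) sequentially"
      using u eventually_ge_at_top[of n\<^sub>0]
    proof eventually_elim
      case (elim n)
      have e: "X n / u n - c = (X n - c * u n) / u n" using elim(1) by (simp add: field_simps)
      have "\<bar>X n / u n - c\<bar> = \<bar>X n - c * u n\<bar> / u n"
        unfolding e abs_divide using elim(1) by (simp only: abs_of_pos)
      also have "\<dots> \<le> \<epsilon> / 2" using elim(1) n\<^sub>0[OF elim(2)] by (simp add: divide_le_eq)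
      also have "\<dots> < \<epsilon>" using \<open>0 < \<epsilon>\<close> by simp
      finally show ?case by (simp add: dist_real_def)
    qed
  qed
  have FU: "\<exists>n\<^sub>0. \<forall>n\<ge>n\<^sub>0. \<bar>F n - S * u n\<bar> \<le> \<epsilon> * u n" if "0 < \<epsilon>" for \<epsilon>
    unfolding u_def by (rule alternating_count_asymptotic[OF ab(2) s L lim(1) F that])
  have GU: "\<exists>n\<^sub>0. \<forall>n\<ge>n\<^sub>0. \<bar>G n - S' * u n\<bar> \<le> \<epsilon> * u n" if "0 < \<epsilon>" for \<epsilon>
    unfolding u_def U_complement[OF ab(1), symmetric]
    by (rule alternating_count_asymptotic[OF ab(3) s L lim(2) G that])
  have ZU: "\<exists>n\<^sub>0. \<forall>n\<ge>n\<^sub>0. \<bar>Z n - 0 * u n\<bar> \<le> \<epsilon> * u n" if \<epsilon>: "0 < \<epsilon>" for \<epsilon>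
  proof -
    obtain K :: nat where K: "1 / \<epsilon> \<le> real K" using real_arch_simple by blast
    obtain n\<^sub>0 where n\<^sub>0: "\<And>N. n\<^sub>0 \<le> N \<Longrightarrow> real K * B a N \<le> U a N" using U_large by blast
    have "\<bar>Z n - 0 * u n\<bar> \<le> \<epsilon> * u n" if "nat n\<^sub>0 \<le> n" for n
    proof -
      have "Z n \<le> H (int n - int (0 * a mod m))" using Z(2)[of n] by (simp add: zext_def)
      also have "\<dots> \<le> B a (int n)" by (rule H_le_B[OF m])
      also have "\<dots> \<le> (\<epsilon> * real K) * B a (int n)"
        using K \<epsilon> mult_right_mono[of 1 "\<epsilon> * real K" "B a (int n)"] B_nonneg by (simp add: field_simps)
      also have "\<dots> = \<epsilon> * (real K * B a (int n))" by simp
      also have "\<dots> \<le> \<epsilon> * u n" unfolding u_def using that \<epsilon> by (intro mult_left_mono n\<^sub>0) auto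
      finally show ?thesis using Z(1)[of n] by simp
    qed
    then show ?thesis by blast
  qed
  \<comment> \<open>Where \<open>u\<close> vanished for large n, the three estimates would force F =
    G = Z = 0, against P > 0.\<close>
  have pos: "eventually (\<lambda>n. 0 < u n) sequentially"
  proof -
    obtain n1 n2 n3 where n: "\<And>n. n1 \<le> n \<Longrightarrow> \<bar>F n - S * u n\<bar> \<le> 1 * u n"
      "\<And>n. n2 \<le> n \<Longrightarrow> \<bar>G n - S' * u n\<bar> \<le> 1 * u n" "\<And>n. n3 \<le> n \<Longrightarrow> \<bar>Z n - 0 * u n\<bar> \<le> 1 * u n"
      using FU[OF zero_less_one] GU[OF zero_less_one] ZU[OF zero_less_one] by metis
    have "0 < u n" if "n1 + n2 + n3 \<le> n" for n
    proof (rule ccontr)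
      assume "\<not> 0 < u n"
      then have "u n = 0" using U_nonneg[of a "int n"] by (simp add: u_def)
      then have "F n = 0" "G n = 0" "Z n = 0" using n(1)[of n] n(2)[of n] n(3)[of n] that by auto
      then show False using P[of n] by simp
    qed
    then show ?thesis unfolding eventually_sequentially by blast
  qed
  have lim': "(\<lambda>n. (F n / u n) / (F n / u n + G n / u n + Z n / u n)) \<longlonglongrightarrow> S / (S + S' + 0)"
    using SS by (intro tendsto_intros approx FU GU ZU pos) auto
  have "eventually (\<lambda>n. (F n / u n) / (F n / u n + G n / u n + Z n / u n) = F n / P n) sequentially"
    using pos
  proof eventually_elim
    case (elim n)
    then show ?case unfolding P(1) by (simp flip: add_divide_distrib)
  qed
  from Lim_transform_eventually[OF lim' this] show ?thesis by simp
qed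

end

section \<open>Triangular exponents, for distinct parts\<close>

definition pred_triangle :: "nat \<Rightarrow> nat" where
  "pred_triangle d = d * (d - 1) div 2"

lemma pred_triangle_Suc: "pred_triangle (Suc d) = pred_triangle d + d"
proof -
  have "Suc d * (Suc d - 1) = d * (d - 1) + d * 2" by (cases d) (auto simp: algebra_simps)
  then show ?thesis unfolding pred_triangle_def by (metis div_mult_self1 add.commute zero_neq_numeral)
qed

lemma pred_triangle_mono: "d \<le> e \<Longrightarrow> pred_triangle d \<le> pred_triangle e"
  by (induction e rule: dec_induct) (simp_all add: pred_triangle_Suc)

lemma pred_triangle_le: "pred_triangle d \<le> d * d"
  by (induction d) (simp_all add: pred_triangle_Suc, simp add: pred_triangle_def)

context slow_sequence
begin

text \<open>The term for a at d and the term for b at a reflected index lie in the same residue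
  class modulo m, so monotonicity orders them. After a shift by one block this works in both
  directions, and the two sums differ by at most the first block, which is at most
  \<open>B\<close>.\<close>

lemma triangular_counts_ratio:
  fixes F G P :: "nat \<Rightarrow> real"
  assumes ab: "a + b = m" "0 < a" "a \<le> b"
    and F: "\<And>n. F n = (\<Sum>d=1..n. H (int n - int (a * d + m * pred_triangle d)))"
    and G: "\<And>n. G n = (\<Sum>d=1..n. H (int n - int (b * d + m * pred_triangle d)))"
    and P: "\<And>n. P n = F n + G n + h n" "\<And>n. 0 < P n"
  shows "(\<lambda>n. F n / P n) \<longlonglongrightarrow> 1 / 2"
proof -
  define \<phi> where "\<phi> = (\<lambda>c n d. H (int n - int (c * d + m * pred_triangle d)))"
  \<comment> \<open>The term d = 0, equal to h n, is included and the range rounded up to whole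
    blocks of length m, so that \<sigma> permutes it; the further terms vanish.\<close>
  define F\<^sub>0 where "F\<^sub>0 = (\<lambda>c n. \<Sum>d<Suc n * m. \<phi> c n d)"
  \<comment> \<open>Negates d modulo m inside its block. For c + c' = m the products c' \<sigma>(d)
    and c d are then congruent.\<close>
  define \<sigma> where "\<sigma> = (\<lambda>d. (d div m) * m + (m - d mod m) mod m)"
  have \<phi>_nonneg: "0 \<le> \<phi> c n d" for c n d by (simp add: \<phi>_def H_nonneg)
  have \<phi>_0: "\<phi> c n 0 = h n" for c n by (simp add: \<phi>_def pred_triangle_def zext_def)
  have vanish: "\<phi> c n d = 0" if "0 < c" "n < d" for c n d
  proof -
    have "1 * d \<le> c * d" using that by (intro mult_le_mono1) simp
    then have "n < c * d + m * pred_triangle d" using that by linarith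
    then have "int n - int (c * d + m * pred_triangle d) < 0" by linarith
    then show ?thesis by (simp only: \<phi>_def zext_def if_True)
  qed
  have long: "Suc n \<le> Suc n * m" for n using m mult_le_mono2[of 1 m "Suc n"] by simp
  have F\<^sub>0_eq: "F\<^sub>0 c n = h n + (\<Sum>d=1..n. \<phi> c n d)" if c: "0 < c" for c n
  proof -
    have "F\<^sub>0 c n = (\<Sum>d<Suc n. \<phi> c n d)"
      unfolding F\<^sub>0_def using long[of n] vanish[OF c] by (intro sum.mono_neutral_right) auto
    also have "{..<Suc n} = insert 0 {1..n}" by auto
    finally show ?thesis by (simp add: \<phi>_0)
  qed
  have \<sigma>_less: "\<sigma> d < d div m * m + m" "d div m * m \<le> \<sigma> d" for d
    using m by (simp_all add: \<sigma>_def)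
  have \<sigma>_div: "\<sigma> d div m = d div m" for d
    using \<sigma>_less[of d] m by (intro div_nat_eqI) (simp_all add: mult.commute)
  have \<sigma>_\<sigma>: "\<sigma> (\<sigma> d) = d" for d
  proof -
    have "\<sigma> d mod m = (m - d mod m) mod m" by (simp add: \<sigma>_def)
    then have "(m - \<sigma> d mod m) mod m = d mod m" using m by (cases "d mod m = 0") simp_all
    moreover have "\<sigma> (\<sigma> d) = \<sigma> d div m * m + (m - \<sigma> d mod m) mod m" by (simp add: \<sigma>_def)
    ultimately show ?thesis unfolding \<sigma>_div by simp
  qed
  have \<sigma>_bound: "\<sigma> d < Suc n * m" if "d < Suc n * m" for d n
    using that m \<sigma>_div[of d] by (metis div_less_iff_less_mult)
  have \<sigma>_gt: "d < \<sigma> d + m" for d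
  proof -
    have "d < d div m * m + m" using m mod_less_divisor[of m d] div_mult_mod_eq[of d m] by linarith
    then show ?thesis using \<sigma>_less(2)[of d] by linarith
  qed
  have \<sigma>_sum: "\<exists>t. \<sigma> d + m + d = m * t" for d
  proof -
    have "(m - d mod m) mod m + d mod m = (if d mod m = 0 then 0 else m)" using m by auto
    moreover have "\<sigma> d + m + d = d div m * m + m + d div m * m + ((m - d mod m) mod m + d mod m)"
      unfolding \<sigma>_def using div_mult_mod_eq[of d m] by linarith
    ultimately have eq: "\<sigma> d + m + d = d div m * m + m + d div m * m + (if d mod m = 0 then 0 else m)"
      by (simp only:)
    have "m dvd \<sigma> d + m + d" unfolding eq by (intro dvd_add) simp_all
    then show ?thesis by (auto elim: dvdE)
  qed
  have compare: "\<phi> c' n (\<sigma> d + m) \<le> \<phi> c n d" if "c + c' = m" "c * d + m * pred_triangle d \<le> c' * (\<sigma> d + m) + m * pred_triangle (\<sigma> d + m)" for c c' n d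
    unfolding \<phi>_def
  proof (rule H_mono')
    show "int n - int (c' * (\<sigma> d + m) + m * pred_triangle (\<sigma> d + m)) \<le> int n - int (c * d + m * pred_triangle d)"
      using that(2) by linarith
    obtain t where t: "\<sigma> d + m + d = m * t" using \<sigma>_sum by blast
    have e: "int (\<sigma> d + m) = int m * int t - int d" using t by (metis add_diff_cancel_right' of_nat_add of_nat_mult)
    have c': "int c' = int m - int c" using that(1) by linarith
    have "int n - int (c * d + m * pred_triangle d) - (int n - int (c' * (\<sigma> d + m) + m * pred_triangle (\<sigma> d + m))) =
        int c' * int (\<sigma> d + m) - int c * int d + int m * (int (pred_triangle (\<sigma> d + m)) - int (pred_triangle d))"
      by (simp only: of_nat_add of_nat_mult algebra_simps)
    also have "\<dots> = int m * (int m * int t - int d - int c * int t + (int (pred_triangle (\<sigma> d + m)) - int (pred_triangle d)))"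
      unfolding e c' by (simp add: algebra_simps)
    finally show "int m dvd int n - int (c * d + m * pred_triangle d) - (int n - int (c' * (\<sigma> d + m) + m * pred_triangle (\<sigma> d + m)))"
      by simp
  qed
  have shifted: "(\<Sum>d<Suc n * m. \<phi> c n (\<sigma> d + m)) = F\<^sub>0 c n - (\<Sum>d<m. \<phi> c n d)" if c: "0 < c" for c n
  proof -
    have "(\<Sum>d<Suc n * m. \<phi> c n (\<sigma> d + m)) = (\<Sum>e<Suc n * m. \<phi> c n (m + e))"
      by (rule sum.reindex_bij_witness[where i = \<sigma> and j = \<sigma>]) (simp_all add: \<sigma>_\<sigma> \<sigma>_bound add.commute del: mult_Suc)
    moreover have "(\<Sum>e<m + l. \<phi> c n e) = (\<Sum>e<m. \<phi> c n e) + (\<Sum>e<l. \<phi> c n (m + e))" for l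
      by (induction l) simp_all
    moreover have "(\<Sum>e<m + Suc n * m. \<phi> c n e) = F\<^sub>0 c n"
      unfolding F\<^sub>0_def using long[of n] by (intro sum.mono_neutral_right) (auto intro!: vanish[OF c])
    ultimately show ?thesis by (metis add_diff_cancel_left')
  qed
  have reduce: "\<exists>s. c * d + m * pred_triangle d = d mod m * c mod m + m * s" for c d
  proof -
    have "c * d mod m = d mod m * c mod m" by (metis mod_mult_left_eq mult.commute)
    then have "c * d = d mod m * c mod m + m * (c * d div m)" using mod_mult_div_eq[of "c * d" m] by linarith
    then have "c * d + m * pred_triangle d = d mod m * c mod m + m * (c * d div m + pred_triangle d)"
      by (simp only: distrib_left add.assoc)
    then show ?thesis by blast
  qed
  have start: "(\<Sum>d<m. \<phi> c n d) \<le> B c (int n)" for c n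
    unfolding class_term_def
  proof (rule sum_mono)
    fix d assume "d \<in> {..<m}"
    obtain s where s: "c * d + m * pred_triangle d = d mod m * c mod m + m * s" using reduce by blast
    then have "int n - int (c * d + m * pred_triangle d) = int n - int (d mod m * c mod m) - int m * int s"
      by simp
    then have "\<phi> c n d \<le> H (int n - int (d mod m * c mod m))" unfolding \<phi>_def using H_mono by metis
    then show "\<phi> c n d \<le> H (int n - int (d * c mod m))" using \<open>d \<in> {..<m}\<close> by simp
  qed
  have diff: "\<bar>F\<^sub>0 a n - F\<^sub>0 b n\<bar> \<le> B a (int n)" for n
  proof -
    have b: "0 < b" using ab by simp
    have "(\<Sum>d<Suc n * m. \<phi> b n (\<sigma> d + m)) \<le> F\<^sub>0 a n"
      unfolding F\<^sub>0_def
    proof (intro sum_mono compare ab(1))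
      fix d
      show "a * d + m * pred_triangle d \<le> b * (\<sigma> d + m) + m * pred_triangle (\<sigma> d + m)"
        using ab(3) \<sigma>_gt[of d] by (intro add_mono mult_le_mono pred_triangle_mono) simp_all
    qed
    then have 1: "F\<^sub>0 b n - B a (int n) \<le> F\<^sub>0 a n"
      using shifted[OF b, of n] start[of b n] B_complement[OF ab(1), of "int n"] by linarith
    have "(\<Sum>d<Suc n * m. \<phi> a n (\<sigma> d + m)) \<le> F\<^sub>0 b n"
      unfolding F\<^sub>0_def
    proof (intro sum_mono compare)
      fix d
      have "b * d \<le> m * d" using ab by (intro mult_le_mono1) simp
      then have "b * d + m * pred_triangle d \<le> m * pred_triangle (Suc d)" by (simp add: pred_triangle_Suc distrib_left)
      also have "\<dots> \<le> m * pred_triangle (\<sigma> d + m)"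
        using \<sigma>_gt[of d] by (intro mult_le_mono2 pred_triangle_mono) simp
      finally show "b * d + m * pred_triangle d \<le> a * (\<sigma> d + m) + m * pred_triangle (\<sigma> d + m)" by linarith
      show "b + a = m" using ab(1) by simp
    qed
    then have "F\<^sub>0 a n - B a (int n) \<le> F\<^sub>0 b n"
      using shifted[OF ab(2), of n] start[of a n] by linarith
    with 1 show ?thesis by linarith
  qed
  have h_le_B: "h n \<le> B a (int n)" for n
    using H_le_B[of 0 "int n" a] m by (simp add: zext_def)
  have large: "\<exists>n\<^sub>0. \<forall>n\<ge>n\<^sub>0. real K * B a (int n) \<le> F\<^sub>0 a n" for K
  proof -
    \<comment> \<open>Bounds the exponent for all d in the first 2 K blocks, so that a single use of
      \<open>H_slow\<close> covers them.\<close>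
    define R where "R = a * (2 * K * m) + m * (2 * K * m * (2 * K * m))"
    obtain n\<^sub>0 where n\<^sub>0: "\<And>i r. n\<^sub>0 \<le> i \<Longrightarrow> r \<le> R \<Longrightarrow> H i / 2 \<le> H (i - int m * int r)"
      using H_slow by blast
    have "real K * B a (int n) \<le> F\<^sub>0 a n" if n: "nat n\<^sub>0 + m + 2 * K \<le> n" for n
    proof -
      have low: "H (int n - int (r * a mod m)) / 2 \<le> \<phi> a n (i * m + r)" if "i < 2 * K" "r < m" for i r
      proof -
        define d where "d = i * m + r"
        have d: "d mod m = r" using that by (simp add: d_def)
        have "d < Suc i * m" using that by (simp add: d_def)
        also have "\<dots> \<le> 2 * K * m" using that by (intro mult_le_mono1) simp
        finally have d_less: "d \<le> 2 * K * m" by simp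
        obtain s where s: "a * d + m * pred_triangle d = r * a mod m + m * s" using reduce[of a d] d by auto
        have "1 * s \<le> m * s" using m by (intro mult_le_mono1) simp
        then have "s \<le> a * d + m * pred_triangle d" using s by linarith
        also have "\<dots> \<le> R"
          unfolding R_def using d_less by (intro add_mono mult_le_mono2 order_trans[OF pred_triangle_le] mult_le_mono)
        finally have "s \<le> R" .
        moreover have "n\<^sub>0 \<le> int n - int (r * a mod m)"
        proof -
          have "r * a mod m < m" using m by simp
          then show ?thesis using n by linarith
        qed
        ultimately have "H (int n - int (r * a mod m)) / 2 \<le> H (int n - int (r * a mod m) - int m * int s)"
          by (intro n\<^sub>0)
        also have "int n - int (r * a mod m) - int m * int s = int n - int (a * d + m * pred_triangle d)"
          unfolding s by simp
        finally show ?thesis by (simp only: \<phi>_def d_def)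
      qed
      have "real K * B a (int n) = (\<Sum>i<2 * K. \<Sum>r<m. H (int n - int (r * a mod m)) / 2)"
        by (simp add: class_term_def sum_divide_distrib[symmetric])
      also have "\<dots> \<le> (\<Sum>i<2 * K. \<Sum>r<m. \<phi> a n (i * m + r))"
        by (intro sum_mono low) simp_all
      also have "\<dots> = (\<Sum>i<2 * K. \<Sum>d\<in>{i * m..<i * m + m}. \<phi> a n d)"
      proof (rule sum.cong)
        fix i
        show "(\<Sum>r<m. \<phi> a n (i * m + r)) = (\<Sum>d\<in>{i * m..<i * m + m}. \<phi> a n d)"
          by (rule sum.reindex_bij_witness[where j = "\<lambda>r. i * m + r" and i = "\<lambda>d. d - i * m"]) auto
      qed simp
      also have "\<dots> = (\<Sum>d<2 * K * m. \<phi> a n d)" by (rule sum.nat_group)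
      also have "\<dots> \<le> F\<^sub>0 a n"
      proof -
        have "2 * K * m \<le> Suc n * m" using n by (intro mult_le_mono1) simp
        then show ?thesis unfolding F\<^sub>0_def by (intro sum_mono2 \<phi>_nonneg) auto
      qed
      finally show ?thesis .
    qed
    then show ?thesis by blast
  qed
  have F\<^sub>0: "F\<^sub>0 a n = h n + F n" "F\<^sub>0 b n = h n + G n" for n
    using F\<^sub>0_eq[OF ab(2)] F\<^sub>0_eq[of b] ab unfolding F G \<phi>_def by simp_all
  have G_nonneg: "0 \<le> G n" for n unfolding G by (intro sum_nonneg H_nonneg)
  show ?thesis
  proof (rule tendstoI)
    fix \<epsilon> :: real assume \<epsilon>: "0 < \<epsilon>"
    obtain K :: nat where K: "1 / \<epsilon> < real K" using reals_Archimedean2 by blast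
    have K_pos: "0 < real K" using K \<epsilon> by (meson less_trans zero_less_divide_1_iff)
    obtain n\<^sub>0 where n\<^sub>0: "\<And>n. n\<^sub>0 \<le> n \<Longrightarrow> real K * B a (int n) \<le> F\<^sub>0 a n" using large by blast
    have "dist (F n / P n) (1 / 2) < \<epsilon>" if "n\<^sub>0 \<le> n" for n
    proof -
      have KB: "real K * B a (int n) \<le> P n" using n\<^sub>0[OF that] F\<^sub>0 G_nonneg[of n] P(1)[of n] by simp
      \<comment> \<open>Half of this difference is F - P / 2.\<close>
      have "\<bar>F n - G n - h n\<bar> \<le> 2 * B a (int n)"
        using diff[of n] F\<^sub>0[of n] h_le_B[of n] h_nonneg[of n] by linarith
      then have "\<bar>F n / P n - 1 / 2\<bar> \<le> B a (int n) / P n"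
      proof -
        have "F n / P n - 1 / 2 = (F n - G n - h n) / (2 * P n)"
          using P(2)[of n] unfolding P(1) by (simp add: field_simps)
        then have "\<bar>F n / P n - 1 / 2\<bar> = \<bar>F n - G n - h n\<bar> / (2 * P n)"
          using P(2)[of n] by (simp only: abs_divide)
        also have "\<dots> \<le> 2 * B a (int n) / (2 * P n)"
          using \<open>\<bar>F n - G n - h n\<bar> \<le> 2 * B a (int n)\<close> P(2)[of n] by (intro divide_right_mono) auto
        finally show ?thesis by simp
      qed
      also have "\<dots> \<le> 1 / real K" using KB P(2)[of n] K_pos by (simp add: field_simps)
      also have "\<dots> < \<epsilon>" using K \<epsilon> K_pos by (simp add: field_simps)
      finally show ?thesis by (simp add: dist_real_def)
    qed
    then show "eventually (\<lambda>n. dist (F n / P n) (1 / 2) < \<epsilon>) sequentially"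
      unfolding eventually_sequentially by blast
  qed
qed

end

section \<open>The main theorem\<close>

text \<open>The exponents of \<open>1 + q\<^sup>k\<close> and \<open>1 / (1 - q\<^sup>k)\<close> in \<open>H\<close>: parts congruent to \<open>\<plusminus>a\<close> are removed, and the
  multiples of \<open>m\<close> collect the infinite products from the theta function identities.\<close>

definition balanced_alpha :: "nat \<Rightarrow> nat \<Rightarrow> nat \<Rightarrow> real \<Rightarrow> real \<Rightarrow> nat \<Rightarrow> nat" where
  "balanced_alpha a b m x y k = (if [k = a] (mod m) \<or> [k = b] (mod m) \<or> y = 0 then 0
     else if x = 1 \<and> m dvd k then 3 else 1)"

definition balanced_beta :: "nat \<Rightarrow> nat \<Rightarrow> nat \<Rightarrow> real \<Rightarrow> real \<Rightarrow> nat \<Rightarrow> nat" where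
  "balanced_beta a b m x y k = (if [k = a] (mod m) \<or> [k = b] (mod m) then 0
     else if x = 1 then if m dvd k then 3 else 1 else if m dvd k then 1 else 0)"

definition balanced_factor :: "nat \<Rightarrow> nat \<Rightarrow> nat \<Rightarrow> real \<Rightarrow> real \<Rightarrow> nat \<Rightarrow> real fps" where
  "balanced_factor a b m x y = euler_factor (balanced_alpha a b m x y) (balanced_beta a b m x y)"

text \<open>The coefficient of the infinite product: factors beyond n do not affect coefficient
  n.\<close>

definition balanced_coeff :: "nat \<Rightarrow> nat \<Rightarrow> nat \<Rightarrow> real \<Rightarrow> real \<Rightarrow> nat \<Rightarrow> real" where
  "balanced_coeff a b m x y n = (\<Prod>k=1..n. balanced_factor a b m x y k) $ n"

lemma balanced_coeff_commute: "balanced_coeff b a m x y = balanced_coeff a b m x y"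
proof -
  have "balanced_alpha b a m x y = balanced_alpha a b m x y" "balanced_beta b a m x y = balanced_beta a b m x y"
    by (auto simp: balanced_alpha_def balanced_beta_def)
  then show ?thesis by (intro ext) (simp only: balanced_coeff_def balanced_factor_def)
qed

lemma euler_factor_eq_1:
  assumes "0 < k"
  shows "fps_eq_upto k (euler_factor \<alpha> \<beta> k) 1"
proof -
  have pow: "fps_eq_upto k (f ^ c) 1" if "fps_eq_upto k f 1" for f :: "real fps" and c
    by (induction c) (use that fps_eq_upto_mult[of k f 1] in force)+
  have "fps_eq_upto k (1 + fps_X ^ k) (1 :: real fps)"
    by (simp add: fps_eq_upto_def)
  moreover have "fps_eq_upto k (inverse (1 - fps_X ^ k)) (1 :: real fps)"
    using assms by (auto simp: fps_eq_upto_def inverse_one_minus_X_power_nth dest: dvd_imp_le)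
  ultimately have "fps_eq_upto k (euler_factor \<alpha> \<beta> k) (1 * 1)"
    unfolding euler_factor_def by (intro fps_eq_upto_mult pow)
  then show ?thesis by simp
qed

lemma euler_product_nth:
  assumes "n \<le> N"
  shows "(\<Prod>k=1..N. balanced_factor a b m x y k) $ n = balanced_coeff a b m x y n"
  using assms
proof (induction N rule: dec_induct)
  case (step N)
  have "fps_eq_upto (Suc N) ((\<Prod>k=1..N. balanced_factor a b m x y k) * balanced_factor a b m x y (Suc N))
      ((\<Prod>k=1..N. balanced_factor a b m x y k) * 1)"
    unfolding balanced_factor_def by (intro fps_eq_upto_mult fps_eq_upto_refl euler_factor_eq_1) simp
  then have "((\<Prod>k=1..N. balanced_factor a b m x y k) * balanced_factor a b m x y (Suc N)) $ n =
      (\<Prod>k=1..N. balanced_factor a b m x y k) $ n"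
    using step.hyps by (simp add: fps_eq_upto_def)
  moreover have "(\<Prod>k=1..Suc N. balanced_factor a b m x y k) =
      (\<Prod>k=1..N. balanced_factor a b m x y k) * balanced_factor a b m x y (Suc N)"
    by (subst prod.cl_ivl_Suc, rule if_not_P) simp
  ultimately show ?case using step.IH by (simp only:)
qed (simp add: balanced_coeff_def)

lemma X_power_mult_balanced_product_nth:
  assumes "n \<le> N"
  shows "(fps_X ^ e * (\<Prod>k=1..N. balanced_factor a b m x y k)) $ n =
    zext (balanced_coeff a b m x y) (int n - int e)"
proof (cases "n < e")
  case True
  then show ?thesis by (simp add: fps_X_power_mult_nth zext_def)
next
  case False
  then have "nat (int n - int e) = n - e" by (simp add: nat_diff_distrib)
  then show ?thesis
    using False assms by (simp add: fps_X_power_mult_nth zext_def euler_product_nth del: One_nat_def)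
qed

text \<open>Multiples of m are never congruent to a or b, so the theta factors join those already
  present in the neutral product. For x = 1 this is the exponent 3 = 1 + 2.\<close>

lemma balanced_product:
  assumes ab: "a + b = m" "0 < a" "0 < b"
    and f: "\<And>k. 0 < k \<Longrightarrow> balanced_factor a b m x y k =
      (if [k = a] (mod m) \<or> [k = b] (mod m) then 1
       else (1 + fps_const y * fps_X ^ k) * inverse (1 - fps_const x * fps_X ^ k)) *
      (if m dvd k then f k else 1)"
  shows "(\<Prod>k=1..M. f (m * k)) * neutral_product a b m x y (m * M) = (\<Prod>k=1..m * M. balanced_factor a b m x y k)"
proof -
  have m: "0 < m" using ab by simp
  have "(\<Prod>k=1..m * M. balanced_factor a b m x y k) = (\<Prod>k=1..m * M.
      (if [k = a] (mod m) \<or> [k = b] (mod m) then 1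
       else (1 + fps_const y * fps_X ^ k) * inverse (1 - fps_const x * fps_X ^ k)) *
      (if m dvd k then f k else 1))"
    by (rule prod.cong) (simp_all only: f atLeastAtMost_iff, simp add: f)
  also have "\<dots> = (\<Prod>k=1..m * M. if [k = a] (mod m) \<or> [k = b] (mod m) then 1
       else (1 + fps_const y * fps_X ^ k) * inverse (1 - fps_const x * fps_X ^ k)) *
      (\<Prod>k=1..m * M. if m dvd k then f k else 1)"
    by (rule prod.distrib)
  also have "(\<Prod>k=1..m * M. if [k = a] (mod m) \<or> [k = b] (mod m) then 1
       else (1 + fps_const y * fps_X ^ k) * inverse (1 - fps_const x * fps_X ^ k)) = neutral_product a b m x y (m * M)"
    unfolding neutral_product_def by (rule prod.mono_neutral_cong_right) auto
  also have "(\<Prod>k=1..m * M. if m dvd k then f k else 1) = (\<Prod>k\<in>(\<lambda>k. m * k) ` {1..M}. f k)"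
    using m by (intro prod.mono_neutral_cong_right) (auto elim!: dvdE simp: image_iff)
  also have "\<dots> = (\<Prod>k=1..M. f (m * k))"
    using m by (subst prod.reindex) (auto simp: inj_on_def)
  finally show ?thesis by (simp only: mult.commute)
qed

text \<open>The scalar will be 1 or 2, the latter for overpartitions. Monotonicity holds because 1 -
  q^m cancels one of the factors 1 / (1 - q^m) and leaves a nonnegative series.\<close>

lemma slow_balanced_coeff:
  assumes ab: "a + b = m" "0 < a" "0 < b" and xy: "(x, y) \<in> {(1, 0), (0, 1), (1, 1)}" and c: "0 < c"
  shows "slow_sequence (\<lambda>n. c * balanced_coeff a b m x y n) m"
proof
  let ?\<alpha> = "balanced_alpha a b m x y" and ?\<beta> = "balanced_beta a b m x y"
  let ?P = "\<lambda>N. \<Prod>k=1..N. balanced_factor a b m x y k"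
  show m: "0 < m" using ab by simp
  have not_res: "\<not> ([k = a] (mod m) \<or> [k = b] (mod m))" if "m dvd k" for k
  proof -
    have "k mod m = 0" "a mod m = a" "b mod m = b" using that ab by auto
    then show ?thesis using ab unfolding cong_def by simp
  qed
  have nonneg: "fps_nonneg (balanced_factor a b m x y k)" if "0 < k" for k
    unfolding balanced_factor_def using that by (rule euler_factor_nonneg)
  have P_nonneg: "fps_nonneg (?P N)" for N by (intro fps_nonneg_prod nonneg) simp
  show "0 \<le> c * balanced_coeff a b m x y n" for n
    using c fps_nonnegD[OF P_nonneg] unfolding balanced_coeff_def by (intro mult_nonneg_nonneg) simp_all
  have diff: "(?P n * (1 - fps_X ^ m)) $ n = balanced_coeff a b m x y n - balanced_coeff a b m x y (n - m)"
    if "m \<le> n" for n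
    using that by (simp add: right_diff_distrib fps_X_power_mult_right_nth euler_product_nth del: One_nat_def)
  show "c * balanced_coeff a b m x y (n - m) \<le> c * balanced_coeff a b m x y n" if n: "m \<le> n" for n
  proof -
    have \<beta>: "?\<beta> m = Suc (?\<beta> m - 1)"
      using not_res[of m] by (simp add: balanced_beta_def)
    have inv: "inverse (1 - fps_X ^ m) * (1 - fps_X ^ m :: real fps) = 1"
      using m by (intro inverse_mult_eq_1) simp
    have pow: "inverse (1 - fps_X ^ m) ^ ?\<beta> m = inverse (1 - fps_X ^ m) * inverse (1 - fps_X ^ m :: real fps) ^ (?\<beta> m - 1)"
      by (subst \<beta>) (rule power_Suc)
    have "?P n = balanced_factor a b m x y m * (\<Prod>k\<in>{1..n} - {m}. balanced_factor a b m x y k)"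
      using n m by (intro prod.remove) auto
    then have "?P n * (1 - fps_X ^ m) = inverse (1 - fps_X ^ m) * (1 - fps_X ^ m) *
        ((1 + fps_X ^ m) ^ ?\<alpha> m * inverse (1 - fps_X ^ m) ^ (?\<beta> m - 1)) *
        (\<Prod>k\<in>{1..n} - {m}. balanced_factor a b m x y k)"
      unfolding balanced_factor_def[of a b m x y] euler_factor_def[of _ _ m] pow by (simp only: mult_ac)
    also have "fps_nonneg \<dots>"
      unfolding inv using m by (intro fps_nonneg_intros nonneg) auto
    finally have "0 \<le> (?P n * (1 - fps_X ^ m)) $ n" by (rule fps_nonnegD)
    then show ?thesis unfolding diff[OF n] using c by (intro mult_left_mono) auto
  qed
  show "\<exists>n\<^sub>0. \<forall>n\<ge>n\<^sub>0. m \<le> n \<longrightarrow> c * balanced_coeff a b m x y n - c * balanced_coeff a b m x y (n - m) \<le>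
      \<epsilon> * (c * balanced_coeff a b m x y n)" if \<epsilon>: "0 < \<epsilon>" for \<epsilon>
  proof -
    have bnd: "?\<alpha> k \<le> 3" "?\<beta> k \<le> 3" for k
      by (simp_all add: balanced_alpha_def balanced_beta_def)
    have pos: "0 < ?\<alpha> k + ?\<beta> k \<longleftrightarrow> \<not> ([k = a] (mod m) \<or> [k = b] (mod m))" for k
      using xy by (auto simp: balanced_alpha_def balanced_beta_def)
    have per: "0 < ?\<alpha> k' + ?\<beta> k'" if "[k = k'] (mod m)" "0 < ?\<alpha> k + ?\<beta> k" for k k'
      using that unfolding pos by (auto simp: cong_def)
    have mult: "1 \<le> ?\<beta> k" if "m dvd k" for k
      using not_res[OF that] that by (simp add: balanced_beta_def)
    obtain n\<^sub>0 where n\<^sub>0: "\<And>n N. n\<^sub>0 \<le> n \<Longrightarrow> n \<le> N \<Longrightarrow>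
        ((\<Prod>k=1..N. euler_factor ?\<alpha> ?\<beta> k) * (1 - fps_X ^ m)) $ n \<le> \<epsilon> * (\<Prod>k=1..N. euler_factor ?\<alpha> ?\<beta> k) $ n"
      by (rule euler_product_difference_small[OF m \<epsilon> bnd per mult]; (assumption | erule that))
    have "c * balanced_coeff a b m x y n - c * balanced_coeff a b m x y (n - m) \<le>
      \<epsilon> * (c * balanced_coeff a b m x y n)" if "n\<^sub>0 \<le> n" "m \<le> n" for n
    proof -
      have "balanced_coeff a b m x y n - balanced_coeff a b m x y (n - m) \<le> \<epsilon> * balanced_coeff a b m x y n"
        using n\<^sub>0[OF that(1) order_refl] diff[OF that(2)] by (simp add: balanced_factor_def balanced_coeff_def)
      then have "c * (balanced_coeff a b m x y n - balanced_coeff a b m x y (n - m)) \<le> c * (\<epsilon> * balanced_coeff a b m x y n)"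
        using c by (intro mult_left_mono) auto
      then show ?thesis by (simp only: right_diff_distrib mult.left_commute)
    qed
    then show ?thesis by blast
  qed
qed

section \<open>Counts by excess through \<open>balanced_coeff\<close>\<close>

context
  fixes a b m :: nat
  assumes ab: "a + b = m" "0 < a" "0 < b" "a \<noteq> b"
begin

lemma m_pos: "0 < m"
  using ab by simp

lemma charge_count_cong:
  assumes "n < M" "d \<le> M"
    and "fps_eq_upto M (\<Sum>k<Suc M. (fps_X ^ m) ^ k * core_coeff m x y k * core_coeff m x y (k + d)) (S * f)"
  shows "charge_count n a b m x y d = (fps_X ^ (a * d) * S * (f * neutral_product a b m x y (m * M))) $ n"
proof -
  have "charge_count n a b m x y d = (fps_X ^ (a * d) * (S * f) * neutral_product a b m x y (m * M)) $ n"
    unfolding charge_count_eq[OF ab assms(1,2)]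
    by (rule fps_eq_upto_nth[OF _ assms(1)]) (intro fps_eq_upto_mult fps_eq_upto_refl assms(3))
  then show ?thesis by (simp only: mult.assoc)
qed

lemma alternating_series_nth:
  assumes "n \<le> N"
  shows "(fps_X ^ (a * d) * (\<Sum>j<L. (-1) ^ j * (fps_X ^ m) ^ (s j + j * d)) *
      (\<Prod>k=1..N. balanced_factor a b m x y k)) $ n =
    (\<Sum>j<L. (-1) ^ j * zext (balanced_coeff a b m x y) (int n - int (a * d + m * (s j + j * d))))"
  unfolding sum_distrib_left sum_distrib_right fps_sum_nth
proof (rule sum.cong)
  fix j
  have sign: "(-1) ^ j = (fps_const ((-1) ^ j) :: real fps)"
    by (induction j) (simp_all add: fps_const_neg[symmetric] del: fps_const_neg)
  have "fps_X ^ (a * d) * ((-1) ^ j * (fps_X ^ m) ^ (s j + j * d)) * (\<Prod>k=1..N. balanced_factor a b m x y k) =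
      fps_const ((-1) ^ j) * (fps_X ^ (a * d + m * (s j + j * d)) * (\<Prod>k=1..N. balanced_factor a b m x y k))"
    unfolding sign power_add power_mult by (simp only: mult_ac)
  then show "(fps_X ^ (a * d) * ((-1) ^ j * (fps_X ^ m) ^ (s j + j * d)) * (\<Prod>k=1..N. balanced_factor a b m x y k)) $ n =
      (-1) ^ j * zext (balanced_coeff a b m x y) (int n - int (a * d + m * (s j + j * d)))"
    by (simp only: fps_mult_left_const_nth X_power_mult_balanced_product_nth[OF assms])
qed simp

lemma not_residue_multiple: "m dvd k \<Longrightarrow> \<not> [k = a] (mod m) \<and> \<not> [k = b] (mod m)"
proof -
  assume "m dvd k"
  then have "k mod m = 0" "a mod m = a" "b mod m = b" using ab by auto
  then show ?thesis using ab unfolding cong_def by simp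
qed

lemma balanced_product_partitions:
  "core_coeff m 1 0 M ^ 2 * neutral_product a b m 1 0 (m * M) = (\<Prod>k=1..m * M. balanced_factor a b m 1 0 k)"
proof -
  have "(\<Prod>k=1..M. inverse (1 - fps_X ^ (m * k)) ^ 2) * neutral_product a b m 1 0 (m * M) =
      (\<Prod>k=1..m * M. balanced_factor a b m 1 0 k)"
    by (rule balanced_product[OF ab(1-3), where f = "\<lambda>k. inverse (1 - fps_X ^ k) ^ 2"])
      (use not_residue_multiple in \<open>auto simp: balanced_factor_def euler_factor_def balanced_alpha_def balanced_beta_def
        power2_eq_square power3_eq_cube\<close>)
  then show ?thesis
    by (simp only: core_coeff_partitions_prod[OF m_pos] prod_power_distrib power_mult)
qed

lemma balanced_product_overpartitions:
  "(\<Prod>k=1..M. (1 + (fps_X ^ m) ^ k) * inverse (1 - (fps_X ^ m) ^ k)) ^ 2 * neutral_product a b m 1 1 (m * M) =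
    (\<Prod>k=1..m * M. balanced_factor a b m 1 1 k)"
proof -
  have "(\<Prod>k=1..M. ((1 + fps_X ^ (m * k)) * inverse (1 - fps_X ^ (m * k))) ^ 2) * neutral_product a b m 1 1 (m * M) =
      (\<Prod>k=1..m * M. balanced_factor a b m 1 1 k)"
    by (rule balanced_product[OF ab(1-3), where f = "\<lambda>k. ((1 + fps_X ^ k) * inverse (1 - fps_X ^ k)) ^ 2"])
      (use not_residue_multiple in \<open>auto simp: balanced_factor_def euler_factor_def balanced_alpha_def balanced_beta_def
        power2_eq_square power3_eq_cube mult_ac\<close>)
  then show ?thesis
    by (simp only: prod_power_distrib power_mult)
qed

lemma balanced_product_distinct:
  "core_coeff m 1 0 M * neutral_product a b m 0 1 (m * M) = (\<Prod>k=1..m * M. balanced_factor a b m 0 1 k)"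
proof -
  have "(\<Prod>k=1..M. inverse (1 - fps_X ^ (m * k))) * neutral_product a b m 0 1 (m * M) =
      (\<Prod>k=1..m * M. balanced_factor a b m 0 1 k)"
    by (rule balanced_product[OF ab(1-3), where f = "\<lambda>k. inverse (1 - fps_X ^ k)"])
      (use not_residue_multiple in \<open>auto simp: balanced_factor_def euler_factor_def balanced_alpha_def balanced_beta_def\<close>)
  then show ?thesis
    by (simp only: core_coeff_partitions_prod[OF m_pos] power_mult)
qed

lemma le_mult_Suc: "n \<le> m * Suc n"
  using m_pos by (cases m) auto

lemma charge_count_partitions:
  assumes "d \<le> n"
  shows "charge_count n a b m 1 0 d = (\<Sum>j<n + 2. (-1) ^ j *
    zext (balanced_coeff a b m 1 0) (int n - int (a * d + m * (j * (j + 1) div 2 + j * d))))"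
proof -
  \<comment> \<open>Just enough to reach coefficient n; the \<open>Suc M\<close> terms of the series
    are the n + 2 of the claim.\<close>
  define M where "M = Suc n"
  have M: "n < M" "d \<le> M" "n \<le> m * M" using assms le_mult_Suc by (simp_all add: M_def)
  let ?S = "\<Sum>j<Suc M. (-1) ^ j * (fps_X ^ m) ^ (j * (j + 1) div 2 + j * d) :: real fps"
  have "fps_eq_upto M (\<Sum>k<Suc M. (fps_X ^ m) ^ k * core_coeff m 1 0 k * core_coeff m 1 0 (k + d))
      (?S * core_coeff m 1 0 M ^ 2)"
    using charge_sum_partitions[OF m_pos, of M d] by (simp only: mult.commute)
  from charge_count_cong[OF M(1,2) this] show ?thesis
    unfolding balanced_product_partitions
    using alternating_series_nth[OF M(3), where d = d and L = "Suc M" and s = "\<lambda>j. j * (j + 1) div 2"] by (simp add: M_def)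
qed

lemma charge_count_distinct:
  assumes "d \<le> n"
  shows "charge_count n a b m 0 1 d =
    zext (balanced_coeff a b m 0 1) (int n - int (a * d + m * pred_triangle d))"
proof -
  define M where "M = Suc n"
  have M: "n < M" "d \<le> M" "n \<le> m * M" using assms le_mult_Suc by (simp_all add: M_def)
  have "charge_count n a b m 0 1 d = (fps_X ^ (a * d) * (fps_X ^ m) ^ pred_triangle d *
      (core_coeff m 1 0 M * neutral_product a b m 0 1 (m * M))) $ n"
    by (rule charge_count_cong[OF M(1,2)]) (use charge_sum_distinct[OF m_pos, of M d] in \<open>simp only: pred_triangle_def\<close>)
  also have "fps_X ^ (a * d) * (fps_X ^ m) ^ pred_triangle d = (fps_X ^ (a * d + m * pred_triangle d) :: real fps)"
    by (simp only: power_add power_mult)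
  finally show ?thesis
    unfolding balanced_product_distinct by (simp only: X_power_mult_balanced_product_nth[OF M(3)])
qed

text \<open>With G the product of (1 + q^k) / (1 - q^k), the charge sum is 2 G^2 / (1 + q^d). For d
  > 0 the divisor expands into an alternating geometric series; at d = 0 it is 2 and cancels the
  factor, hence the separate case.\<close>

lemma charge_count_overpartitions:
  assumes "d \<le> n"
  shows "0 < d \<Longrightarrow> charge_count n a b m 1 1 d = (\<Sum>j<n + 2. (-1) ^ j *
    (2 * zext (balanced_coeff a b m 1 1) (int n - int (a * d + m * (0 + j * d)))))"
    and charge_count_overpartitions_0: "charge_count n a b m 1 1 0 = balanced_coeff a b m 1 1 n"
proof -
  define M where "M = Suc n"
  have M: "n < M" "n \<le> m * M" using le_mult_Suc by (simp_all add: M_def)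
  define q where "q = (fps_X ^ m :: real fps)"
  define E where "E = core_coeff m 1 1"
  define G where "G = (\<Prod>k=1..M. (1 + q ^ k) * inverse (1 - q ^ k))"
  define C where "C = (\<lambda>d. \<Sum>k<Suc M. q ^ k * E k * E (k + d))"
  define S where "S = (\<Sum>j<Suc M. (-1) ^ j * q ^ (0 + j * d))"
  have EG: "fps_eq_upto M (E M ^ 2) (4 * G ^ 2)"
  proof -
    have "fps_eq_upto M (E M * E M) (2 * G * (2 * G))"
      unfolding E_def G_def q_def by (intro fps_eq_upto_mult core_coeff_overpartitions m_pos)
    then show ?thesis by (simp add: power2_eq_square mult_ac)
  qed
  have CE: "fps_eq_upto M (2 * C d' * (1 + q ^ d')) (4 * G ^ 2)" for d'
    using fps_eq_upto_trans[OF _ EG] charge_sum_overpartitions[OF m_pos, of M d']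
    unfolding C_def E_def q_def by blast
  have "fps_eq_upto M (4 * C 0) (4 * G ^ 2)" using CE[of 0] by simp
  then have "fps_eq_upto M (C 0) (1 * G ^ 2)"
    unfolding mult_1_left by (rule fps_eq_upto_cancel) simp
  then have "charge_count n a b m 1 1 0 = (fps_X ^ (a * 0) * 1 * (G ^ 2 * neutral_product a b m 1 1 (m * M))) $ n"
    unfolding C_def E_def q_def by (intro charge_count_cong M) simp_all
  also have "G ^ 2 * neutral_product a b m 1 1 (m * M) = (\<Prod>k=1..m * M. balanced_factor a b m 1 1 k)"
    unfolding G_def q_def by (rule balanced_product_overpartitions)
  finally show "charge_count n a b m 1 1 0 = balanced_coeff a b m 1 1 n"
    using euler_product_nth[OF M(2)] by simp
  show "charge_count n a b m 1 1 d = (\<Sum>j<n + 2. (-1) ^ j *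
    (2 * zext (balanced_coeff a b m 1 1) (int n - int (a * d + m * (0 + j * d)))))" if d_pos: "0 < d"
  proof -
    have "(1 + q ^ d) * (\<Sum>j<l. (-1) ^ j * q ^ (0 + j * d)) = 1 - (-1) ^ l * q ^ (l * d)" for l
      by (induction l) (simp_all add: algebra_simps power_add)
    then have "S * (1 + q ^ d) = 1 - q ^ (Suc M * d) * (-1) ^ Suc M"
      unfolding S_def by (simp only: mult.commute)
    moreover have "M \<le> Suc M * d" using d_pos by (cases d) auto
    then have "fps_eq_upto M (1 - q ^ (Suc M * d) * (-1) ^ Suc M) 1"
      unfolding q_def by (intro fps_eq_upto_add_q_power m_pos)
    ultimately have S1: "fps_eq_upto M (S * (1 + q ^ d)) 1" by (simp only:)
    have "fps_eq_upto M (2 * C d * 1) (2 * C d * (S * (1 + q ^ d)))"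
      by (intro fps_eq_upto_mult fps_eq_upto_refl fps_eq_upto_sym[OF S1])
    also have "2 * C d * (S * (1 + q ^ d)) = S * (2 * C d * (1 + q ^ d))" by (simp only: mult_ac)
    also have "fps_eq_upto M \<dots> (S * (4 * G ^ 2))"
      by (intro fps_eq_upto_mult fps_eq_upto_refl CE)
    also have "S * (4 * G ^ 2) = 2 * (2 * S * G ^ 2)" by (simp add: mult_ac)
    finally have "fps_eq_upto M (2 * C d) (2 * (2 * S * G ^ 2))" by simp
    then have "fps_eq_upto M (C d) (2 * S * G ^ 2)" by (rule fps_eq_upto_cancel) simp
    then have "charge_count n a b m 1 1 d = (fps_X ^ (a * d) * (2 * S) * (G ^ 2 * neutral_product a b m 1 1 (m * M))) $ n"
      unfolding C_def E_def q_def using assms by (intro charge_count_cong M) (simp_all add: M_def)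
    also have "G ^ 2 * neutral_product a b m 1 1 (m * M) = (\<Prod>k=1..m * M. balanced_factor a b m 1 1 k)"
      unfolding G_def q_def by (rule balanced_product_overpartitions)
    also have "fps_X ^ (a * d) * (2 * S) * (\<Prod>k=1..m * M. balanced_factor a b m 1 1 k) =
        fps_const 2 * (fps_X ^ (a * d) * S * (\<Prod>k=1..m * M. balanced_factor a b m 1 1 k))"
      by (simp only: numeral_fps_const mult_ac)
    finally show ?thesis
      unfolding fps_mult_left_const_nth S_def q_def alternating_series_nth[OF M(2), where d = d and L = "Suc M" and s = "\<lambda>_. 0"]
      by (simp add: M_def sum_distrib_left mult.left_commute)
  qed
qed

end

lemma alternating_progression_limit:
  assumes "0 < m" "0 < a"
  shows "(\<lambda>J. \<Sum>j<2 * J. (-1) ^ j / real (a + m * j)) \<longlonglongrightarrow>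
    (Digamma (1 / 2 + real a / real m / 2) - Digamma (real a / real m / 2)) / 2 / real m"
proof -
  have "(\<lambda>J. (\<Sum>j<2 * J. (-1) ^ j / (real a / real m + real j)) / real m) \<longlonglongrightarrow>
    (Digamma (1 / 2 + real a / real m / 2) - Digamma (real a / real m / 2)) / 2 / real m"
    using assms by (intro tendsto_divide tendsto_const alternating_sums_Digamma) auto
  moreover have "(\<Sum>j<2 * J. (-1) ^ j / (real a / real m + real j)) / real m =
      (\<Sum>j<2 * J. (-1) ^ j / real (a + m * j))" for J
    unfolding sum_divide_distrib
  proof (intro sum.cong refl)
    fix j
    have "(real a / real m + real j) * real m = real (a + m * j)" using assms by (simp add: field_simps)
    then show "(-1) ^ j / (real a / real m + real j) / real m = (-1) ^ j / real (a + m * j)"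
      by (simp only: divide_divide_eq_left)
  qed
  ultimately show ?thesis by (simp only:)
qed

theorem theorem1p3:
  fixes a m :: nat and x y :: real
  assumes "1 \<le> a" and "real a < real m / 2"
    and "(x, y) \<in> {(1, 0), (0, 1), (1, 1)}"
  shows "(\<lambda>n. biased_count n a (m - a) m x y)
           \<sim>[at_top] (\<lambda>n. bias_const a m x * weighted_count n x y)"
proof -
  define b where "b = m - a"
  have ab: "a + b = m" "0 < a" "0 < b" "a \<noteq> b" "a \<le> b" and am: "2 * a < m" and m: "0 < m"
    using assms(1,2) by (auto simp: b_def)
  have ba: "b + a = m" "0 < b" "0 < a" "b \<noteq> a" using ab by simp_all
  define S where "S = (\<lambda>c. (Digamma (1 / 2 + real c / real m / 2) - Digamma (real c / real m / 2)) / 2 / real m)"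
  have lim: "(\<lambda>J. \<Sum>j<2 * J. (-1) ^ j / real (c + m * j)) \<longlonglongrightarrow> S c" if "0 < c" for c
    unfolding S_def by (rule alternating_progression_limit[OF m that])
  have S_pos: "0 < S c" if "0 < c" for c
    unfolding S_def using m that by (intro divide_pos_pos) (auto intro!: Digamma_real_strict_mono)
  \<comment> \<open>\<open>S\<close> carries a factor 1 / m, which cancels in the ratio.\<close>
  have const: "bias_const a m 1 = S a / (S a + S b)"
  proof -
    have scale: "p / (p + p') = p / r / (p / r + p' / r)" if "0 < r" for p p' r :: real
      using that by (simp add: add_divide_distrib[symmetric])
    show ?thesis unfolding bias_const_eq(1)[OF assms(1) am] S_def b_def by (rule scale) (use m in simp)
  qed
  let ?h = "balanced_coeff a b m x y"
  interpret slow_sequence "\<lambda>n. 1 * ?h n" m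
    by (rule slow_balanced_coeff[OF ab(1-3) assms(3)]) simp
  have h_eq: "(\<lambda>n. 1 * ?h n) = ?h" by simp
  have weighted: "weighted_count n x y = biased_count n a b m x y + biased_count n b a m x y + charge_count n a b m x y 0" for n
    by (rule weighted_count_eq)
  have pos: "0 < weighted_count n x y" for n by (rule weighted_count_pos[OF assms(3)])
  have zext_scale: "zext (\<lambda>n. 2 * h n) i = 2 * zext h i" for h i by (simp add: zext_def)
  have "(\<lambda>n. biased_count n a b m x y / weighted_count n x y) \<longlonglongrightarrow> bias_const a m x"
  proof -
    consider "x = 1" "y = 0" | "x = 0" "y = 1" | "x = 1" "y = 1" using assms(3) by auto
    then show ?thesis
    proof cases
      case 1
      have count: "biased_count n c c' m 1 0 = (\<Sum>d=1..n. \<Sum>j<n + 2. (-1) ^ j *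
          zext (balanced_coeff a b m 1 0) (int n - int (c * d + m * (j * (j + 1) div 2 + j * d))))"
        if "(c, c') = (a, b) \<or> (c, c') = (b, a)" for c c' n
        using that charge_count_partitions[OF ab(1-4)] charge_count_partitions[OF ba]
        by (auto simp: biased_count_eq_sum balanced_coeff_commute[of b a] intro!: sum.cong)
      \<comment> \<open>At d = 0 the terms of the alternating series decrease, so the count is at
        most the first of them.\<close>
      have zero: "0 \<le> charge_count n a b m 1 0 0" "charge_count n a b m 1 0 0 \<le> ?h n" for n
      proof -
        show "0 \<le> charge_count n a b m 1 0 0" unfolding charge_count_def by (intro sum_nonneg) simp
        let ?t = "\<lambda>j. zext ?h (int n - int (m * (j * (j + 1) div 2)))"
        have "charge_count n a b m 1 0 0 = (\<Sum>j<n + 2. (-1) ^ j * ?t j)"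
          using charge_count_partitions[OF ab(1-4), of 0 n] by (simp add: 1)
        also have "\<dots> \<le> ?t 0"
        proof (rule alternating_sum_bounds(2))
          fix j
          show "0 \<le> ?t j" using H_nonneg by (simp only: h_eq)
          have "Suc j * (Suc j + 1) div 2 = j * (j + 1) div 2 + Suc j"
          proof -
            have "Suc j * (Suc j + 1) = j * (j + 1) + Suc j * 2" by simp
            then show ?thesis by (metis div_mult_self1 add.commute zero_neq_numeral)
          qed
          then have "int n - int (m * (Suc j * (Suc j + 1) div 2)) =
              int n - int (m * (j * (j + 1) div 2)) - int m * int (Suc j)"
            by (simp add: distrib_left)
          then show "?t (Suc j) \<le> ?t j" using H_mono unfolding h_eq by metis
        qed
        finally show "charge_count n a b m 1 0 0 \<le> ?h n" by (simp add: zext_def)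
      qed
      have "(\<lambda>n. biased_count n a b m x y / weighted_count n x y) \<longlonglongrightarrow> S a / (S a + S b)"
      proof (rule alternating_counts_ratio[OF ab(1-3), where s = "\<lambda>j. j * (j + 1) div 2" and L = "\<lambda>n. n + 2"
            and G = "\<lambda>n. biased_count n b a m x y" and Z = "\<lambda>n. charge_count n a b m x y 0"])
        show "j * (j + 1) div 2 \<le> Suc j * (Suc j + 1) div 2" for j by (intro div_le_mono mult_le_mono) auto
        show "0 < S a + S b" using S_pos[OF ab(2)] S_pos[OF ab(3)] by simp
      qed (use lim ab weighted pos zero in \<open>simp_all only: h_eq 1 count simp_thms mult_1_left le_add1\<close>)
      then show ?thesis using const 1 by simp
    next
      case 2
      have count: "biased_count n c c' m 0 1 = (\<Sum>d=1..n.
          zext (balanced_coeff a b m 0 1) (int n - int (c * d + m * pred_triangle d)))"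
        if "(c, c') = (a, b) \<or> (c, c') = (b, a)" for c c' n
        using that charge_count_distinct[OF ab(1-4)] charge_count_distinct[OF ba]
        by (auto simp: biased_count_eq_sum balanced_coeff_commute[of b a] intro!: sum.cong)
      have zero: "charge_count n a b m 0 1 0 = ?h n" for n
        using charge_count_distinct[OF ab(1-4), of 0 n] by (simp add: 2 pred_triangle_def zext_def)
      have "(\<lambda>n. biased_count n a b m x y / weighted_count n x y) \<longlonglongrightarrow> 1 / 2"
        by (rule triangular_counts_ratio[OF ab(1,2,5), where G = "\<lambda>n. biased_count n b a m x y"])
          (use weighted pos zero in \<open>simp_all only: h_eq 2 count simp_thms mult_1_left\<close>)
      then show ?thesis using 2 by (simp add: bias_const_def)
    next
      case 3
      \<comment> \<open>Doubling absorbs the factor 2 in the counts of positive excess; the zero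
        excess count, without that factor, stays below the doubled sequence.\<close>
      interpret two: slow_sequence "\<lambda>n. 2 * ?h n" m
        by (rule slow_balanced_coeff[OF ab(1-3) assms(3)]) simp
      have count: "biased_count n c c' m 1 1 = (\<Sum>d=1..n. \<Sum>j<n + 2. (-1) ^ j *
          zext (\<lambda>n. 2 * balanced_coeff a b m 1 1 n) (int n - int (c * d + m * (0 + j * d))))"
        if "(c, c') = (a, b) \<or> (c, c') = (b, a)" for c c' n
        using that charge_count_overpartitions[OF ab(1-4)] charge_count_overpartitions[OF ba]
        by (auto simp: biased_count_eq_sum balanced_coeff_commute[of b a] zext_scale intro!: sum.cong)
      have zero: "0 \<le> charge_count n a b m 1 1 0" "charge_count n a b m 1 1 0 \<le> 2 * ?h n" for n
        using charge_count_overpartitions_0[OF ab(1-4) le0, of n] h_nonneg[of n] by (simp_all add: 3)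
      have "(\<lambda>n. biased_count n a b m x y / weighted_count n x y) \<longlonglongrightarrow> S a / (S a + S b)"
      proof (rule two.alternating_counts_ratio[OF ab(1-3), where s = "\<lambda>j. 0" and L = "\<lambda>n. n + 2"
            and G = "\<lambda>n. biased_count n b a m x y" and Z = "\<lambda>n. charge_count n a b m x y 0"])
        show "0 < S a + S b" using S_pos[OF ab(2)] S_pos[OF ab(3)] by simp
      qed (use lim ab weighted pos zero in \<open>simp_all only: 3 count simp_thms le_add1 order_refl\<close>)
      then show ?thesis using const 3 by simp
    qed
  qed
  moreover have c_pos: "0 < bias_const a m x"
    using assms(3) const S_pos[OF ab(2)] S_pos[OF ab(3)] by (auto simp: bias_const_def[of a m 0])
  ultimately have "(\<lambda>n. biased_count n a b m x y / weighted_count n x y / bias_const a m x) \<longlonglongrightarrow>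
      bias_const a m x / bias_const a m x"
    by (intro tendsto_divide tendsto_const) auto
  then have "(\<lambda>n. biased_count n a b m x y / (bias_const a m x * weighted_count n x y)) \<longlonglongrightarrow> 1"
    using c_pos by (simp add: divide_divide_eq_left mult.commute)
  then show ?thesis unfolding b_def by (rule asymp_equivI')
qed

end
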